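(* Let $B^{(1/2)}_t=B_t+\frac12 t$, $t\ge 0$, be a Brownian motion with drift $1/2$ started from $B^{(1/2)}_0=0$. Then the following three identities in law hold. (a) For $a>0$ and $r=\log((1+a)/a)$, $$\int_0^\infty (a\exp(B^{(1/2)}_s)+1)^{-2}\,ds\ \stackrel{(d)}{=}\ H_r(\beta^{(1/2)}),$$ where $\beta^{(1/2)}$ is a Brownian motion with drift $1/2$ started at $0$. (b) For $a>0$ and $r=\log((1+a)/a)$, $$\int_0^\infty (a\exp(B^{(1/2)}_s)+1)^{-2}\,\mathbf{1}_{\{B^{(1/2)}_s>0\}}\,ds\ \stackrel{(d)}{=}\ H_r(\tilde\beta^{(1/2)}),$$ where $\tilde\beta^{(1/2)}$ is a reflecting Brownian motion with drift $1/2$ started at $0$. (c) For $a>-1$, $$\int_0^\infty (a\exp(B^{(1/2)}_s)+1)^{-2}\,\mathbf{1}_{\{B^{(1/2)}_s<0\}}\,ds\ \stackrel{(d)}{=}\ H_\lambda(\beta^{(1/2)}),$$ where $\beta^{(1/2)}$ is a Brownian motion with drift $1/2$ started at $0$ and $\lambda$ is a random variable independent of $\beta^{(1/2)}$ and exponentially distributed with parameter $1+a$.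
   Context: $\stackrel{(d)}{=}$ means "is identical in law with". For a process $Z$ and a (possibly random) level $y$, $H_y(Z):=\inf\{t:\ Z_t=y\}$. A reflecting Brownian motion with drift $\mu$ started at $0$ is the solution of Skorokhod's reflection equation on $[0,\infty)$ driven by a Brownian motion with drift, i.e. the process $W_t+\mu t+\sup_{s\le t}\{-(W_s+\mu s)\}$ with $W$ a standard Brownian motion started at $0$. An exponential distribution with parameter $c$ has density $c\,e^{-cx}$ on $(0,\infty)$. *)

theory Defs
  imports "HOL-Probability.Probability"
begin

text \<open>Processes are indexed by real time; only times \<open>t \<ge> 0\<close> are constrained.\<close>

locale standard_brownian_motion = prob_space M
  for M :: "'a measure" and W :: "real \<Rightarrow> 'a \<Rightarrow> real" +
  assumes measurable_W: "\<And>t. 0 \<le> t \<Longrightarrow> W t \<in> borel_measurable M"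
    and start_zero: "\<And>\<omega>. \<omega> \<in> space M \<Longrightarrow> W 0 \<omega> = 0"
    and continuous_paths: "\<And>\<omega>. \<omega> \<in> space M \<Longrightarrow> continuous_on {0..} (\<lambda>t. W t \<omega>)"
    and normal_increments: "\<And>s t. 0 \<le> s \<Longrightarrow> s < t \<Longrightarrow>
      distributed M lborel (\<lambda>\<omega>. W t \<omega> - W s \<omega>) (normal_density 0 (sqrt (t - s)))"
    and independent_increments: "\<And>(\<tau> :: nat \<Rightarrow> real) n. 0 \<le> \<tau> 0 \<Longrightarrow>
      (\<And>i. i < n \<Longrightarrow> \<tau> i \<le> \<tau> (Suc i)) \<Longrightarrow>
      indep_vars (\<lambda>_. borel) (\<lambda>i \<omega>. W (\<tau> (Suc i)) \<omega> - W (\<tau> i) \<omega>) {..<n}"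

definition brownian_motion_with_drift ::
    "'a measure \<Rightarrow> real \<Rightarrow> (real \<Rightarrow> 'a \<Rightarrow> real) \<Rightarrow> bool" where
  "brownian_motion_with_drift M \<mu> X \<longleftrightarrow>
    (\<exists>W. standard_brownian_motion M W \<and>
      (\<forall>t\<ge>0. \<forall>\<omega>\<in>space M. X t \<omega> = W t \<omega> + \<mu> * t))"

text \<open>The added supremum is the regulator in Skorokhod's reflection equation on \<open>[0,\<infinity>)\<close>.
  By path continuity it is a supremum of a bounded set of reals.\<close>

definition reflecting_brownian_motion_with_drift ::
    "'a measure \<Rightarrow> real \<Rightarrow> (real \<Rightarrow> 'a \<Rightarrow> real) \<Rightarrow> bool" where
  "reflecting_brownian_motion_with_drift M \<mu> R \<longleftrightarrow>
    (\<exists>X. brownian_motion_with_drift M \<mu> X \<and>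
      (\<forall>t\<ge>0. \<forall>\<omega>\<in>space M. R t \<omega> = X t \<omega> + (SUP s\<in>{0..t}. - X s \<omega>)))"

text \<open>The level may be random; the value is \<open>\<infinity>\<close> if the level is never attained
  (\<open>Inf {} = \<infinity>\<close> in \<^typ>\<open>ennreal\<close>).\<close>

definition hitting_time :: "(real \<Rightarrow> 'a \<Rightarrow> real) \<Rightarrow> ('a \<Rightarrow> real) \<Rightarrow> 'a \<Rightarrow> ennreal" where
  "hitting_time Z y \<omega> = Inf {ennreal t | t. 0 \<le> t \<and> Z t \<omega> = y \<omega>}"

text \<open>Measurability is part of the definition because \<^const>\<open>distr\<close> is only meaningful for
  measurable functions.\<close>

definition identical_in_law ::
    "'a measure \<Rightarrow> ('a \<Rightarrow> 'c::topological_space) \<Rightarrow> 'b measure \<Rightarrow> ('b \<Rightarrow> 'c) \<Rightarrow> bool" where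
  "identical_in_law M X N Y \<longleftrightarrow>
    X \<in> borel_measurable M \<and> Y \<in> borel_measurable N \<and> distr M borel X = distr N borel Y"

text \<open>Independence of the sigma-algebras generated by a process (as a random element of the
  path space over \<open>[0,\<infinity>)\<close> with the product sigma-algebra) and by a real random
  variable; \<open>indep_var\<close> requires both to have the same value type.\<close>

definition process_indep_var ::
    "'a measure \<Rightarrow> (real \<Rightarrow> 'a \<Rightarrow> real) \<Rightarrow> ('a \<Rightarrow> real) \<Rightarrow> bool" where
  "process_indep_var M Z y \<longleftrightarrow>
    prob_space.indep_set M
      (sets (vimage_algebra (space M) (\<lambda>\<omega>. \<lambda>t\<in>{0..}. Z t \<omega>) (PiM {0..} (\<lambda>_. borel))))
      (sets (vimage_algebra (space M) y borel))"

end

theory Submission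
  imports Defs "HOL-Real_Asymp.Real_Asymp"
begin

text \<open>Both sides of each identity have values in \<open>[0,\<infinity>]\<close>, so it suffices to compare the Laplace
  transforms at \<open>\<mu> = 1, 2, \<dots>\<close>, and with \<open>\<mu> = \<rho> (1 + \<rho>) / 2\<close> all of them are explicit. If \<open>g\<close> solves
  \<open>g''/2 + g'/2 = f g\<close>, then \<open>g (B t) exp (- \<integral>f (B s) ds)\<close> is a martingale; letting \<open>t \<rightarrow> \<infinity>\<close> when
  \<open>g \<rightarrow> 1\<close> at infinity gives the left-hand sides, and stopping when \<open>g\<close> reaches the value \<open>1\<close> gives the
  hitting times. Stochastic calculus is avoided by using this only for the random walk observed on a
  grid of mesh \<open>T/n\<close>, where Dynkin's formula is a finite telescoping sum over independent Gaussian
  increments whose error terms vanish by dominated convergence. For the hitting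
  times one obtains bounds for slightly smaller and slightly larger levels, and continuity in the level
  closes the gap.\<close>

section \<open>Laplace transforms of extended nonnegative random variables\<close>

text \<open>The roots of \<open>x * (1 + x) / 2 = \<mu>\<close> are \<open>\<rho>\<close> and
  \<open>- (1 + \<rho>)\<close>, the growth rates of the exponential solutions for constant
  \<open>f\<close>; the same two exponents return in the coordinate
  \<open>y = ln (1 + exp (- x) / a)\<close> for the integrands of the theorem. For positive
  \<open>a\<close>, the level \<open>r\<close> is the value of \<open>y\<close> at the starting
  point 0, while \<open>y\<close> tends to 0 at infinity. The parameter \<open>1 + a\<close> is the
  reciprocal of \<open>- dy/dx\<close> at 0 and enters through the matching of slopes there. The
  obstacles are of regularity. The indicators make \<open>f\<close> jump at 0, so \<open>g\<close>
  is only C1 with a bounded second derivative off a finite set; an exceptional point either has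
  probability 0 at each fixed time or lies outside the region where the walk still runs. A stopped
  walk overshoots its level, and the test functions must therefore be bounded above it as well.
  Reflection is imitated by taking absolute values after each step: an even test function does not
  see this, so the increments are still free Gaussian ones.\<close>

definition exp_neg :: "ennreal \<Rightarrow> real" where
  "exp_neg x = (if x = \<top> then 0 else exp (- enn2real x))"

lemma exp_neg_ennreal [simp]: "0 \<le> t \<Longrightarrow> exp_neg (ennreal t) = exp (- t)"
  by (simp add: exp_neg_def)

lemma exp_neg_top [simp]: "exp_neg \<top> = 0"
  by (simp add: exp_neg_def)

lemma exp_neg_nonneg: "0 \<le> exp_neg x" and exp_neg_le_1: "exp_neg x \<le> 1"
  by (auto simp: exp_neg_def)

lemma measurable_exp_neg [measurable]: "exp_neg \<in> borel_measurable borel"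
  unfolding exp_neg_def[abs_def] by measurable

lemma exp_neg_antimono: "x \<le> y \<Longrightarrow> exp_neg y \<le> exp_neg x"
  by (cases x; cases y) (auto simp: exp_neg_def top_unique)

text \<open>This turns the Laplace transform at \<open>n\<close> into the \<open>n\<close>-th moment
  of a \<open>[0,1]\<close>-valued variable.\<close>

lemma exp_neg_of_nat_mult:
  assumes "n > 0" shows "exp_neg (of_nat n * x) = exp_neg x ^ n"
proof (cases x)
  case (real t)
  have "of_nat n * x = ennreal (real n * t)"
    using real by (simp add: ennreal_mult ennreal_of_nat_eq_real_of_nat)
  then show ?thesis using real by (simp flip: exp_of_nat_mult)
next
  case top
  then show ?thesis using assms by (simp add: ennreal_mult_eq_top_iff zero_power)
qed

text \<open>The value 0 at \<open>\<top>\<close> makes \<open>exp_neg\<close> continuous at infinity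
  too, so functionals that diverge need no separate treatment.\<close>

lemma tendsto_exp_neg:
  assumes "(f \<longlongrightarrow> x) F" shows "((\<lambda>y. exp_neg (f y)) \<longlongrightarrow> exp_neg x) F"
proof (cases x)
  case (real t)
  have ev: "\<forall>\<^sub>F y in F. f y < \<top>"
    by (rule order_tendstoD[OF assms]) (simp add: real)
  have "((\<lambda>y. exp (- enn2real (f y))) \<longlongrightarrow> exp (- t)) F"
    using assms real by (intro tendsto_intros tendsto_enn2real) auto
  moreover have "\<forall>\<^sub>F y in F. exp (- enn2real (f y)) = exp_neg (f y)"
    using ev by eventually_elim (auto simp: exp_neg_def)
  ultimately show ?thesis using real by (simp add: tendsto_cong)
next
  case top
  show ?thesis
  proof (rule order_tendstoI)
    fix a assume "a < exp_neg x" then show "\<forall>\<^sub>F y in F. a < exp_neg (f y)"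
      using exp_neg_nonneg top by (auto intro!: always_eventually intro: less_le_trans)
  next
    fix a assume a: "exp_neg x < a"
    then have a0: "0 < a" using top by simp
    \<comment> \<open>\<open>exp (ln a - 1) < a\<close>, hence the constant 1; the maximum with 0
      keeps \<open>ennreal K\<close> faithful to \<open>K\<close>.\<close>
    define K where "K = max 0 (1 - ln a)"
    have "\<forall>\<^sub>F y in F. ennreal K < f y"
      by (rule order_tendstoD[OF assms]) (simp add: top)
    then show "\<forall>\<^sub>F y in F. exp_neg (f y) < a"
    proof eventually_elim
      case (elim y)
      have "exp_neg (f y) \<le> exp_neg (ennreal K)" using elim by (intro exp_neg_antimono) simp
      also have "\<dots> = exp (-K)" by (rule exp_neg_ennreal) (simp add: K_def)
      also have "\<dots> < exp (ln a)" unfolding K_def by (subst exp_less_cancel_iff) linarith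
      finally show ?case using a0 by simp
    qed
  qed
qed

text \<open>Both characteristic functions are limits of the same Taylor polynomials, since moments
  bounded by 1 leave a remainder of order \<open>\<bar>t\<bar>^n / fact n\<close>. Levy's uniqueness
  theorem then applies.\<close>

lemma distr_eqI_moments:
  assumes "prob_space M" "prob_space N"
    and X[measurable]: "X \<in> borel_measurable M" and Y[measurable]: "Y \<in> borel_measurable N"
    and X01: "\<And>\<omega>. \<bar>X \<omega>\<bar> \<le> (1::real)" and Y01: "\<And>\<omega>. \<bar>Y \<omega>\<bar> \<le> (1::real)"
    and mom: "\<And>n. (\<integral>\<omega>. X \<omega> ^ n \<partial>M) = (\<integral>\<omega>. Y \<omega> ^ n \<partial>N)"
  shows "distr M borel X = distr N borel Y"
proof -
  interpret M: prob_space M by fact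
  interpret N: prob_space N by fact
  interpret X: real_distribution "distr M borel X" by (rule M.real_distribution_distr) simp
  interpret Y: real_distribution "distr N borel Y" by (rule N.real_distribution_distr) simp
  have le1: "\<bar>x ^ k\<bar> \<le> 1" if "\<bar>x\<bar> \<le> 1" for x :: real and k
    using that by (simp add: power_abs power_le_one)
  have iX: "integrable M (\<lambda>\<omega>. X \<omega> ^ k)" for k
    by (rule M.integrable_const_bound[of _ 1]) (auto simp: le1 X01)
  have iY: "integrable N (\<lambda>\<omega>. Y \<omega> ^ k)" for k
    by (rule N.integrable_const_bound[of _ 1]) (auto simp: le1 Y01)
  have "char (distr M borel X) t = char (distr N borel Y) t" for t :: real
  proof -
    let ?S = "\<lambda>n::nat. \<Sum>k\<le>n. ((\<i> * complex_of_real t)^k / fact k) * complex_of_real (\<integral>\<omega>. X \<omega> ^ k \<partial>M)"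
    have ex0: "(\<lambda>n::nat. 2 * \<bar>t\<bar>^n / fact n) \<longlonglongrightarrow> (0::real)"
      using tendsto_mult_right_zero[OF summable_LIMSEQ_zero[OF summable_exp[of "\<bar>t\<bar>"]], of 2]
      by (simp add: field_simps)
    have bX: "cmod (char (distr M borel X) t - ?S n) \<le> 2 * \<bar>t\<bar>^n / fact n" for n :: nat
    proof -
      have "(\<integral>\<omega>. \<bar>X \<omega>\<bar> ^ n \<partial>M) \<le> 1"
        using M.integral_le_const[of "\<lambda>\<omega>. \<bar>X \<omega>\<bar> ^ n" 1] iX[of n, THEN integrable_abs]
        by (auto simp: power_abs le1[unfolded power_abs] X01)
      then have "(2 * \<bar>t\<bar>^n / fact n) * (\<integral>\<omega>. \<bar>X \<omega>\<bar> ^ n \<partial>M) \<le> (2 * \<bar>t\<bar>^n / fact n) * 1"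
        by (intro mult_left_mono) auto
      then show ?thesis
        using M.char_approx1'[OF iX X refl, where n=n and t=t] by simp
    qed
    have bY: "cmod (char (distr N borel Y) t - ?S n) \<le> 2 * \<bar>t\<bar>^n / fact n" for n :: nat
    proof -
      have "(\<integral>\<omega>. \<bar>Y \<omega>\<bar> ^ n \<partial>N) \<le> 1"
        using N.integral_le_const[of "\<lambda>\<omega>. \<bar>Y \<omega>\<bar> ^ n" 1] iY[of n, THEN integrable_abs]
        by (auto simp: power_abs le1[unfolded power_abs] Y01)
      then have "(2 * \<bar>t\<bar>^n / fact n) * (\<integral>\<omega>. \<bar>Y \<omega>\<bar> ^ n \<partial>N) \<le> (2 * \<bar>t\<bar>^n / fact n) * 1"
        by (intro mult_left_mono) auto
      then show ?thesis
        using N.char_approx1'[OF iY Y refl, where n=n and t=t] by (simp add: mom)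
    qed
    have "?S \<longlonglongrightarrow> char (distr M borel X) t"
      by (rule LIM_zero_cancel, rule Lim_null_comparison[OF always_eventually ex0])
        (use bX in \<open>auto simp: norm_minus_commute\<close>)
    moreover have "?S \<longlonglongrightarrow> char (distr N borel Y) t"
      by (rule LIM_zero_cancel, rule Lim_null_comparison[OF always_eventually ex0])
        (use bY in \<open>auto simp: norm_minus_commute\<close>)
    ultimately show ?thesis by (rule LIMSEQ_unique)
  qed
  then show ?thesis
    by (intro Levy_uniqueness X.real_distribution_axioms Y.real_distribution_axioms) auto
qed

text \<open>\<open>exp_neg\<close> carries both laws into \<open>[0,1]\<close> without losing
  information, and there the moments, which are the transforms at the integers, determine a
  law.\<close>

lemma identical_in_law_if_laplace_eq:
  assumes "prob_space M" "prob_space N"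
    and X[measurable]: "X \<in> borel_measurable M" and Y[measurable]: "Y \<in> borel_measurable N"
    and eq: "\<And>n::nat. n > 0 \<Longrightarrow>
      (\<integral>\<omega>. exp_neg (of_nat n * X \<omega>) \<partial>M) = (\<integral>\<omega>. exp_neg (of_nat n * Y \<omega>) \<partial>N)"
  shows "identical_in_law M X N Y"
proof -
  interpret M: prob_space M by fact
  interpret N: prob_space N by fact
  \<comment> \<open>A measurable left inverse of \<open>exp_neg\<close>; 0 has to go back to
    \<open>\<top>\<close>, and negative arguments never occur.\<close>
  define inv where "inv = (\<lambda>u::real. if u \<le> 0 then (\<top>::ennreal) else ennreal (- ln u))"
  have [measurable]: "inv \<in> borel_measurable borel" unfolding inv_def by measurable
  have inv: "inv (exp_neg x) = x" for x
    by (cases x) (auto simp: inv_def)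
  have mom: "(\<integral>\<omega>. exp_neg (X \<omega>) ^ n \<partial>M) = (\<integral>\<omega>. exp_neg (Y \<omega>) ^ n \<partial>N)" for n
    using eq[of n] by (cases "n = 0") (auto simp: exp_neg_of_nat_mult M.prob_space N.prob_space)
  have abs1: "\<bar>exp_neg x\<bar> \<le> 1" for x
    using exp_neg_nonneg exp_neg_le_1 by simp
  have e: "distr M borel (\<lambda>\<omega>. exp_neg (X \<omega>)) = distr N borel (\<lambda>\<omega>. exp_neg (Y \<omega>))"
    by (rule distr_eqI_moments) (auto simp: mom abs1 assms(1,2))
  have "distr M borel X = distr (distr M borel (\<lambda>\<omega>. exp_neg (X \<omega>))) borel inv"
    by (subst distr_distr) (auto simp: o_def inv)
  also have "\<dots> = distr N borel Y"
    unfolding e by (subst distr_distr) (auto simp: o_def inv)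
  finally show ?thesis by (simp add: identical_in_law_def)
qed

section \<open>The transition operator and its generator\<close>

lemma integrable_std_normal_iff:
  fixes f :: "real \<Rightarrow> real"
  assumes [measurable]: "f \<in> borel_measurable borel"
  shows "integrable std_normal_distribution f \<longleftrightarrow> integrable lborel (\<lambda>x. std_normal_density x * f x)"
  by (subst integrable_density) auto

lemma integral_std_normal_eq:
  fixes f :: "real \<Rightarrow> real"
  assumes [measurable]: "f \<in> borel_measurable borel"
  shows "(\<integral>x. f x \<partial>std_normal_distribution) = (\<integral>x. std_normal_density x * f x \<partial>lborel)"
  by (subst integral_density) auto

lemma prob_space_std_normal: "prob_space std_normal_distribution"
  by (rule prob_space_normal_density) simp

lemma measure_std_normal_UNIV [simp]: "measure std_normal_distribution UNIV = 1"
  using prob_space.prob_space[OF prob_space_std_normal] by simp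

lemma std_normal_first_two_moments:
  shows "integrable std_normal_distribution (\<lambda>z. z)"
    and "(\<integral>z. z \<partial>std_normal_distribution) = 0"
    and "integrable std_normal_distribution (\<lambda>z. z\<^sup>2)"
    and "(\<integral>z. z\<^sup>2 \<partial>std_normal_distribution) = 1"
  using integrable_std_normal_moment[of 1] integral_std_normal_moment_odd[of 0]
    integrable_std_normal_moment[of 2] integral_std_normal_moment_even[of 1]
  by (auto simp: integrable_std_normal_iff integral_std_normal_eq)

text \<open>\<open>sqrt h * z + h / 2\<close> is the increment over a time \<open>h\<close>. Its
  mean is \<open>h / 2\<close> and its second moment is \<open>h\<close> up to order two, which is
  where the generator \<open>g'' / 2 + g' / 2\<close> comes from.\<close>

lemma step_moments:
  fixes h :: real assumes "0 \<le> h"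
  shows "integrable std_normal_distribution (\<lambda>z. sqrt h * z + h / 2)"
    and "(\<integral>z. sqrt h * z + h / 2 \<partial>std_normal_distribution) = h / 2"
    and "integrable std_normal_distribution (\<lambda>z. (sqrt h * z + h / 2)\<^sup>2)"
    and "(\<integral>z. (sqrt h * z + h / 2)\<^sup>2 \<partial>std_normal_distribution) = h + h\<^sup>2 / 4"
proof -
  interpret N: prob_space std_normal_distribution by (rule prob_space_std_normal)
  note m = std_normal_first_two_moments
  have e: "(sqrt h * z + h / 2)\<^sup>2 = h * z\<^sup>2 + (h * sqrt h) * z + h\<^sup>2 / 4" for z
    using assms by (simp add: power2_sum power_mult_distrib power_divide)
  show "integrable std_normal_distribution (\<lambda>z. sqrt h * z + h / 2)"
    "integrable std_normal_distribution (\<lambda>z. (sqrt h * z + h / 2)\<^sup>2)"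
    unfolding e using m by (auto simp del: integrable_mult_left_iff)
  show "(\<integral>z. sqrt h * z + h / 2 \<partial>std_normal_distribution) = h / 2"
    using m by (simp add: N.prob_space)
  have "(\<integral>z. (sqrt h * z + h / 2)\<^sup>2 \<partial>std_normal_distribution)
    = (\<integral>z. h * z\<^sup>2 + (h * sqrt h) * z \<partial>std_normal_distribution) + (\<integral>z. h\<^sup>2 / 4 \<partial>std_normal_distribution)"
    unfolding e using m by (intro Bochner_Integration.integral_add) auto
  also have "\<dots> = h + h\<^sup>2 / 4"
    using m by (subst Bochner_Integration.integral_add) (auto simp: N.prob_space)
  finally show "(\<integral>z. (sqrt h * z + h / 2)\<^sup>2 \<partial>std_normal_distribution) = h + h\<^sup>2 / 4" .
qed

text \<open>Transition operator over a time \<open>h\<close> of a Brownian motion with drift \<open>1/2\<close>.\<close>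

definition step_op :: "real \<Rightarrow> (real \<Rightarrow> real) \<Rightarrow> real \<Rightarrow> real" where
  "step_op h g x = (\<integral>z. g (x + (sqrt h * z + h / 2)) \<partial>std_normal_distribution)"

text \<open>\<open>g2\<close> may jump on \<open>S\<close>: it does so at 0 when \<open>f\<close>
  does, and at the seams where a test function is continued. Continuity of \<open>g1\<close>
  everywhere keeps the one-step error of order \<open>h\<close> even across these points.\<close>

locale piecewise_C2 =
  fixes S :: "real set" and g g1 g2 :: "real \<Rightarrow> real" and C :: real
  assumes finite_S: "finite S"
    and deriv_g: "\<And>x. (g has_real_derivative g1 x) (at x)"
    and cont_g1: "\<And>x. isCont g1 x"
    and deriv_g1: "\<And>x. x \<notin> S \<Longrightarrow> (g1 has_real_derivative g2 x) (at x)"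
    and cont_g2: "\<And>x. x \<notin> S \<Longrightarrow> isCont g2 x"
    and bound_g: "\<And>x. \<bar>g x\<bar> \<le> C" and bound_g1: "\<And>x. \<bar>g1 x\<bar> \<le> C" and bound_g2: "\<And>x. \<bar>g2 x\<bar> \<le> C"
begin

lemma C_nonneg: "0 \<le> C"
  using bound_g[of 0] by linarith

lemma cont_g: "isCont g x"
  using deriv_g by (rule DERIV_isCont)

lemma measurable_g [measurable]: "g \<in> borel_measurable borel"
  by (rule borel_measurable_continuous_onI) (auto simp: continuous_on_eq_continuous_at cont_g)

lemma g_lipschitz: "\<bar>g y - g x\<bar> \<le> C * \<bar>y - x\<bar>"
proof -
  have *: "\<bar>g y - g x\<bar> \<le> C * \<bar>y - x\<bar>" if xy: "x < y" for x y
  proof -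
    obtain z where "g y - g x = (y - x) * g1 z"
      using MVT2[OF xy, of g g1] deriv_g by blast
    then show ?thesis using bound_g1[of z] xy by (simp add: abs_mult mult.commute mult_right_mono)
  qed
  show ?thesis
    using *[of x y] *[of y x] by (cases x y rule: linorder_cases) (auto simp: abs_minus_commute)
qed

text \<open>The fundamental theorem of calculus tolerates finitely many exceptional points, so
  \<open>g1\<close> need not be differentiable on \<open>S\<close>.\<close>

lemma g1_lipschitz: "\<bar>g1 y - g1 x\<bar> \<le> C * \<bar>y - x\<bar>"
proof -
  have *: "\<bar>g1 y - g1 x\<bar> \<le> C * \<bar>y - x\<bar>" if xy: "x \<le> y" for x y
  proof -
    have "(g2 has_integral (g1 y - g1 x)) {x..y}"
      by (rule fundamental_theorem_of_calculus_interior_strong[OF finite_S xy])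
        (auto simp: has_real_derivative_iff_has_vector_derivative[symmetric] deriv_g1
          intro!: continuous_at_imp_continuous_on cont_g1)
    then have "norm (g1 y - g1 x) \<le> C * measure lborel (cbox x y)"
      by (intro has_integral_bound[OF C_nonneg]) (auto simp: bound_g2)
    then show ?thesis using xy by simp
  qed
  show ?thesis
    using *[of x y] *[of y x] by (cases "x \<le> y") (auto simp: abs_minus_commute)
qed

text \<open>Only the linear term is split off: its expectation under a step is exactly
  \<open>g1 x * h / 2\<close>, and the rest can be estimated without a second derivative at
  \<open>x\<close>.\<close>

definition rem :: "real \<Rightarrow> real \<Rightarrow> real" where
  "rem x d = g (x + d) - g x - g1 x * d"

lemma measurable_rem [measurable]: "rem x \<in> borel_measurable borel"
  unfolding rem_def[abs_def] by measurable

text \<open>The mean value theorem writes the remainder as \<open>d * (g1 \<xi> - g1 x)\<close>, and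
  \<open>g1\<close> is Lipschitz. The estimate therefore survives steps that cross
  \<open>S\<close>.\<close>

lemma rem_bound: "\<bar>rem x d\<bar> \<le> C * d\<^sup>2"
proof -
  have *: "\<exists>\<xi>. g (x + d) - g x = d * g1 \<xi> \<and> \<bar>\<xi> - x\<bar> \<le> \<bar>d\<bar>"
  proof (cases d "0::real" rule: linorder_cases)
    case greater
    then obtain z where "x < z" "z < x + d" "g (x + d) - g x = (x + d - x) * g1 z"
      using MVT2[of x "x + d" g g1] deriv_g by auto
    then show ?thesis by (intro exI[of _ z]) auto
  next
    case less
    then obtain z where "x + d < z" "z < x" "g x - g (x + d) = (x - (x + d)) * g1 z"
      using MVT2[of "x + d" x g g1] deriv_g by auto
    then show ?thesis by (intro exI[of _ z]) (auto simp: algebra_simps)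
  qed auto
  then obtain \<xi> where \<xi>: "g (x + d) - g x = d * g1 \<xi>" "\<bar>\<xi> - x\<bar> \<le> \<bar>d\<bar>" by blast
  have "\<bar>rem x d\<bar> = \<bar>d\<bar> * \<bar>g1 \<xi> - g1 x\<bar>"
    unfolding rem_def \<xi>(1) by (simp add: algebra_simps flip: abs_mult)
  also have "\<dots> \<le> \<bar>d\<bar> * (C * \<bar>d\<bar>)"
    using g1_lipschitz[of \<xi> x] mult_left_mono[OF \<xi>(2) C_nonneg] by (intro mult_left_mono) auto
  also have "\<dots> = C * d\<^sup>2" by (simp add: power2_eq_square)
  finally show ?thesis .
qed

lemma rem_eq:
  assumes "\<And>y. \<bar>y - x\<bar> \<le> \<bar>d\<bar> \<Longrightarrow> y \<notin> S"
  obtains \<xi> where "\<bar>\<xi> - x\<bar> \<le> \<bar>d\<bar>" "rem x d = g2 \<xi> * d\<^sup>2 / 2"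
proof (cases "d = 0")
  case True
  then show ?thesis using that[of x] by (simp add: rem_def)
next
  case False
  define D where "D = (\<lambda>m::nat. if m = 0 then g else if m = 1 then g1 else g2)"
  have "\<exists>t. (if x + d < x then x + d < t \<and> t < x else x < t \<and> t < x + d) \<and>
      g (x + d) = (\<Sum>m<2. D m x / fact m * (x + d - x) ^ m) + D 2 t / fact 2 * (x + d - x) ^ 2"
  proof (rule Taylor[where a="x - \<bar>d\<bar>" and b="x + \<bar>d\<bar>"])
    show "\<forall>m t. m < 2 \<and> x - \<bar>d\<bar> \<le> t \<and> t \<le> x + \<bar>d\<bar> \<longrightarrow> (D m has_real_derivative D (Suc m) t) (at t)"
    proof (intro allI impI)
      fix m :: nat and t assume m: "m < 2 \<and> x - \<bar>d\<bar> \<le> t \<and> t \<le> x + \<bar>d\<bar>"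
      then have "t \<notin> S" by (intro assms) auto
      then show "(D m has_real_derivative D (Suc m) t) (at t)"
        using m deriv_g[of t] deriv_g1[of t] by (cases m) (simp_all add: D_def)
    qed
  qed (use False in \<open>auto simp: D_def\<close>)
  then obtain t where "\<bar>t - x\<bar> \<le> \<bar>d\<bar>"
    "g (x + d) = (\<Sum>m<2. D m x / fact m * (x + d - x) ^ m) + D 2 t / fact 2 * (x + d - x) ^ 2"
    by (force split: if_splits)
  then show ?thesis by (intro that[of t]) (simp_all add: rem_def D_def numeral_2_eq_2)
qed

text \<open>The base point moves with \<open>n\<close> because it will be the position of the walk.
  Near a point off \<open>S\<close> the Lagrange form of the remainder is available and
  \<open>g2\<close> is continuous, so the intermediate points can be followed to
  \<open>x\<close>.\<close>

lemma rem_limit: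
  assumes x: "xs \<longlonglongrightarrow> x" "x \<notin> S" and d: "d \<longlonglongrightarrow> 0"
    and q: "(\<lambda>n. (d n)\<^sup>2 / h n) \<longlonglongrightarrow> q"
  shows "(\<lambda>n. rem (xs n) (d n) / h n) \<longlonglongrightarrow> g2 x * q / 2"
proof -
  have "open (- S)" using finite_S by (simp add: finite_imp_closed open_Compl)
  then obtain e where e: "e > 0" "\<And>y. \<bar>y - x\<bar> < e \<Longrightarrow> y \<notin> S"
    using x(2) unfolding open_dist by (auto simp: dist_real_def)
  \<comment> \<open>Half the radius for the base point and half for the step keep the whole segment
    inside the ball that avoids \<open>S\<close>.\<close>
  have ev: "\<forall>\<^sub>F n in sequentially. \<bar>xs n - x\<bar> < e / 2 \<and> \<bar>d n\<bar> < e / 2"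
    using tendstoD[OF x(1), of "e/2"] tendstoD[OF d, of "e/2"] e(1)
    by (auto simp: dist_real_def intro: eventually_conj)
  have "\<exists>\<xi>. \<bar>xs n - x\<bar> < e / 2 \<and> \<bar>d n\<bar> < e / 2 \<longrightarrow>
      \<bar>\<xi> - xs n\<bar> \<le> \<bar>d n\<bar> \<and> rem (xs n) (d n) = g2 \<xi> * (d n)\<^sup>2 / 2" for n
  proof (cases "\<bar>xs n - x\<bar> < e / 2 \<and> \<bar>d n\<bar> < e / 2")
    case True
    have "y \<notin> S" if "\<bar>y - xs n\<bar> \<le> \<bar>d n\<bar>" for y
      using True that by (intro e(2)) linarith
    with rem_eq[of "xs n" "d n"] show ?thesis by blast
  qed auto
  then have "\<forall>n. \<exists>\<xi>. \<bar>xs n - x\<bar> < e / 2 \<and> \<bar>d n\<bar> < e / 2 \<longrightarrow>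
      \<bar>\<xi> - xs n\<bar> \<le> \<bar>d n\<bar> \<and> rem (xs n) (d n) = g2 \<xi> * (d n)\<^sup>2 / 2" by blast
  from choice[OF this] obtain \<xi> where \<xi>: "\<And>n. \<bar>xs n - x\<bar> < e / 2 \<and> \<bar>d n\<bar> < e / 2 \<Longrightarrow>
      \<bar>\<xi> n - xs n\<bar> \<le> \<bar>d n\<bar> \<and> rem (xs n) (d n) = g2 (\<xi> n) * (d n)\<^sup>2 / 2"
    by blast
  have "(\<lambda>n. \<xi> n - xs n) \<longlonglongrightarrow> 0"
    by (rule Lim_null_comparison[OF _ tendsto_rabs_zero[OF d]]) (use ev \<xi> in \<open>auto elim!: eventually_mono\<close>)
  then have "\<xi> \<longlonglongrightarrow> x" using tendsto_add[OF _ x(1)] by fastforce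
  then have "(\<lambda>n. g2 (\<xi> n)) \<longlonglongrightarrow> g2 x" by (rule isCont_tendsto_compose[OF cont_g2[OF x(2)]])
  then have "(\<lambda>n. g2 (\<xi> n) * ((d n)\<^sup>2 / h n) / 2) \<longlonglongrightarrow> g2 x * q / 2"
    using q by (intro tendsto_intros) auto
  moreover have "\<forall>\<^sub>F n in sequentially. g2 (\<xi> n) * ((d n)\<^sup>2 / h n) / 2 = rem (xs n) (d n) / h n"
    using ev by eventually_elim (simp add: \<xi>)
  ultimately show ?thesis by (rule Lim_transform_eventually)
qed

lemma integrable_rem:
  assumes "0 \<le> h" shows "integrable std_normal_distribution (\<lambda>z. rem x (sqrt h * z + h / 2))"
proof (rule Bochner_Integration.integrable_bound)
  show "integrable std_normal_distribution (\<lambda>z. C * (sqrt h * z + h / 2)\<^sup>2)"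
    by (rule integrable_mult_right, rule step_moments(3)[OF assms])
  show "AE z in std_normal_distribution. norm (rem x (sqrt h * z + h / 2)) \<le> norm (C * (sqrt h * z + h / 2)\<^sup>2)"
    by (rule AE_I2) (metis rem_bound abs_ge_self order_trans real_norm_def)
qed measurable

lemma step_op_eq:
  assumes "0 \<le> h"
  shows "step_op h g x - g x
    = g1 x * h / 2 + (\<integral>z. rem x (sqrt h * z + h / 2) \<partial>std_normal_distribution)"
proof -
  interpret N: prob_space std_normal_distribution by (rule prob_space_std_normal)
  have "step_op h g x = (\<integral>z. (g x + g1 x * (sqrt h * z + h / 2)) + rem x (sqrt h * z + h / 2) \<partial>std_normal_distribution)"
    unfolding step_op_def rem_def by simp
  also have "\<dots> = (\<integral>z. g x + g1 x * (sqrt h * z + h / 2) \<partial>std_normal_distribution)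
      + (\<integral>z. rem x (sqrt h * z + h / 2) \<partial>std_normal_distribution)"
    using step_moments[OF assms] integrable_rem[OF assms]
    by (intro Bochner_Integration.integral_add) (auto simp del: integrable_mult_left_iff)
  also have "(\<integral>z. g x + g1 x * (sqrt h * z + h / 2) \<partial>std_normal_distribution) = g x + g1 x * (h / 2)"
    using step_moments[OF assms] by (subst Bochner_Integration.integral_add) auto
  finally show ?thesis by simp
qed

lemma step_op_bound: "\<bar>step_op h g x\<bar> \<le> C"
proof -
  interpret N: prob_space std_normal_distribution by (rule prob_space_std_normal)
  have "norm (step_op h g x) \<le> (\<integral>z. C \<partial>std_normal_distribution)"
    unfolding step_op_def
    by (rule Bochner_Integration.integral_norm_bound_integral[OF N.integrable_const_bound[of _ C]]) (auto simp: bound_g)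
  then show ?thesis by (simp add: N.prob_space)
qed

lemma step_op_diff_bound:
  assumes h: "0 \<le> h" "h \<le> 1" shows "\<bar>step_op h g x - g x\<bar> \<le> 2 * C * h"
proof -
  have "norm (\<integral>z. rem x (sqrt h * z + h / 2) \<partial>std_normal_distribution)
      \<le> (\<integral>z. C * (sqrt h * z + h / 2)\<^sup>2 \<partial>std_normal_distribution)"
    by (rule Bochner_Integration.integral_norm_bound_integral[OF integrable_rem[OF h(1)]
          integrable_mult_right[OF step_moments(3)[OF h(1)]]]) (simp add: rem_bound)
  also have "\<dots> = C * (h + h\<^sup>2 / 4)" using step_moments[OF h(1)] by simp
  finally have "\<bar>step_op h g x - g x\<bar> \<le> \<bar>g1 x\<bar> * h / 2 + C * (h + h\<^sup>2 / 4)"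
    unfolding step_op_eq[OF h(1)] using h by (auto simp: abs_mult intro!: order_trans[OF abs_triangle_ineq])
  also have "\<dots> \<le> C * h / 2 + C * (h + h / 4)"
    using h bound_g1[of x] C_nonneg power_decreasing[of 1 2 h]
    by (intro add_mono divide_right_mono mult_right_mono mult_left_mono) auto
  also have "\<dots> \<le> 2 * C * h" using mult_nonneg_nonneg[OF C_nonneg h(1)] by (simp add: algebra_simps)
  finally show ?thesis .
qed

text \<open>A bound of order \<open>h\<close> that is uniform in the position: after division by
  \<open>h\<close> it becomes the dominating constant for the error of the walk.\<close>

lemma generator_bound:
  assumes h: "0 \<le> h" and a: "0 \<le> a" "a \<le> F"
  shows "\<bar>exp (- h * a) * step_op h g x - g x\<bar> \<le> C * (2 + F) * h"
proof -
  have ha: "exp (- h * a) \<le> 1" "0 \<le> h * F" using h a by simp_all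
  have "1 - exp (- h * a) \<le> h * a" using exp_ge_add_one_self[of "- h * a"] by simp
  also have "\<dots> \<le> h * F" using h a by (intro mult_left_mono)
  finally have e: "\<bar>exp (- h * a) - 1\<bar> \<le> h * F" using ha by linarith
  have step: "\<bar>step_op h g x - g x\<bar> \<le> 2 * C * h"
  proof (cases "h \<le> 1")
    case True
    then show ?thesis using h by (intro step_op_diff_bound)
  next
    case False
    \<comment> \<open>For large \<open>h\<close> the trivial bound \<open>2 * C\<close> is already
      below \<open>2 * C * h\<close>.\<close>
    have "\<bar>step_op h g x - g x\<bar> \<le> 2 * C" using step_op_bound[of h x] bound_g[of x] by linarith
    also have "\<dots> \<le> 2 * C * h" using False C_nonneg mult_left_mono[of 1 h "2 * C"] by simp
    finally show ?thesis .
  qed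
  have "\<bar>(exp (- h * a) - 1) * step_op h g x\<bar> \<le> h * F * C"
    unfolding abs_mult using e step_op_bound ha by (intro mult_mono) auto
  moreover have "exp (- h * a) * step_op h g x - g x = (step_op h g x - g x) + (exp (- h * a) - 1) * step_op h g x"
    by (simp add: algebra_simps)
  ultimately have "\<bar>exp (- h * a) * step_op h g x - g x\<bar> \<le> 2 * C * h + h * F * C"
    using step by linarith
  then show ?thesis by (simp add: algebra_simps)
qed

text \<open>Position and killing rate vary with \<open>n\<close>, since along the grid they are
  values at approximating times. The limit is the generator minus the killing term, which the
  differential equation makes vanish.\<close>

lemma generator_limit:
  assumes x: "xs \<longlonglongrightarrow> x" "x \<notin> S" and h: "h \<longlonglongrightarrow> 0" "\<And>n. 0 < h n"
    and a: "as \<longlonglongrightarrow> a"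
  shows "(\<lambda>n. (exp (- h n * as n) * step_op (h n) g (xs n) - g (xs n)) / h n) \<longlonglongrightarrow> g2 x / 2 + g1 x / 2 - a * g x"
proof -
  interpret N: prob_space std_normal_distribution by (rule prob_space_std_normal)
  let ?R = "\<lambda>n z. rem (xs n) (sqrt (h n) * z + h n / 2) / h n"
  have sq: "(sqrt (h n) * z + h n / 2)\<^sup>2 / h n = (z + sqrt (h n) / 2)\<^sup>2" for n z
  proof -
    have "sqrt (h n) * z + h n / 2 = sqrt (h n) * (z + sqrt (h n) / 2)"
      using h(2)[of n] by (simp add: algebra_simps)
    then show ?thesis using h(2)[of n] by (simp add: power_mult_distrib)
  qed
  have h1: "\<forall>\<^sub>F n in sequentially. h n \<le> 1"
    using order_tendstoD(2)[OF h(1), of 1] by (auto elim: eventually_mono)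
  \<comment> \<open>The dominating function is valid for \<open>h n \<le> 1\<close>; the sequence is
    shifted so that this holds from its first term.\<close>
  obtain n0 where n0: "\<And>n. n \<ge> n0 \<Longrightarrow> h n \<le> 1"
    using h1 by (auto simp: eventually_sequentially)
  have "(\<lambda>n. \<integral>z. ?R (n + n0) z \<partial>std_normal_distribution) \<longlonglongrightarrow> (\<integral>z. g2 x * z\<^sup>2 / 2 \<partial>std_normal_distribution)"
  proof (rule integral_dominated_convergence[where w="\<lambda>z. C * (2 * z\<^sup>2 + 1)"])
    show "integrable std_normal_distribution (\<lambda>z. C * (2 * z\<^sup>2 + 1))"
      using std_normal_first_two_moments by (auto simp del: integrable_mult_left_iff)
    show "AE z in std_normal_distribution. (\<lambda>n. ?R (n + n0) z) \<longlonglongrightarrow> g2 x * z\<^sup>2 / 2"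
    proof (intro AE_I2 rem_limit)
      fix z
      show "(\<lambda>n. xs (n + n0)) \<longlonglongrightarrow> x" using x(1) by (rule LIMSEQ_ignore_initial_segment)
      have hn: "(\<lambda>n. h (n + n0)) \<longlonglongrightarrow> 0" using h(1) by (rule LIMSEQ_ignore_initial_segment)
      have sh: "(\<lambda>n. sqrt (h (n + n0))) \<longlonglongrightarrow> 0" using tendsto_real_sqrt[OF hn] by simp
      show "(\<lambda>n. sqrt (h (n + n0)) * z + h (n + n0) / 2) \<longlonglongrightarrow> 0"
        using tendsto_add[OF tendsto_mult_left_zero[OF sh, of z] tendsto_divide_zero[OF hn, of 2]] by simp
      have "(\<lambda>n. (z + sqrt (h (n + n0)) / 2)\<^sup>2) \<longlonglongrightarrow> (z + 0)\<^sup>2"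
        by (intro tendsto_intros tendsto_divide_zero sh)
      then show "(\<lambda>n. (sqrt (h (n + n0)) * z + h (n + n0) / 2)\<^sup>2 / h (n + n0)) \<longlonglongrightarrow> z\<^sup>2"
        unfolding sq by simp
    qed (rule x)
    fix n
    show "AE z in std_normal_distribution. norm (?R (n + n0) z) \<le> C * (2 * z\<^sup>2 + 1)"
    proof (rule AE_I2)
      fix z
      let ?h = "h (n + n0)"
      have hp: "0 < ?h" "?h \<le> 1" using h(2) n0 by auto
      have "norm (?R (n + n0) z) \<le> C * (sqrt ?h * z + ?h / 2)\<^sup>2 / ?h"
        using rem_bound hp by (simp add: divide_right_mono)
      also have "\<dots> = C * (z + sqrt ?h / 2)\<^sup>2" using sq[of "n + n0" z] by (metis times_divide_eq_right)
      also have "(z + sqrt ?h / 2)\<^sup>2 \<le> 2 * z\<^sup>2 + 1"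
      proof -
        \<comment> \<open>The parallelogram identity gives the dominating function without a case
          distinction on the sign of \<open>z\<close>.\<close>
        have "(z + sqrt ?h / 2)\<^sup>2 + (z - sqrt ?h / 2)\<^sup>2 = 2 * z\<^sup>2 + ?h / 2"
          using hp by (simp add: power2_eq_square field_simps)
        then show ?thesis using hp zero_le_power2[of "z - sqrt ?h / 2"] by linarith
      qed
      finally show "norm (?R (n + n0) z) \<le> C * (2 * z\<^sup>2 + 1)" using C_nonneg by (simp add: mult_left_mono)
    qed
  qed auto
  then have R: "(\<lambda>n. \<integral>z. ?R n z \<partial>std_normal_distribution) \<longlonglongrightarrow> g2 x / 2"
    using LIMSEQ_offset[of "\<lambda>n. \<integral>z. ?R n z \<partial>std_normal_distribution" n0] std_normal_first_two_moments by simp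
  have "(\<lambda>n. g1 (xs n) / 2 + (\<integral>z. ?R n z \<partial>std_normal_distribution)) \<longlonglongrightarrow> g1 x / 2 + g2 x / 2"
    by (intro tendsto_intros R isCont_tendsto_compose[OF cont_g1] x) auto
  then have P: "(\<lambda>n. (step_op (h n) g (xs n) - g (xs n)) / h n) \<longlonglongrightarrow> g1 x / 2 + g2 x / 2"
  proof (rule Lim_transform_eventually, intro always_eventually allI)
    fix n show "g1 (xs n) / 2 + (\<integral>z. ?R n z \<partial>std_normal_distribution) = (step_op (h n) g (xs n) - g (xs n)) / h n"
      using h(2)[of n] by (simp add: step_op_eq field_simps)
  qed
  have ha: "(\<lambda>n. - h n * as n) \<longlonglongrightarrow> 0" using tendsto_mult[OF tendsto_minus[OF h(1)] a] by simp
  have gx: "(\<lambda>n. g (xs n)) \<longlonglongrightarrow> g x" by (rule isCont_tendsto_compose[OF cont_g x(1)])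
  have E: "(\<lambda>n. (exp (- h n * as n) - 1) / h n) \<longlonglongrightarrow> - a"
  proof -
    \<comment> \<open>The difference quotient of \<open>exp\<close> at 0 with its gap filled, so
      that indices with \<open>as n = 0\<close> need no separate treatment.\<close>
    define \<phi> where "\<phi> = (\<lambda>u::real. if u = 0 then 1 else (exp u - 1) / u)"
    have "isCont \<phi> 0"
      unfolding isCont_def
    proof (rule Lim_transform_eventually)
      show "(\<lambda>y. (exp y - 1) / y) \<midarrow>0\<rightarrow> \<phi> 0"
        using DERIV_exp[of 0] by (simp add: \<phi>_def has_field_derivative_iff)
    qed (simp add: \<phi>_def eventually_at_filter)
    then have "(\<lambda>n. \<phi> (- h n * as n)) \<longlonglongrightarrow> \<phi> 0" by (rule isCont_tendsto_compose[OF _ ha])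
    then have "(\<lambda>n. \<phi> (- h n * as n) * (- as n)) \<longlonglongrightarrow> 1 * (- a)"
      by (intro tendsto_intros a) (simp add: \<phi>_def)
    moreover have "\<phi> (- h n * as n) * (- as n) = (exp (- h n * as n) - 1) / h n" for n
      using h(2)[of n] by (auto simp: \<phi>_def field_simps)
    ultimately show ?thesis by simp
  qed
  have "(\<lambda>n. exp (- h n * as n) * ((step_op (h n) g (xs n) - g (xs n)) / h n)
      + g (xs n) * ((exp (- h n * as n) - 1) / h n)) \<longlonglongrightarrow> exp 0 * (g1 x / 2 + g2 x / 2) + g x * (- a)"
    by (intro tendsto_intros P E ha gx)
  moreover have "exp (- h n * as n) * ((step_op (h n) g (xs n) - g (xs n)) / h n)
      + g (xs n) * ((exp (- h n * as n) - 1) / h n) = (exp (- h n * as n) * step_op (h n) g (xs n) - g (xs n)) / h n" for n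
    by (simp add: algebra_simps flip: add_divide_distrib diff_divide_distrib)
  ultimately show ?thesis by (simp add: algebra_simps)
qed

end

section \<open>Gaussian walks and Dynkin's formula\<close>

definition incr_law :: "real \<Rightarrow> real measure" where
  "incr_law h = distr std_normal_distribution borel (\<lambda>z. sqrt h * z + h / 2)"

lemma sets_incr_law [simp, measurable_cong]: "sets (incr_law h) = sets borel"
  and space_incr_law [simp]: "space (incr_law h) = UNIV"
  by (auto simp: incr_law_def)

lemma prob_space_incr_law: "prob_space (incr_law h)"
  unfolding incr_law_def by (rule prob_space.prob_space_distr[OF prob_space_std_normal]) simp

lemma step_op_eq_integral_incr_law:
  assumes [measurable]: "g \<in> borel_measurable borel"
  shows "step_op h g x = (\<integral>d. g (x + d) \<partial>incr_law h)"
  unfolding step_op_def incr_law_def by (subst integral_distr) auto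

text \<open>\<open>\<pi>\<close> is the identity for the walk itself and \<open>abs\<close> for the
  reflected walk.\<close>

primrec chain :: "(real \<Rightarrow> real) \<Rightarrow> (nat \<Rightarrow> real) \<Rightarrow> nat \<Rightarrow> real" where
  "chain \<pi> d 0 = 0"
| "chain \<pi> d (Suc k) = \<pi> (chain \<pi> d k + d k)"

text \<open>\<open>\<kappa>\<close> is the survival indicator and \<open>f\<close> the killing rate.\<close>

primrec weight :: "(real \<Rightarrow> real) \<Rightarrow> (real \<Rightarrow> real) \<Rightarrow> real \<Rightarrow> (nat \<Rightarrow> real) \<Rightarrow> nat \<Rightarrow> real" where
  "weight \<kappa> f h x 0 = 1"
| "weight \<kappa> f h x (Suc k) = weight \<kappa> f h x k * (\<kappa> (x k) * exp (- h * f (x k)))"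

text \<open>If \<open>\<kappa>\<close> is an indicator, this is the discounted value of \<open>g\<close> along \<open>x\<close>, frozen once \<open>\<kappa>\<close> has vanished.
  The recursive form makes its expectation telescope.\<close>

primrec stopped_value ::
  "(real \<Rightarrow> real) \<Rightarrow> (real \<Rightarrow> real) \<Rightarrow> real \<Rightarrow> (real \<Rightarrow> real) \<Rightarrow> (nat \<Rightarrow> real) \<Rightarrow> nat \<Rightarrow> real" where
  "stopped_value \<kappa> f h g x 0 = g (x 0)"
| "stopped_value \<kappa> f h g x (Suc k) = stopped_value \<kappa> f h g x k
    + weight \<kappa> f h x k * \<kappa> (x k) * (exp (- h * f (x k)) * g (x (Suc k)) - g (x k))"

lemma chain_cong: "(\<And>i. i < k \<Longrightarrow> d i = d' i) \<Longrightarrow> chain \<pi> d k = chain \<pi> d' k"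
  by (induction k) auto

lemma weight_cong: "(\<And>i. i < k \<Longrightarrow> x i = x' i) \<Longrightarrow> weight \<kappa> f h x k = weight \<kappa> f h x' k"
  by (induction k) auto

lemma weight_nonneg_le_1:
  assumes "\<And>x. 0 \<le> \<kappa> x" "\<And>x. \<kappa> x \<le> 1" "\<And>x. 0 \<le> f x" "0 \<le> h"
  shows "0 \<le> weight \<kappa> f h x k \<and> weight \<kappa> f h x k \<le> 1"
  by (induction k) (use assms in \<open>auto intro!: mult_le_one\<close>)

lemma weight_no_stop: "weight (\<lambda>_. 1) f h x k = exp (- (\<Sum>j<k. h * f (x j)))"
  by (induction k) (auto simp: exp_add[symmetric])

lemma stopped_value_no_stop:
  "stopped_value (\<lambda>_. 1) f h g x k = exp (- (\<Sum>j<k. h * f (x j))) * g (x k)"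
  by (induction k) (simp_all add: weight_no_stop algebra_simps exp_add exp_minus exp_diff divide_inverse)

text \<open>\<open>\<sigma>\<close> is the first index at which the walk is at or above
  \<open>r\<close>, capped at \<open>n\<close>; when it equals \<open>n\<close> the walk may be on
  either side of \<open>r\<close>. The clause on the weight is carried along for the induction,
  where it multiplies the next increment.\<close>

lemma stopped_value_cases:
  "\<exists>\<sigma>\<le>n. stopped_value (indicator {..<r}) (\<lambda>_. \<mu>) h g x n = exp (- \<mu> * (h * \<sigma>)) * g (x \<sigma>) \<and>
    (\<forall>j<\<sigma>. x j < r) \<and> (\<sigma> < n \<longrightarrow> r \<le> x \<sigma>) \<and>
    weight (indicator {..<r}) (\<lambda>_. \<mu>) h x n = (if \<sigma> = n then exp (- \<mu> * (h * n)) else 0)"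
  (is "\<exists>\<sigma>\<le>n. ?P n \<sigma>")
proof (induction n)
  case 0
  show ?case by (intro exI[of _ 0]) auto
next
  case (Suc n)
  then obtain \<sigma> where \<sigma>: "\<sigma> \<le> n" "?P n \<sigma>" by blast
  show ?case
  proof (cases "\<sigma> = n \<and> x n < r")
    case True
    then have "?P (Suc n) (Suc n)"
      using \<sigma> by (auto simp: algebra_simps exp_add exp_minus exp_diff divide_inverse less_Suc_eq)
    then show ?thesis by blast
  next
    case False
    then have "?P (Suc n) \<sigma>" using \<sigma> by (auto simp: le_less)
    then show ?thesis using \<sigma> by (intro exI[of _ \<sigma>]) auto
  qed
qed

lemma (in prob_space) integral_affine:
  fixes G :: "'a \<Rightarrow> real"
  assumes "integrable M G"
  shows "(\<integral>\<omega>. a * (b * G \<omega> - c) \<partial>M) = a * (b * (\<integral>\<omega>. G \<omega> \<partial>M) - c)"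
  using assms by (simp add: prob_space)

locale gaussian_walk = prob_space M for M :: "'a measure" +
  fixes h :: real and n :: nat and D :: "nat \<Rightarrow> 'a \<Rightarrow> real"
  assumes h_nonneg: "0 \<le> h"
    and indep_D: "indep_vars (\<lambda>_. borel) D {..<n}"
    and distr_D: "\<And>k. k < n \<Longrightarrow> distr M borel (D k) = incr_law h"
begin

lemma measurable_D: "k < n \<Longrightarrow> D k \<in> borel_measurable M"
  using indep_D by (auto simp: indep_vars_def)

text \<open>Conditioning on the past, done by Fubini: the first \<open>k\<close> increments form one
  random element independent of the next one, whose law is \<open>incr_law h\<close>.\<close>

lemma integral_next_increment:
  fixes \<Phi> :: "(nat \<Rightarrow> real) \<Rightarrow> real \<Rightarrow> real"
  assumes k: "k < n"
    and \<Phi>[measurable]: "(\<lambda>(u, d). \<Phi> u d) \<in> borel_measurable (PiM {..<k} (\<lambda>_. borel) \<Otimes>\<^sub>M borel)"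
    and bound: "\<And>u d. \<bar>\<Phi> u d\<bar> \<le> B"
    and cong: "\<And>u u' d. (\<And>i. i < k \<Longrightarrow> u i = u' i) \<Longrightarrow> \<Phi> u d = \<Phi> u' d"
  shows "(\<integral>\<omega>. \<Phi> (\<lambda>i. D i \<omega>) (D k \<omega>) \<partial>M) = (\<integral>\<omega>. (\<integral>d. \<Phi> (\<lambda>i. D i \<omega>) d \<partial>incr_law h) \<partial>M)"
proof -
  let ?U = "\<lambda>\<omega>. \<lambda>i\<in>{..<k}. D i \<omega>"
  let ?P = "PiM {..<k} (\<lambda>_. borel :: real measure)"
  have U[measurable]: "?U \<in> measurable M ?P"
    using k by (intro measurable_restrict) (auto intro!: measurable_D)
  have Dk[measurable]: "D k \<in> borel_measurable M" using k by (rule measurable_D)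
  \<comment> \<open>The next increment is viewed as a family over \<open>{k}\<close>, because
    independence is obtained for restrictions to disjoint index sets.\<close>
  let ?Q = "PiM {k} (\<lambda>_. borel :: real measure)"
  let ?V = "\<lambda>\<omega>. \<lambda>i\<in>{k}. D i \<omega>"
  have V[measurable]: "?V \<in> measurable M ?Q"
    using k by (intro measurable_restrict) (auto intro!: measurable_D)
  have ind: "indep_var ?P ?U ?Q ?V"
    using k by (intro indep_var_restrict[OF indep_D]) auto
  interpret U: prob_space "distr M ?P ?U" by (rule prob_space_distr) simp
  interpret V: prob_space "distr M ?Q ?V" by (rule prob_space_distr) simp
  interpret UV: pair_prob_space "distr M ?P ?U" "distr M ?Q ?V" ..
  have joint: "distr M ?P ?U \<Otimes>\<^sub>M distr M ?Q ?V = distr M (?P \<Otimes>\<^sub>M ?Q) (\<lambda>\<omega>. (?U \<omega>, ?V \<omega>))"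
    using ind indep_var_distribution_eq by blast
  have \<Phi>2[measurable]: "(\<lambda>(u, v). \<Phi> u (v k)) \<in> borel_measurable (?P \<Otimes>\<^sub>M ?Q)"
  proof -
    have "(\<lambda>(u, v). (u, v k)) \<in> ?P \<Otimes>\<^sub>M ?Q \<rightarrow>\<^sub>M ?P \<Otimes>\<^sub>M borel"
      by measurable
    from measurable_compose[OF this \<Phi>] show ?thesis by (simp add: case_prod_beta')
  qed
  have int: "integrable (distr M ?P ?U \<Otimes>\<^sub>M distr M ?Q ?V) (\<lambda>(u, v). \<Phi> u (v k))"
  proof (rule UV.P.integrable_const_bound)
    show "AE z in distr M ?P ?U \<Otimes>\<^sub>M distr M ?Q ?V. norm ((\<lambda>(u, v). \<Phi> u (v k)) z) \<le> B"
      using bound by (intro AE_I2) (simp add: case_prod_beta')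
    show "(\<lambda>(u, v). \<Phi> u (v k)) \<in> borel_measurable (distr M ?P ?U \<Otimes>\<^sub>M distr M ?Q ?V)"
      using \<Phi>2 by (simp cong: measurable_cong_sets sets_pair_measure_cong)
  qed
  \<comment> \<open>\<open>\<Phi>\<close> looks only at indices below \<open>k\<close>, so the
    restricted past may stand for the full sequence.\<close>
  have U_eq: "\<Phi> (?U \<omega>) d = \<Phi> (\<lambda>i. D i \<omega>) d" for \<omega> d by (rule cong) auto
  have "(\<integral>\<omega>. \<Phi> (\<lambda>i. D i \<omega>) (D k \<omega>) \<partial>M) = (\<integral>\<omega>. (\<lambda>(u, v). \<Phi> u (v k)) (?U \<omega>, ?V \<omega>) \<partial>M)"
    by (simp add: U_eq)
  also have "\<dots> = integral\<^sup>L (distr M (?P \<Otimes>\<^sub>M ?Q) (\<lambda>\<omega>. (?U \<omega>, ?V \<omega>))) (\<lambda>(u, v). \<Phi> u (v k))"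
    by (rule integral_distr[symmetric]) measurable
  also have "\<dots> = integral\<^sup>L (distr M ?P ?U \<Otimes>\<^sub>M distr M ?Q ?V) (\<lambda>(u, v). \<Phi> u (v k))"
    by (simp add: joint)
  also have "\<dots> = (\<integral>u. (\<integral>v. \<Phi> u (v k) \<partial>distr M ?Q ?V) \<partial>distr M ?P ?U)"
    by (rule UV.integral_fst[OF int, symmetric])
  also have "\<dots> = (\<integral>u. (\<integral>d. \<Phi> u d \<partial>incr_law h) \<partial>distr M ?P ?U)"
  proof (rule Bochner_Integration.integral_cong[OF refl])
    fix u assume "u \<in> space (distr M ?P ?U)"
    then have u: "u \<in> space ?P" by simp
    have [measurable]: "\<Phi> u \<in> borel_measurable borel"
      using measurable_Pair2[OF \<Phi> u] by simp
    have "(\<integral>v. \<Phi> u (v k) \<partial>distr M ?Q ?V) = (\<integral>\<omega>. \<Phi> u (D k \<omega>) \<partial>M)"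
      by (subst integral_distr) auto
    also have "\<dots> = (\<integral>d. \<Phi> u d \<partial>incr_law h)"
      unfolding distr_D[OF k, symmetric] by (subst integral_distr) auto
    finally show "(\<integral>v. \<Phi> u (v k) \<partial>distr M ?Q ?V) = (\<integral>d. \<Phi> u d \<partial>incr_law h)" .
  qed
  also have "\<dots> = (\<integral>\<omega>. (\<integral>d. \<Phi> (?U \<omega>) d \<partial>incr_law h) \<partial>M)"
  proof (rule integral_distr)
    interpret L: prob_space "incr_law h" by (rule prob_space_incr_law)
    have [measurable]: "(\<lambda>(u, d). \<Phi> u d) \<in> borel_measurable (?P \<Otimes>\<^sub>M incr_law h)"
      using \<Phi> by (simp cong: measurable_cong_sets sets_pair_measure_cong)
    show "(\<lambda>u. \<integral>d. \<Phi> u d \<partial>incr_law h) \<in> borel_measurable ?P" by measurable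
  qed measurable
  finally show ?thesis by (simp add: U_eq)
qed

end

lemma measurable_chain_PiM:
  assumes [measurable]: "\<pi> \<in> borel_measurable borel" and "j \<le> k"
  shows "(\<lambda>u. chain \<pi> u j) \<in> borel_measurable (PiM {..<k} (\<lambda>_. borel))"
  using \<open>j \<le> k\<close>
proof (induction j)
  case (Suc j)
  then have [measurable]: "(\<lambda>u. chain \<pi> u j) \<in> borel_measurable (PiM {..<k} (\<lambda>_. borel))"
    "(\<lambda>u. u j) \<in> borel_measurable (PiM {..<k} (\<lambda>_. borel))"
    by (auto intro!: measurable_component_singleton)
  show ?case by simp
qed simp

lemma measurable_weight:
  assumes [measurable]: "\<kappa> \<in> borel_measurable borel" "f \<in> borel_measurable borel"
    and x: "\<And>j. j < k \<Longrightarrow> (\<lambda>u. x u j) \<in> borel_measurable N"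
  shows "(\<lambda>u. weight \<kappa> f h (x u) k) \<in> borel_measurable N"
  using x
proof (induction k)
  case (Suc k)
  have [measurable]: "(\<lambda>u. x u k) \<in> borel_measurable N" "(\<lambda>u. weight \<kappa> f h (x u) k) \<in> borel_measurable N"
    using Suc by auto
  show ?case by simp
qed simp

lemma (in prob_space) measurable_chain:
  assumes [measurable]: "\<pi> \<in> borel_measurable borel"
    and D: "\<And>k. k < n \<Longrightarrow> D k \<in> borel_measurable M" and "j \<le> n"
  shows "(\<lambda>\<omega>. chain \<pi> (\<lambda>i. D i \<omega>) j) \<in> borel_measurable M"
  using \<open>j \<le> n\<close>
proof (induction j)
  case (Suc j)
  then have [measurable]: "(\<lambda>\<omega>. chain \<pi> (\<lambda>i. D i \<omega>) j) \<in> borel_measurable M" "D j \<in> borel_measurable M"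
    using D by auto
  show ?case by simp
qed simp

context gaussian_walk
begin

lemma dynkin:
  assumes [measurable]: "\<pi> \<in> borel_measurable borel" "\<kappa> \<in> borel_measurable borel" "f \<in> borel_measurable borel"
    and \<kappa>: "\<And>x. 0 \<le> \<kappa> x" "\<And>x. \<kappa> x \<le> 1" and f: "\<And>x. 0 \<le> f x" "\<And>x. f x \<le> F"
    and g[measurable]: "g \<in> borel_measurable borel" and gC: "\<And>x. \<bar>g x\<bar> \<le> C" and g\<pi>: "\<And>x. g (\<pi> x) = g x"
    and m: "m \<le> n"
  defines "x \<equiv> \<lambda>\<omega>. chain \<pi> (\<lambda>i. D i \<omega>)"
  shows "integrable M (\<lambda>\<omega>. stopped_value \<kappa> f h g (x \<omega>) m)"
    and "\<bar>(\<integral>\<omega>. stopped_value \<kappa> f h g (x \<omega>) m \<partial>M) - g 0\<bar>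
      \<le> (\<Sum>k<m. \<integral>\<omega>. \<kappa> (x \<omega> k) * \<bar>exp (- h * f (x \<omega> k)) * step_op h g (x \<omega> k) - g (x \<omega> k)\<bar> \<partial>M)"
proof -
  let ?gen = "\<lambda>y. exp (- h * f y) * step_op h g y - g y"
  let ?e = "\<lambda>k \<omega>. weight \<kappa> f h (x \<omega>) k * \<kappa> (x \<omega> k) * (?gen (x \<omega> k))"
  have C0: "0 \<le> C" using gC[of 0] by linarith
  interpret L: prob_space "incr_law h" by (rule prob_space_incr_law)
  have mx[measurable]: "(\<lambda>\<omega>. x \<omega> k) \<in> borel_measurable M" if "k \<le> n" for k
    unfolding x_def using that by (intro measurable_chain measurable_D) auto
  have mstep[measurable]: "step_op h g \<in> borel_measurable borel"
    unfolding step_op_eq_integral_incr_law[OF g, abs_def] by measurable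
  have stepC: "\<bar>step_op h g x\<bar> \<le> C" for x
  proof -
    have "norm (\<integral>d. g (x + d) \<partial>incr_law h) \<le> (\<integral>d. C \<partial>incr_law h)"
      by (rule Bochner_Integration.integral_norm_bound_integral[OF L.integrable_const_bound[of _ C]]) (auto simp: gC)
    then show ?thesis by (simp add: step_op_eq_integral_incr_law L.prob_space[simplified])
  qed
  have W: "0 \<le> weight \<kappa> f h y k" "weight \<kappa> f h y k \<le> 1" for y k
    using weight_nonneg_le_1[of \<kappa> f h y k] \<kappa> f h_nonneg by auto
  have W\<kappa>: "0 \<le> weight \<kappa> f h y k * \<kappa> z" "weight \<kappa> f h y k * \<kappa> z \<le> 1" for y k z
    using W \<kappa> by (auto intro!: mult_le_one)
  have e1: "0 \<le> exp (- h * f z)" "exp (- h * f z) \<le> 1" for z using f h_nonneg by auto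
  have diffC: "\<bar>exp (- h * f z) * v - g z\<bar> \<le> 2 * C" if "\<bar>v\<bar> \<le> C" for v z
  proof -
    have "\<bar>exp (- h * f z) * v\<bar> \<le> 1 * C" unfolding abs_mult using e1[of z] that by (intro mult_mono) auto
    then show ?thesis using gC[of z] by linarith
  qed
  have prodC: "\<bar>weight \<kappa> f h y k * \<kappa> z * (exp (- h * f z) * v - g z)\<bar> \<le> 2 * C" if "\<bar>v\<bar> \<le> C" for y k z v
  proof -
    have "\<bar>weight \<kappa> f h y k * \<kappa> z * (exp (- h * f z) * v - g z)\<bar>
        = weight \<kappa> f h y k * \<kappa> z * \<bar>exp (- h * f z) * v - g z\<bar>"
      using W[of y k] \<kappa>[of z] by (simp add: abs_mult)
    also have "\<dots> \<le> 1 * (2 * C)"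
      using W\<kappa>[of y k z] diffC[OF that] by (intro mult_mono) auto
    finally show ?thesis by simp
  qed
  define inc where "inc = (\<lambda>k \<omega>. weight \<kappa> f h (x \<omega>) k * \<kappa> (x \<omega> k) * (exp (- h * f (x \<omega> k)) * g (x \<omega> (Suc k)) - g (x \<omega> k)))"
  have mw[measurable]: "(\<lambda>\<omega>. weight \<kappa> f h (x \<omega>) k) \<in> borel_measurable M" if "k \<le> n" for k
    using that by (intro measurable_weight) auto
  have int_inc: "integrable M (inc k)" if "k < n" for k
  proof (rule integrable_const_bound[of _ "2 * C"])
    have [measurable]: "(\<lambda>\<omega>. x \<omega> k) \<in> borel_measurable M" "(\<lambda>\<omega>. x \<omega> (Suc k)) \<in> borel_measurable M"
      "(\<lambda>\<omega>. weight \<kappa> f h (x \<omega>) k) \<in> borel_measurable M"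
      using that by (intro mx mw; simp)+
    show "inc k \<in> borel_measurable M" unfolding inc_def by measurable
  qed (auto simp: inc_def intro!: AE_I2 prodC[unfolded minus_mult_left[symmetric]] prodC gC)
  have sv: "stopped_value \<kappa> f h g (x \<omega>) k = g 0 + (\<Sum>j<k. inc j \<omega>)" for k \<omega>
    by (induction k) (auto simp: inc_def x_def)
  show "integrable M (\<lambda>\<omega>. stopped_value \<kappa> f h g (x \<omega>) m)"
    unfolding sv using int_inc m by (auto intro!: Bochner_Integration.integrable_add Bochner_Integration.integrable_sum)
  have inc_le: "\<bar>\<integral>\<omega>. inc k \<omega> \<partial>M\<bar>
      \<le> (\<integral>\<omega>. \<kappa> (x \<omega> k) * \<bar>?gen (x \<omega> k)\<bar> \<partial>M)" if k: "k < n" for k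
  proof -
    have [measurable]: "(\<lambda>\<omega>. x \<omega> k) \<in> borel_measurable M" "(\<lambda>\<omega>. weight \<kappa> f h (x \<omega>) k) \<in> borel_measurable M"
      using k by (intro mx mw; simp)+
    define \<Phi> where "\<Phi> = (\<lambda>u d. weight \<kappa> f h (chain \<pi> u) k * \<kappa> (chain \<pi> u k) *
      (exp (- h * f (chain \<pi> u k)) * g (chain \<pi> u k + d) - g (chain \<pi> u k)))"
    have [measurable]: "(\<lambda>u. chain \<pi> u k) \<in> borel_measurable (PiM {..<k} (\<lambda>_. borel))"
      by (rule measurable_chain_PiM) auto
    have [measurable]: "(\<lambda>u. weight \<kappa> f h (chain \<pi> u) k) \<in> borel_measurable (PiM {..<k} (\<lambda>_. borel))"
      by (intro measurable_weight measurable_chain_PiM) auto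
    \<comment> \<open>Here \<open>g (\<pi> x) = g x\<close> removes the reflection: the next value
      of \<open>g\<close> is a function of the present position plus the free increment.\<close>
    have "(\<integral>\<omega>. inc k \<omega> \<partial>M) = (\<integral>\<omega>. \<Phi> (\<lambda>i. D i \<omega>) (D k \<omega>) \<partial>M)"
      by (simp add: inc_def \<Phi>_def x_def g\<pi>)
    also have "\<dots> = (\<integral>\<omega>. (\<integral>d. \<Phi> (\<lambda>i. D i \<omega>) d \<partial>incr_law h) \<partial>M)"
    proof (rule integral_next_increment[OF k, of _ "2 * C"])
      show "(\<lambda>(u, d). \<Phi> u d) \<in> borel_measurable (PiM {..<k} (\<lambda>_. borel) \<Otimes>\<^sub>M borel)"
        unfolding \<Phi>_def by measurable
      show "\<bar>\<Phi> u d\<bar> \<le> 2 * C" for u d unfolding \<Phi>_def by (intro prodC gC)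
      fix u u' :: "nat \<Rightarrow> real" and d assume "\<And>i. i < k \<Longrightarrow> u i = u' i"
      then have "chain \<pi> u k = chain \<pi> u' k" "weight \<kappa> f h (chain \<pi> u) k = weight \<kappa> f h (chain \<pi> u') k"
        by (auto intro!: chain_cong weight_cong)
      then show "\<Phi> u d = \<Phi> u' d" by (simp add: \<Phi>_def)
    qed
    also have "\<dots> = (\<integral>\<omega>. ?e k \<omega> \<partial>M)"
    proof (rule Bochner_Integration.integral_cong[OF refl])
      fix \<omega>
      have int: "integrable (incr_law h) (\<lambda>d. g (x \<omega> k + d))"
        by (rule L.integrable_const_bound[of _ C]) (auto simp: gC)
      have xw: "chain \<pi> (\<lambda>i. D i \<omega>) = x \<omega>" by (simp add: x_def)
      have "(\<integral>d. \<Phi> (\<lambda>i. D i \<omega>) d \<partial>incr_law h)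
          = (\<integral>d. weight \<kappa> f h (x \<omega>) k * \<kappa> (x \<omega> k) * (exp (- h * f (x \<omega> k)) * g (x \<omega> k + d) - g (x \<omega> k)) \<partial>incr_law h)"
        by (simp only: \<Phi>_def xw)
      also have "\<dots> = ?e k \<omega>"
        by (simp only: L.integral_affine[OF int] step_op_eq_integral_incr_law[OF g])
      finally show "(\<integral>d. \<Phi> (\<lambda>i. D i \<omega>) d \<partial>incr_law h)
          = ?e k \<omega>" .
    qed
    finally have inc_eq: "(\<integral>\<omega>. inc k \<omega> \<partial>M) = (\<integral>\<omega>. ?e k \<omega> \<partial>M)" .
    have "\<bar>\<integral>\<omega>. inc k \<omega> \<partial>M\<bar> \<le> (\<integral>\<omega>. \<bar>?e k \<omega>\<bar> \<partial>M)"
      unfolding inc_eq by (rule integral_abs_bound)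
    also have "\<dots> \<le> (\<integral>\<omega>. \<kappa> (x \<omega> k) * \<bar>?gen (x \<omega> k)\<bar> \<partial>M)"
    proof (rule integral_mono)
      show "integrable M (\<lambda>\<omega>. \<bar>?e k \<omega>\<bar>)"
      proof (rule integrable_const_bound)
        show "AE \<omega> in M. norm \<bar>?e k \<omega>\<bar> \<le> 2 * C"
          by (intro AE_I2) (simp only: real_norm_def abs_abs prodC[OF stepC])
      qed measurable
      have "\<bar>\<kappa> y * \<bar>?gen y\<bar>\<bar> \<le> 1 * (2 * C)" for y
        unfolding abs_mult using \<kappa>[of y] diffC[OF stepC, of y y] by (intro mult_mono) auto
      then show "integrable M (\<lambda>\<omega>. \<kappa> (x \<omega> k) * \<bar>?gen (x \<omega> k)\<bar>)"
        by (intro integrable_const_bound[of _ "2 * C"] AE_I2) (simp_all only: real_norm_def mult_1, measurable)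
      fix \<omega>
      show "\<bar>?e k \<omega>\<bar>
        \<le> \<kappa> (x \<omega> k) * \<bar>?gen (x \<omega> k)\<bar>"
        unfolding abs_mult using W[of "x \<omega>" k] \<kappa>[of "x \<omega> k"]
        by (intro mult_right_mono) (auto intro: mult_left_le_one_le)
    qed
    finally show ?thesis .
  qed
  have "(\<integral>\<omega>. stopped_value \<kappa> f h g (x \<omega>) m \<partial>M) = g 0 + (\<Sum>k<m. \<integral>\<omega>. inc k \<omega> \<partial>M)"
    unfolding sv using int_inc m by (subst Bochner_Integration.integral_add) (auto simp: prob_space intro!: Bochner_Integration.integral_sum)
  then have "\<bar>(\<integral>\<omega>. stopped_value \<kappa> f h g (x \<omega>) m \<partial>M) - g 0\<bar> \<le> (\<Sum>k<m. \<bar>\<integral>\<omega>. inc k \<omega> \<partial>M\<bar>)"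
    by (simp add: sum_abs)
  also have "\<dots> \<le> (\<Sum>k<m. \<integral>\<omega>. \<kappa> (x \<omega> k) * \<bar>?gen (x \<omega> k)\<bar> \<partial>M)"
    using m by (intro sum_mono inc_le) auto
  finally show "\<bar>(\<integral>\<omega>. stopped_value \<kappa> f h g (x \<omega>) m \<partial>M) - g 0\<bar>
      \<le> (\<Sum>k<m. \<integral>\<omega>. \<kappa> (x \<omega> k) * \<bar>?gen (x \<omega> k)\<bar> \<partial>M)" .
qed

end

section \<open>Drifting Brownian motion on a grid\<close>

text \<open>Sums over the grid become integrals of step functions, so that dominated convergence
  also handles the limit in time.\<close>

lemma integral_step_function:
  fixes \<phi> :: "nat \<Rightarrow> real"
  assumes T: "0 < T" and n: "0 < n"
  shows "(\<integral>s. indicator {0..<T} s * \<phi> (nat \<lfloor>s * real n / T\<rfloor>) \<partial>lborel) = (\<Sum>k<n. T / n * \<phi> k)"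
proof -
  let ?I = "\<lambda>k. {real k * (T / n)..<real (Suc k) * (T / n)}"
  have eq: "indicator {0..<T} s * \<phi> (nat \<lfloor>s * real n / T\<rfloor>) = (\<Sum>k<n. \<phi> k * indicator (?I k) s)" for s
  proof -
    have I: "s \<in> ?I k \<longleftrightarrow> 0 \<le> s \<and> nat \<lfloor>s * real n / T\<rfloor> = k" for k
    proof -
      have "s \<in> ?I k \<longleftrightarrow> real k \<le> s * real n / T \<and> s * real n / T < real (Suc k)"
        using T n by (simp add: field_simps)
      also have "\<dots> \<longleftrightarrow> \<lfloor>s * real n / T\<rfloor> = int k" by (auto simp: floor_eq_iff)
      also have "\<dots> \<longleftrightarrow> 0 \<le> s \<and> nat \<lfloor>s * real n / T\<rfloor> = k"
      proof -
        have s0: "0 \<le> s \<longleftrightarrow> 0 \<le> \<lfloor>s * real n / T\<rfloor>" using T n by (simp add: zero_le_divide_iff zero_le_mult_iff)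
        have "i = int k \<longleftrightarrow> 0 \<le> i \<and> nat i = k" for i by auto
        then show ?thesis unfolding s0 .
      qed
      finally show ?thesis .
    qed
    show ?thesis
    proof (cases "0 \<le> s")
      case True
      define j where "j = nat \<lfloor>s * real n / T\<rfloor>"
      have "j < n \<longleftrightarrow> s < T"
      proof -
        have "j < n \<longleftrightarrow> \<lfloor>s * real n / T\<rfloor> < int n" using n by (auto simp: j_def)
        also have "\<dots> \<longleftrightarrow> s < T" using T n by (simp add: floor_less_iff field_simps)
        finally show ?thesis .
      qed
      moreover have "(\<Sum>k<n. \<phi> k * indicator (?I k) s) = (\<Sum>k<n. if j = k then \<phi> k else 0)"
        using True by (intro sum.cong refl) (simp only: indicator_def I True j_def, simp)
      ultimately show ?thesis using True by (auto simp: j_def[symmetric])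
    next
      case False
      then have "(\<Sum>k<n. \<phi> k * indicator (?I k) s) = 0"
        by (intro sum.neutral ballI) (simp only: indicator_def I, simp)
      then show ?thesis using False by simp
    qed
  qed
  have "(\<integral>s. indicator {0..<T} s * \<phi> (nat \<lfloor>s * real n / T\<rfloor>) \<partial>lborel)
      = (\<Sum>k<n. \<integral>s. \<phi> k * indicator (?I k) s \<partial>lborel)"
    unfolding eq
  proof (rule Bochner_Integration.integral_sum)
    have "integrable lborel (indicator {a..<b} :: real \<Rightarrow> real)" for a b :: real
      by (cases "a \<le> b") (simp_all add: integrable_indicator_iff)
    then show "integrable lborel (\<lambda>s. \<phi> k * indicator (?I k) s)" for k
      by (intro integrable_mult_right)
  qed
  also have "\<dots> = (\<Sum>k<n. T / n * \<phi> k)"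
  proof (intro sum.cong refl)
    fix k
    have "real k * (T / n) \<le> real (Suc k) * (T / n)" using T by (intro mult_right_mono) auto
    then have "measure lborel (?I k) = T / n"
      by (simp only: measure_lborel_Ico) (simp add: algebra_simps add_divide_distrib)
    then show "(\<integral>s. \<phi> k * indicator (?I k) s \<partial>lborel) = T / n * \<phi> k"
      by (simp del: of_nat_Suc)
  qed
  finally show ?thesis .
qed

lemma grid_index_less:
  assumes T: "0 < T" and "s < T" shows "nat \<lfloor>s * real (Suc n) / T\<rfloor> < Suc n"
proof -
  have "s * real (Suc n) / T < real (Suc n)"
    using assms mult_strict_right_mono[of s T "real (Suc n)"] by (simp only: pos_divide_less_eq mult.commute of_nat_0_less_iff)
  then have "\<lfloor>s * real (Suc n) / T\<rfloor> < int (Suc n)" by (simp only: floor_less_iff of_int_of_nat_eq)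
  then show ?thesis by (simp only: nat_less_iff)
qed

lemma step_sum_tendsto:
  fixes \<phi> :: "nat \<Rightarrow> nat \<Rightarrow> real"
  assumes T: "0 < T" and bound: "\<And>n k. k < Suc n \<Longrightarrow> \<bar>\<phi> n k\<bar> \<le> K"
    and lim: "AE s in lborel. 0 < s \<and> s < T \<longrightarrow> (\<lambda>n. \<phi> n (nat \<lfloor>s * real (Suc n) / T\<rfloor>)) \<longlonglongrightarrow> L s"
    and L[measurable]: "L \<in> borel_measurable borel"
  shows "(\<lambda>n. \<Sum>k<Suc n. T / Suc n * \<phi> n k) \<longlonglongrightarrow> (\<integral>s. indicator {0<..<T} s * L s \<partial>lborel)"
proof -
  note lt = grid_index_less[OF T]
  have "(\<lambda>n. \<integral>s. indicator {0..<T} s * \<phi> n (nat \<lfloor>s * real (Suc n) / T\<rfloor>) \<partial>lborel)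
      \<longlonglongrightarrow> (\<integral>s. indicator {0<..<T} s * L s \<partial>lborel)"
  proof (rule integral_dominated_convergence[where w="\<lambda>s. indicator {0..<T} s * K"])
    show "integrable lborel (\<lambda>s. indicator {0..<T} s * K)"
      using T by (intro integrable_mult_left) (simp add: integrable_indicator_iff)
    show "AE s in lborel. (\<lambda>n. indicator {0..<T} s * \<phi> n (nat \<lfloor>s * real (Suc n) / T\<rfloor>)) \<longlonglongrightarrow> indicator {0<..<T} s * L s"
      \<comment> \<open>The step functions live on \<open>{0..<T}\<close> and the limit on
        \<open>{0<..<T}\<close>: at time 0 no convergence is assumed, and a single point has measure
        0.\<close>
      using lim AE_lborel_singleton[of 0]
    proof eventually_elim
      case (elim s)
      then show ?case by (cases "0 < s \<and> s < T") (auto simp: indicator_def)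
    qed
    show "AE s in lborel. norm (indicator {0..<T} s * \<phi> n (nat \<lfloor>s * real (Suc n) / T\<rfloor>)) \<le> indicator {0..<T} s * K" for n
      using bound[OF lt] by (intro AE_I2) (auto simp: indicator_def)
  qed measurable
  then show ?thesis using integral_step_function[OF T, of "Suc _"] by simp
qed

lemma floor_grid_tendsto:
  assumes T: "0 < T" and s: "0 \<le> s"
  shows "(\<lambda>n. real (nat \<lfloor>s * real (Suc n) / T\<rfloor>) * (T / Suc n)) \<longlonglongrightarrow> s"
proof -
  have le: "\<bar>real (nat \<lfloor>s * real (Suc n) / T\<rfloor>) * (T / Suc n) - s\<bar> \<le> T / Suc n" for n
  proof -
    define N where "N = real (Suc n)"
    have N: "0 < N" by (simp add: N_def)
    let ?u = "s * N / T"
    have u: "0 \<le> ?u" using T s N by simp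
    have "\<bar>real (nat \<lfloor>?u\<rfloor>) - ?u\<bar> \<le> 1" using u by linarith
    moreover have "real (nat \<lfloor>?u\<rfloor>) * (T / N) - s = (real (nat \<lfloor>?u\<rfloor>) - ?u) * (T / N)"
      using T N by (simp add: field_simps)
    ultimately have "\<bar>real (nat \<lfloor>?u\<rfloor>) * (T / N) - s\<bar> \<le> T / N"
      using T N mult_right_mono[of "\<bar>real (nat \<lfloor>?u\<rfloor>) - ?u\<bar>" 1 "T / N"] by (simp add: abs_mult)
    then show ?thesis by (simp add: N_def)
  qed
  have "(\<lambda>n. T / Suc n) \<longlonglongrightarrow> 0"
    using LIMSEQ_Suc[OF lim_const_over_n[of T]] .
  then have "(\<lambda>n. real (nat \<lfloor>s * real (Suc n) / T\<rfloor>) * (T / Suc n) - s) \<longlonglongrightarrow> 0"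
    by (rule Lim_null_comparison[rotated]) (use le in simp)
  then show ?thesis by (rule LIM_zero_cancel)
qed

text \<open>Continuity makes the process a limit of its values at discretised times, each jointly
  measurable as a countable case distinction. \<open>max 0 s\<close> hides the unconstrained
  negative times.\<close>

lemma measurable_continuous_process:
  fixes Z :: "real \<Rightarrow> 'a \<Rightarrow> real"
  assumes Z: "\<And>t. 0 \<le> t \<Longrightarrow> Z t \<in> borel_measurable M"
    and cont: "\<And>\<omega>. \<omega> \<in> space M \<Longrightarrow> continuous_on {0..} (\<lambda>t. Z t \<omega>)"
  shows "(\<lambda>(s, \<omega>). Z (max 0 s) \<omega>) \<in> borel_measurable (borel \<Otimes>\<^sub>M M)"
proof (rule borel_measurable_LIMSEQ_real)
  let ?k = "\<lambda>n s. nat \<lfloor>max 0 s * real (Suc n) / 1\<rfloor>"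
  show "(\<lambda>p :: real \<times> 'a. Z (real (?k n (fst p)) * (1 / Suc n)) (snd p)) \<in> borel_measurable (borel \<Otimes>\<^sub>M M)" for n
  proof (rule measurable_compose_countable[where f="\<lambda>k (p :: real \<times> 'a). Z (real k * (1 / Suc n)) (snd p)" and g="\<lambda>p :: real \<times> 'a. ?k n (fst p)"])
    show "(\<lambda>p :: real \<times> 'a. Z (real k * (1 / Suc n)) (snd p)) \<in> borel_measurable (borel \<Otimes>\<^sub>M M)" for k
      by (intro measurable_compose[OF measurable_snd Z]) simp
  qed measurable
  fix p :: "real \<times> 'a" assume "p \<in> space (borel \<Otimes>\<^sub>M M)"
  then have \<omega>: "snd p \<in> space M" by (auto simp: space_pair_measure)
  have "(\<lambda>n. real (?k n (fst p)) * (1 / Suc n)) \<longlonglongrightarrow> max 0 (fst p)"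
    by (rule floor_grid_tendsto) auto
  then show "(\<lambda>n. Z (real (?k n (fst p)) * (1 / Suc n)) (snd p)) \<longlonglongrightarrow> (case p of (s, \<omega>) \<Rightarrow> Z (max 0 s) \<omega>)"
    unfolding case_prod_beta' by (rule continuous_on_tendsto_compose[OF cont[OF \<omega>]]) (auto intro!: always_eventually)
qed

text \<open>Brownian motion is specified only on \<open>space M\<close>, so increments computed in
  two ways agree there and need not be equal as functions.\<close>

lemma (in prob_space) indep_vars_cong_space:
  assumes "indep_vars M' X I" and eq: "\<And>i \<omega>. i \<in> I \<Longrightarrow> \<omega> \<in> space M \<Longrightarrow> X i \<omega> = Y i \<omega>"
  shows "indep_vars M' Y I"
proof -
  have "X i \<in> measurable M (M' i) \<longleftrightarrow> Y i \<in> measurable M (M' i)" if "i \<in> I" for i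
    using eq[OF that] by (rule measurable_cong)
  moreover have "{X i -` A \<inter> space M |A. A \<in> sets (M' i)} = {Y i -` A \<inter> space M |A. A \<in> sets (M' i)}" if "i \<in> I" for i
  proof -
    have "X i -` A \<inter> space M = Y i -` A \<inter> space M" for A
      using eq[OF that] by auto
    then show ?thesis by simp
  qed
  then have "indep_sets (\<lambda>i. {X i -` A \<inter> space M |A. A \<in> sets (M' i)}) I
      \<longleftrightarrow> indep_sets (\<lambda>i. {Y i -` A \<inter> space M |A. A \<in> sets (M' i)}) I"
    by (intro indep_sets_cong refl)
  ultimately show ?thesis using assms(1) by (auto simp: indep_vars_def2)
qed

locale half_drift_bm = prob_space M for M :: "'a measure" +
  fixes X :: "real \<Rightarrow> 'a \<Rightarrow> real"
  assumes bm: "brownian_motion_with_drift M (1/2) X"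

lemma half_drift_bmI: "brownian_motion_with_drift M (1/2) X \<Longrightarrow> half_drift_bm M X"
  by (auto simp: half_drift_bm_def half_drift_bm_axioms_def brownian_motion_with_drift_def
      standard_brownian_motion_def)

context half_drift_bm
begin

text \<open>\<open>T\<close> is cut into \<open>Suc n\<close> cells so that the mesh is meaningful
  for every \<open>n\<close>.\<close>

definition incr :: "real \<Rightarrow> nat \<Rightarrow> nat \<Rightarrow> 'a \<Rightarrow> real" where
  "incr T n k \<omega> = X (real (Suc k) * (T / Suc n)) \<omega> - X (real k * (T / Suc n)) \<omega>"

lemma
  shows measurable_X: "0 \<le> t \<Longrightarrow> X t \<in> borel_measurable M"
    and X_zero: "\<omega> \<in> space M \<Longrightarrow> X 0 \<omega> = 0"
    and continuous_X: "\<omega> \<in> space M \<Longrightarrow> continuous_on {0..} (\<lambda>t. X t \<omega>)"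
    and walk_X: "0 < T \<Longrightarrow> gaussian_walk M (T / Suc n) (Suc n) (incr T n)"
    and distr_X: "0 < t \<Longrightarrow> distr M borel (X t) = incr_law t"
proof -
  obtain W where W: "standard_brownian_motion M W"
    and XW: "\<And>t \<omega>. 0 \<le> t \<Longrightarrow> \<omega> \<in> space M \<Longrightarrow> X t \<omega> = W t \<omega> + 1/2 * t"
    using bm unfolding brownian_motion_with_drift_def by blast
  interpret W: standard_brownian_motion M W by fact
  show mX: "X t \<in> borel_measurable M" if "0 \<le> t" for t
    using W.measurable_W[OF that] measurable_cong[of M "X t" "\<lambda>\<omega>. W t \<omega> + 1/2 * t" borel] XW[OF that]
    by simp
  show X0: "X 0 \<omega> = 0" if "\<omega> \<in> space M" for \<omega>
    using XW[OF order_refl that] W.start_zero[OF that] by simp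
  show "continuous_on {0..} (\<lambda>t. X t \<omega>)" if "\<omega> \<in> space M" for \<omega>
  proof -
    have "continuous_on {0..} (\<lambda>t. W t \<omega> + 1/2 * t)"
      by (intro continuous_intros W.continuous_paths that)
    then show ?thesis by (rule continuous_on_eq) (simp add: XW that)
  qed
  have distr_incr: "distr M borel (\<lambda>\<omega>. X t \<omega> - X s \<omega>) = incr_law (t - s)" if st: "0 \<le> s" "s < t" for s t
  proof -
    let ?h = "t - s" and ?Y = "\<lambda>\<omega>. (W t \<omega> - W s \<omega> - 0) / sqrt (t - s)"
    have Y: "distributed M lborel ?Y std_normal_density"
      using normal_standard_normal_convert[of "sqrt (t - s)" "\<lambda>\<omega>. W t \<omega> - W s \<omega>" 0] W.normal_increments[OF st] st
      by simp
    have [measurable]: "W t \<in> borel_measurable M" "W s \<in> borel_measurable M"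
      using st by (auto intro!: W.measurable_W)
    have dY: "distr M borel ?Y = std_normal_distribution"
      using distributed_distr_eq_density[OF Y] by (simp cong: distr_cong)
    have "distr M borel (\<lambda>\<omega>. X t \<omega> - X s \<omega>) = distr M borel (\<lambda>\<omega>. sqrt ?h * ?Y \<omega> + ?h / 2)"
      using st by (intro distr_cong refl) (simp add: XW field_simps)
    also have "\<dots> = distr (distr M borel ?Y) borel (\<lambda>z. sqrt ?h * z + ?h / 2)"
      by (subst distr_distr) (auto simp: o_def)
    finally show ?thesis unfolding dY incr_law_def .
  qed
  show "distr M borel (X t) = incr_law t" if "0 < t" for t
  proof -
    have "distr M borel (X t) = distr M borel (\<lambda>\<omega>. X t \<omega> - X 0 \<omega>)"
      by (intro distr_cong refl) (simp add: X0)
    then show ?thesis using distr_incr[OF order_refl that] by simp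
  qed
  show "gaussian_walk M (T / Suc n) (Suc n) (incr T n)" if T: "0 < T"
  proof
    show "0 \<le> T / Suc n" using T by simp
    let ?\<tau> = "\<lambda>k. real k * (T / Suc n)"
    have "indep_vars (\<lambda>_. borel) (\<lambda>i \<omega>. W (?\<tau> (Suc i)) \<omega> - W (?\<tau> i) \<omega>) {..<Suc n}"
      using T by (intro W.independent_increments) (auto intro!: mult_right_mono divide_right_mono)
    then have "indep_vars (\<lambda>_. borel) (\<lambda>i \<omega>. (W (?\<tau> (Suc i)) \<omega> - W (?\<tau> i) \<omega>) + 1/2 * (T / Suc n)) {..<Suc n}"
      by (rule indep_vars_compose2) auto
    then show "indep_vars (\<lambda>_. borel) (incr T n) {..<Suc n}"
      by (rule indep_vars_cong_space)
        (use T in \<open>auto simp: incr_def XW algebra_simps add_divide_distrib\<close>)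
    show "distr M borel (incr T n k) = incr_law (T / Suc n)" if "k < Suc n" for k
    proof -
      have "?\<tau> (Suc k) - ?\<tau> k = T / Suc n" by (simp add: algebra_simps add_divide_distrib)
      then show ?thesis
        using distr_incr[of "?\<tau> k" "?\<tau> (Suc k)"] T unfolding incr_def by (simp add: divide_strict_right_mono)
    qed
  qed
qed

end

section \<open>Passage to the limit in Dynkin's formula\<close>

context half_drift_bm
begin

abbreviation walk :: "(real \<Rightarrow> real) \<Rightarrow> real \<Rightarrow> nat \<Rightarrow> 'a \<Rightarrow> nat \<Rightarrow> real" where
  "walk \<pi> T n \<omega> \<equiv> chain \<pi> (\<lambda>i. incr T n i \<omega>)"

text \<open>The error in Dynkin's formula is a Riemann sum of expectations. At a fixed time the
  integrand tends to 0 for one of two reasons: the equation holds at the limit point of the walk, or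
  \<open>\<kappa>\<close> vanishes around that point and the walk no longer contributes.\<close>

lemma stopped_value_tendsto:
  assumes "piecewise_C2 S g g1 g2 C"
    and [measurable]: "\<pi> \<in> borel_measurable borel" "\<kappa> \<in> borel_measurable borel" "f \<in> borel_measurable borel"
    and \<kappa>: "\<And>x. 0 \<le> \<kappa> x" "\<And>x. \<kappa> x \<le> 1" and f: "\<And>x. 0 \<le> f x" "\<And>x. f x \<le> F"
    and g\<pi>: "\<And>x. g (\<pi> x) = g x" and T: "0 < T"
    and conv: "\<And>s \<omega>. 0 < s \<Longrightarrow> s < T \<Longrightarrow> \<omega> \<in> space M \<Longrightarrow>
      (\<lambda>n. walk \<pi> T n \<omega> (nat \<lfloor>s * real (Suc n) / T\<rfloor>)) \<longlonglongrightarrow> Z s \<omega>"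
    and good: "\<And>s. 0 < s \<Longrightarrow> s < T \<Longrightarrow> AE \<omega> in M.
      (Z s \<omega> \<notin> S \<and> isCont f (Z s \<omega>) \<and> g2 (Z s \<omega>) / 2 + g1 (Z s \<omega>) / 2 = f (Z s \<omega>) * g (Z s \<omega>))
      \<or> (\<forall>\<^sub>F y in nhds (Z s \<omega>). \<kappa> y = 0)"
  shows "(\<lambda>n. \<integral>\<omega>. stopped_value \<kappa> f (T / Suc n) g (walk \<pi> T n \<omega>) (Suc n) \<partial>M) \<longlonglongrightarrow> g 0"
proof -
  interpret piecewise_C2 S g g1 g2 C by fact
  let ?G = "\<lambda>n x. (exp (- (T / Suc n) * f x) * step_op (T / Suc n) g x - g x) / (T / Suc n)"
  \<comment> \<open>The one-step error per unit of time; its expectations, multiplied by the mesh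
    and summed over the grid, bound the defect in Dynkin's formula.\<close>
  define \<theta> where "\<theta> = (\<lambda>n x. \<kappa> x * \<bar>exp (- (T / Suc n) * f x) * step_op (T / Suc n) g x - g x\<bar> / (T / Suc n))"
  have mstep[measurable]: "step_op h g \<in> borel_measurable borel" for h
    unfolding step_op_eq_integral_incr_law[OF measurable_g, abs_def]
  proof -
    interpret L: prob_space "incr_law h" by (rule prob_space_incr_law)
    show "(\<lambda>x. \<integral>d. g (x + d) \<partial>incr_law h) \<in> borel_measurable borel" by measurable
  qed
  have [measurable]: "\<theta> n \<in> borel_measurable borel" for n
    unfolding \<theta>_def by measurable
  have F0: "0 \<le> F" using f[of 0] by linarith
  have hp: "0 < T / Suc n" for n using T by simp
  have \<theta>0: "0 \<le> \<theta> n x" for n x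
    unfolding \<theta>_def by (intro divide_nonneg_nonneg mult_nonneg_nonneg \<kappa> abs_ge_zero less_imp_le[OF hp])
  have \<theta>K: "\<theta> n x \<le> C * (2 + F)" for n x
  proof -
    have "\<kappa> x * \<bar>exp (- (T / Suc n) * f x) * step_op (T / Suc n) g x - g x\<bar> \<le> 1 * (C * (2 + F) * (T / Suc n))"
      using \<kappa> generator_bound[of "T / Suc n" "f x" F x] f hp[of n] by (intro mult_mono) auto
    then show ?thesis unfolding \<theta>_def by (simp only: pos_divide_le_eq[OF hp] mult_1)
  qed
  have m_walk[measurable]: "(\<lambda>\<omega>. walk \<pi> T n \<omega> k) \<in> borel_measurable M" if "k \<le> Suc n" for n k
  proof -
    interpret gaussian_walk M "T / Suc n" "Suc n" "incr T n" using T by (rule walk_X)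
    show ?thesis using that by (intro measurable_chain measurable_D) auto
  qed
  note lt = grid_index_less[OF T]
  \<comment> \<open>Dominated convergence is used twice, over \<open>\<omega>\<close> at each fixed
    time and then over time, both with the constant \<open>C * (2 + F)\<close>.\<close>
  have "(\<lambda>n. \<Sum>k<Suc n. T / Suc n * (\<integral>\<omega>. \<theta> n (walk \<pi> T n \<omega> k) \<partial>M)) \<longlonglongrightarrow> (\<integral>s. indicator {0<..<T} s * 0 \<partial>lborel)"
  proof (rule step_sum_tendsto[OF T])
    show "\<bar>\<integral>\<omega>. \<theta> n (walk \<pi> T n \<omega> k) \<partial>M\<bar> \<le> C * (2 + F)" if "k < Suc n" for n k
    proof -
      have [measurable]: "(\<lambda>\<omega>. walk \<pi> T n \<omega> k) \<in> borel_measurable M" using that by (intro m_walk) simp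
      have "integrable M (\<lambda>\<omega>. \<theta> n (walk \<pi> T n \<omega> k))"
        by (rule integrable_const_bound[of _ "C * (2 + F)"]) (auto simp: \<theta>0 \<theta>K)
      then have "(\<integral>\<omega>. \<theta> n (walk \<pi> T n \<omega> k) \<partial>M) \<le> C * (2 + F)"
        by (intro integral_le_const) (auto simp: \<theta>K)
      then show ?thesis using \<theta>0 by simp
    qed
    show "AE s in lborel. 0 < s \<and> s < T \<longrightarrow>
      (\<lambda>n. \<integral>\<omega>. \<theta> n (walk \<pi> T n \<omega> (nat \<lfloor>s * real (Suc n) / T\<rfloor>)) \<partial>M) \<longlonglongrightarrow> 0"
    proof (intro AE_I2 impI, elim conjE)
      fix s assume s: "0 < s" "s < T"
      let ?k = "\<lambda>n. nat \<lfloor>s * real (Suc n) / T\<rfloor>"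
      have [measurable]: "(\<lambda>\<omega>. walk \<pi> T n \<omega> (?k n)) \<in> borel_measurable M" for n
        by (intro m_walk less_imp_le lt s)
      have "(\<lambda>n. \<integral>\<omega>. \<theta> n (walk \<pi> T n \<omega> (?k n)) \<partial>M) \<longlonglongrightarrow> (\<integral>\<omega>. 0 \<partial>M)"
      proof (rule integral_dominated_convergence[where w="\<lambda>_. C * (2 + F)"])
        show "AE \<omega> in M. (\<lambda>n. \<theta> n (walk \<pi> T n \<omega> (?k n))) \<longlonglongrightarrow> 0"
          using good[OF s] AE_space
        proof eventually_elim
          case (elim \<omega>)
          let ?x = "\<lambda>n. walk \<pi> T n \<omega> (?k n)"
          have x: "?x \<longlonglongrightarrow> Z s \<omega>" using conv s elim by blast
          from elim(1) show ?case
          proof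
            assume Z: "Z s \<omega> \<notin> S \<and> isCont f (Z s \<omega>) \<and> g2 (Z s \<omega>) / 2 + g1 (Z s \<omega>) / 2 = f (Z s \<omega>) * g (Z s \<omega>)"
            have "(\<lambda>n. ?G n (?x n))
                \<longlonglongrightarrow> g2 (Z s \<omega>) / 2 + g1 (Z s \<omega>) / 2 - f (Z s \<omega>) * g (Z s \<omega>)"
            proof (rule generator_limit[OF x])
              show "(\<lambda>n. T / Suc n) \<longlonglongrightarrow> 0" using LIMSEQ_Suc[OF lim_const_over_n[of T]] .
              show "(\<lambda>n. f (?x n)) \<longlonglongrightarrow> f (Z s \<omega>)" by (rule isCont_tendsto_compose[OF conjunct1[OF conjunct2[OF Z]] x])
            qed (use Z hp in auto)
            then have lim: "(\<lambda>n. \<bar>?G n (?x n)\<bar>) \<longlonglongrightarrow> 0"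
              using Z by (intro tendsto_rabs_zero) simp
            show ?thesis
            proof (rule Lim_null_comparison[OF always_eventually lim], rule allI)
              fix n
              have "norm (\<theta> n (?x n)) = \<kappa> (?x n) * \<bar>?G n (?x n)\<bar>"
                using \<kappa>[of "?x n"] hp[of n] by (simp add: \<theta>_def abs_mult del: of_nat_Suc)
              also have "\<dots> \<le> 1 * \<bar>?G n (?x n)\<bar>"
                using \<kappa> by (intro mult_right_mono) auto
              finally show "norm (\<theta> n (?x n)) \<le> \<bar>?G n (?x n)\<bar>"
                by simp
            qed
          next
            assume "\<forall>\<^sub>F y in nhds (Z s \<omega>). \<kappa> y = 0"
            then have "\<forall>\<^sub>F n in sequentially. \<kappa> (?x n) = 0"
              using x by (rule eventually_compose_filterlim)
            then show ?thesis by (intro tendsto_eventually) (auto elim!: eventually_mono simp: \<theta>_def)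
          qed
        qed
        show "AE \<omega> in M. norm (\<theta> n (walk \<pi> T n \<omega> (?k n))) \<le> C * (2 + F)" for n
          by (auto simp: \<theta>0 \<theta>K)
        show "(\<lambda>\<omega>. \<theta> n (walk \<pi> T n \<omega> (?k n))) \<in> borel_measurable M" for n
          by measurable
      qed simp_all
      then show "(\<lambda>n. \<integral>\<omega>. \<theta> n (walk \<pi> T n \<omega> (?k n)) \<partial>M) \<longlonglongrightarrow> 0" by simp
    qed
  qed simp
  then have lim: "(\<lambda>n. \<Sum>k<Suc n. T / Suc n * (\<integral>\<omega>. \<theta> n (walk \<pi> T n \<omega> k) \<partial>M)) \<longlonglongrightarrow> 0" by simp
  show ?thesis
  proof (rule LIM_zero_cancel, rule Lim_null_comparison[OF always_eventually lim], rule allI)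
    fix n
    interpret gaussian_walk M "T / Suc n" "Suc n" "incr T n" using T by (rule walk_X)
    have "norm ((\<integral>\<omega>. stopped_value \<kappa> f (T / Suc n) g (walk \<pi> T n \<omega>) (Suc n) \<partial>M) - g 0)
      \<le> (\<Sum>k<Suc n. \<integral>\<omega>. \<kappa> (walk \<pi> T n \<omega> k) * \<bar>exp (- (T / Suc n) * f (walk \<pi> T n \<omega> k)) * step_op (T / Suc n) g (walk \<pi> T n \<omega> k) - g (walk \<pi> T n \<omega> k)\<bar> \<partial>M)"
      unfolding real_norm_def by (rule dynkin(2)[where F=F and C=C]) (auto simp: \<kappa> f bound_g g\<pi>)
    also have "\<dots> = (\<Sum>k<Suc n. T / Suc n * (\<integral>\<omega>. \<theta> n (walk \<pi> T n \<omega> k) \<partial>M))"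
      using T unfolding \<theta>_def integral_mult_right_zero[symmetric]
      by (intro sum.cong refl Bochner_Integration.integral_cong) (simp del: of_nat_Suc)
    finally show "norm ((\<integral>\<omega>. stopped_value \<kappa> f (T / Suc n) g (walk \<pi> T n \<omega>) (Suc n) \<partial>M) - g 0)
      \<le> (\<Sum>k<Suc n. T / Suc n * (\<integral>\<omega>. \<theta> n (walk \<pi> T n \<omega> k) \<partial>M))" .
  qed
qed

lemma walk_id:
  assumes "\<omega> \<in> space M" shows "walk (\<lambda>x. x) T n \<omega> k = X (real k * (T / Suc n)) \<omega>"
  by (induction k) (use X_zero[OF assms] in \<open>auto simp: incr_def\<close>)

lemma X_grid_tendsto:
  assumes "\<omega> \<in> space M" "0 < T" "0 \<le> s"
  shows "(\<lambda>n. X (real (nat \<lfloor>s * real (Suc n) / T\<rfloor>) * (T / Suc n)) \<omega>) \<longlonglongrightarrow> X s \<omega>"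
  by (rule continuous_on_tendsto_compose[OF continuous_X[OF assms(1)] floor_grid_tendsto])
    (use assms in \<open>auto intro!: always_eventually\<close>)

text \<open>At a fixed positive time the law has no atoms, so the point where \<open>f\<close> and
  the second derivative may jump can be ignored.\<close>

lemma AE_X_neq_zero:
  assumes "0 < s" shows "AE \<omega> in M. X s \<omega> \<noteq> 0"
proof -
  have [measurable]: "X s \<in> borel_measurable M" using assms by (intro measurable_X) simp
  have "sqrt s * z + s / 2 = sqrt s * (z + sqrt s / 2)" for z
    using assms by (simp add: algebra_simps)
  then have "sqrt s * z + s / 2 \<noteq> 0" if "z \<noteq> - (sqrt s / 2)" for z
    using that assms by (simp add: eq_neg_iff_add_eq_0)
  then have "AE z in std_normal_distribution. sqrt s * z + s / 2 \<noteq> 0"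
    using AE_lborel_singleton[of "- (sqrt s / 2)"]
    by (subst AE_density) (auto elim!: eventually_mono)
  then have "AE x in distr M borel (X s). x \<noteq> 0"
    unfolding distr_X[OF assms] incr_law_def by (subst AE_distr_iff) auto
  then show ?thesis by (subst (asm) AE_distr_iff) auto
qed

lemma measurable_X_max [measurable]: "(\<lambda>p. X (max 0 (fst p)) (snd p)) \<in> borel_measurable (borel \<Otimes>\<^sub>M M)"
  using measurable_continuous_process[OF measurable_X continuous_X] by (simp add: case_prod_beta')

lemma measurable_X_max_swap [measurable]: "(\<lambda>p. X (max 0 (snd p)) (fst p)) \<in> borel_measurable (M \<Otimes>\<^sub>M lborel)"
proof -
  have "(\<lambda>p. (snd p, fst p)) \<in> M \<Otimes>\<^sub>M borel \<rightarrow>\<^sub>M borel \<Otimes>\<^sub>M M" by measurable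
  from measurable_compose[OF this measurable_X_max] show ?thesis
    by (simp cong: measurable_cong_sets sets_pair_measure_cong)
qed

text \<open>Fubini turns the statement at each fixed time into one about almost every path. Riemann
  sums of an \<open>f\<close> that is discontinuous at 0 converge along such a path.\<close>

lemma AE_occupation_zero: "AE \<omega> in M. AE s in lborel. 0 < s \<longrightarrow> X s \<omega> \<noteq> 0"
proof -
  interpret P: pair_sigma_finite lborel M ..
  have [measurable]: "(\<lambda>p. X (max 0 (fst p)) (snd p)) \<in> borel_measurable (lborel \<Otimes>\<^sub>M M)"
    using measurable_X_max by (simp cong: measurable_cong_sets sets_pair_measure_cong)
  have meas: "{p \<in> space (lborel \<Otimes>\<^sub>M M). 0 < fst p \<longrightarrow> X (max 0 (fst p)) (snd p) \<noteq> 0} \<in> sets (lborel \<Otimes>\<^sub>M M)"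
    by measurable
  have "AE s in lborel. AE \<omega> in M. 0 < s \<longrightarrow> X (max 0 s) \<omega> \<noteq> 0"
  proof (rule AE_I2)
    fix s :: real
    show "AE \<omega> in M. 0 < s \<longrightarrow> X (max 0 s) \<omega> \<noteq> 0"
      by (cases "0 < s") (use AE_X_neq_zero[of s] in \<open>simp_all add: max_def\<close>)
  qed
  then have "AE \<omega> in M. AE s in lborel. 0 < s \<longrightarrow> X (max 0 s) \<omega> \<noteq> 0"
    using P.AE_commute[OF meas] by blast
  then show ?thesis
    by eventually_elim (auto elim!: eventually_mono simp: max_def)
qed

text \<open>The expected value of the walk without stopping has two limits: \<open>g 0\<close> by
  Dynkin's formula, and the exponential functional by Riemann sums along almost every path.\<close>

lemma feynman_kac:
  assumes "piecewise_C2 {0} g g1 g2 C"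
    and [measurable]: "f \<in> borel_measurable borel" and f: "\<And>x. 0 \<le> f x" "\<And>x. f x \<le> F"
    and fcont: "\<And>x. x \<noteq> 0 \<Longrightarrow> isCont f x"
    and eq: "\<And>x. x \<noteq> 0 \<Longrightarrow> g2 x / 2 + g1 x / 2 = f x * g x" and T: "0 < T"
  shows "(\<integral>\<omega>. exp (- (\<integral>s. indicator {0<..<T} s * f (X (max 0 s) \<omega>) \<partial>lborel)) * g (X T \<omega>) \<partial>M) = g 0"
proof -
  interpret piecewise_C2 "{0}" g g1 g2 C by fact
  let ?I = "\<lambda>\<omega>. \<integral>s. indicator {0<..<T} s * f (X (max 0 s) \<omega>) \<partial>lborel"
  let ?V = "\<lambda>n \<omega>. stopped_value (\<lambda>_. 1) f (T / Suc n) g (walk (\<lambda>x. x) T n \<omega>) (Suc n)"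
  have l1: "(\<lambda>n. \<integral>\<omega>. ?V n \<omega> \<partial>M) \<longlonglongrightarrow> g 0"
  proof (rule stopped_value_tendsto[where Z = X, OF assms(1) _ _ _ _ _ f _ T])
    show "(\<lambda>n. walk (\<lambda>x. x) T n \<omega> (nat \<lfloor>s * real (Suc n) / T\<rfloor>)) \<longlonglongrightarrow> X s \<omega>"
      if "0 < s" "\<omega> \<in> space M" for s \<omega>
      unfolding walk_id[OF that(2)] by (rule X_grid_tendsto) (use that T in auto)
    show "AE \<omega> in M. X s \<omega> \<notin> {0} \<and> isCont f (X s \<omega>) \<and> g2 (X s \<omega>) / 2 + g1 (X s \<omega>) / 2 = f (X s \<omega>) * g (X s \<omega>)
      \<or> (\<forall>\<^sub>F y in nhds (X s \<omega>). (1::real) = 0)" if "0 < s" for s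
      using AE_X_neq_zero[OF that] by eventually_elim (use fcont eq in auto)
  qed auto
  have V: "?V n \<omega> = exp (- (\<Sum>j<Suc n. T / Suc n * f (X (real j * (T / Suc n)) \<omega>))) * g (X T \<omega>)" if "\<omega> \<in> space M" for n \<omega>
  proof -
    \<comment> \<open>The last grid point is \<open>T\<close> for every \<open>n\<close>, so the
      terminal factor is constant in \<open>n\<close>.\<close>
    have "real (Suc n) * (T / Suc n) = T" by simp
    then show ?thesis unfolding stopped_value_no_stop walk_id[OF that] by metis
  qed
  have l2: "(\<lambda>n. \<integral>\<omega>. ?V n \<omega> \<partial>M) \<longlonglongrightarrow> (\<integral>\<omega>. exp (- ?I \<omega>) * g (X T \<omega>) \<partial>M)"
  proof (rule integral_dominated_convergence[where w="\<lambda>_. C"])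
    show "AE \<omega> in M. (\<lambda>n. ?V n \<omega>) \<longlonglongrightarrow> exp (- ?I \<omega>) * g (X T \<omega>)"
      using AE_occupation_zero AE_space
    proof eventually_elim
      case (elim \<omega>)
      have "(\<lambda>n. \<Sum>j<Suc n. T / Suc n * f (X (real j * (T / Suc n)) \<omega>)) \<longlonglongrightarrow> ?I \<omega>"
      proof (rule step_sum_tendsto[OF T, of _ F])
        show "AE s in lborel. 0 < s \<and> s < T \<longrightarrow>
          (\<lambda>n. f (X (real (nat \<lfloor>s * real (Suc n) / T\<rfloor>) * (T / Suc n)) \<omega>)) \<longlonglongrightarrow> f (X (max 0 s) \<omega>)"
          using elim(1)
        proof eventually_elim
          case (elim s)
          show ?case
          proof
            assume s: "0 < s \<and> s < T"
            then have A: "isCont f (X s \<omega>)" using elim fcont by auto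
            have B: "(\<lambda>n. X (real (nat \<lfloor>s * real (Suc n) / T\<rfloor>) * (T / Suc n)) \<omega>) \<longlonglongrightarrow> X s \<omega>"
              using s by (intro X_grid_tendsto \<open>\<omega> \<in> space M\<close> T) simp
            have "max 0 s = s" using s by simp
            then show "(\<lambda>n. f (X (real (nat \<lfloor>s * real (Suc n) / T\<rfloor>) * (T / Suc n)) \<omega>)) \<longlonglongrightarrow> f (X (max 0 s) \<omega>)"
              by (simp only: isCont_tendsto_compose[OF A B])
          qed
        qed
        have "continuous_on UNIV (\<lambda>s. X (max 0 s) \<omega>)"
          by (rule continuous_on_compose2[OF continuous_X[OF elim(2)]]) (auto intro!: continuous_intros)
        then have [measurable]: "(\<lambda>s. X (max 0 s) \<omega>) \<in> borel_measurable borel"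
          by (rule borel_measurable_continuous_onI)
        show "(\<lambda>s. f (X (max 0 s) \<omega>)) \<in> borel_measurable borel" by measurable
      qed (use f in auto)
      then show ?case unfolding V[OF elim(2)] by (intro tendsto_intros)
    qed
    have [measurable]: "X T \<in> borel_measurable M" using T by (intro measurable_X) simp
    show "(\<lambda>\<omega>. exp (- ?I \<omega>) * g (X T \<omega>)) \<in> borel_measurable M" by measurable
    fix n
    have X_grid[measurable]: "X (real j * (T / Suc n)) \<in> borel_measurable M" for j using T by (intro measurable_X) simp
    have "(\<lambda>\<omega>. exp (- (\<Sum>j<Suc n. T / Suc n * f (X (real j * (T / Suc n)) \<omega>))) * g (X T \<omega>)) \<in> borel_measurable M"
      by measurable
    then show "?V n \<in> borel_measurable M"
      by (subst measurable_cong[OF V]) auto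
    show "AE \<omega> in M. norm (?V n \<omega>) \<le> C"
    proof (intro AE_I2)
      fix \<omega> assume \<omega>: "\<omega> \<in> space M"
      have "0 \<le> (\<Sum>j<Suc n. T / Suc n * f (X (real j * (T / Suc n)) \<omega>))"
        using T f by (intro sum_nonneg) simp
      then show "norm (?V n \<omega>) \<le> C"
        unfolding V[OF \<omega>] norm_mult using mult_mono[of "norm (exp (- (\<Sum>j<Suc n. T / Suc n * f (X (real j * (T / Suc n)) \<omega>))))" 1 "norm (g (X T \<omega>))" C] bound_g
        by simp
    qed
  qed auto
  show ?thesis using LIMSEQ_unique[OF l2 l1] .
qed

end

section \<open>Additive functionals over an infinite horizon\<close>

context half_drift_bm
begin

lemma continuous_X_max: "\<omega> \<in> space M \<Longrightarrow> continuous_on UNIV (\<lambda>s. X (max 0 s) \<omega>)"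
  by (rule continuous_on_compose2[OF continuous_X]) (auto intro!: continuous_intros)

text \<open>The right-hand side is jointly measurable in time and path, since \<open>max 0 s\<close>
  avoids the unconstrained negative times; the integrands differ at most on the null set
  \<open>{0}\<close>.\<close>

lemma additive_functional_eq:
  "(\<integral>\<^sup>+s\<in>{0..}. ennreal (f (X s \<omega>)) \<partial>lborel) = (\<integral>\<^sup>+s. indicator {0<..} s * ennreal (f (X (max 0 s) \<omega>)) \<partial>lborel)"
  by (rule nn_integral_cong_AE) (use AE_lborel_singleton[of "0::real"] in \<open>auto elim!: eventually_mono simp: indicator_def max_def\<close>)

lemma measurable_additive_functional:
  assumes [measurable]: "f \<in> borel_measurable borel"
  shows "(\<lambda>\<omega>. \<integral>\<^sup>+s\<in>{0..}. ennreal (f (X s \<omega>)) \<partial>lborel) \<in> borel_measurable M"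
proof -
  show ?thesis unfolding additive_functional_eq by measurable
qed

text \<open>\<open>X m\<close> has the law of \<open>sqrt m * z + m / 2\<close> with one fixed
  normal \<open>z\<close>, and for each \<open>z\<close> this tends to infinity. Convergence in mean
  follows without any almost sure statement about the paths.\<close>

lemma g_X_tendsto_1:
  assumes "piecewise_C2 S g g1 g2 C" and g1: "(g \<longlongrightarrow> 1) at_top"
  shows "(\<lambda>m. \<integral>\<omega>. \<bar>g (X (real (Suc m)) \<omega>) - 1\<bar> \<partial>M) \<longlonglongrightarrow> 0"
proof -
  interpret piecewise_C2 S g g1 g2 C by fact
  interpret N: prob_space std_normal_distribution by (rule prob_space_std_normal)
  have eq: "(\<integral>\<omega>. \<bar>g (X (real (Suc m)) \<omega>) - 1\<bar> \<partial>M)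
      = (\<integral>z. \<bar>g (sqrt (real (Suc m)) * z + real (Suc m) / 2) - 1\<bar> \<partial>std_normal_distribution)" for m
  proof -
    have [measurable]: "X (real (Suc m)) \<in> borel_measurable M" by (intro measurable_X) simp
    have law: "distr M borel (X (real (Suc m))) = incr_law (real (Suc m))" by (rule distr_X) simp
    have "(\<integral>\<omega>. \<bar>g (X (real (Suc m)) \<omega>) - 1\<bar> \<partial>M) = (\<integral>x. \<bar>g x - 1\<bar> \<partial>distr M borel (X (real (Suc m))))"
      by (rule integral_distr[symmetric]) measurable
    also have "\<dots> = (\<integral>z. \<bar>g (sqrt (real (Suc m)) * z + real (Suc m) / 2) - 1\<bar> \<partial>std_normal_distribution)"
      unfolding law incr_law_def by (subst integral_distr) (simp_all del: of_nat_Suc)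
    finally show ?thesis .
  qed
  have "(\<lambda>m. \<integral>z. \<bar>g (sqrt (real (Suc m)) * z + real (Suc m) / 2) - 1\<bar> \<partial>std_normal_distribution)
      \<longlonglongrightarrow> (\<integral>z. 0 \<partial>std_normal_distribution)"
  proof (rule integral_dominated_convergence[where w="\<lambda>_. C + 1"])
    show "AE z in std_normal_distribution. (\<lambda>m. \<bar>g (sqrt (real (Suc m)) * z + real (Suc m) / 2) - 1\<bar>) \<longlonglongrightarrow> 0"
    proof (rule AE_I2)
      fix z :: real
      have "filterlim (\<lambda>m. sqrt (real (Suc m)) * z + real (Suc m) / 2) at_top sequentially"
        by real_asymp
      then show "(\<lambda>m. \<bar>g (sqrt (real (Suc m)) * z + real (Suc m) / 2) - 1\<bar>) \<longlonglongrightarrow> 0"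
        by (intro tendsto_rabs_zero LIM_zero filterlim_compose[OF g1])
    qed
    show "AE z in std_normal_distribution. norm \<bar>g (sqrt (real (Suc m)) * z + real (Suc m) / 2) - 1\<bar> \<le> C + 1" for m
    proof (rule AE_I2)
      fix z show "norm \<bar>g (sqrt (real (Suc m)) * z + real (Suc m) / 2) - 1\<bar> \<le> C + 1"
        using bound_g[of "sqrt (real (Suc m)) * z + real (Suc m) / 2"] unfolding real_norm_def by linarith
    qed
  qed simp_all
  then show ?thesis unfolding eq by simp
qed

text \<open>Up to a finite horizon \<open>feynman_kac\<close> is exact, with \<open>g\<close> at the
  end point as a factor. Replacing that factor by 1 costs at most the mean distance of
  \<open>g (X m)\<close> from 1, since the exponential is at most 1.\<close>

theorem laplace_additive_functional:
  assumes C2: "piecewise_C2 {0} g g1 g2 C"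
    and [measurable]: "f \<in> borel_measurable borel" and f: "\<And>x. 0 \<le> f x" "\<And>x. f x \<le> F"
    and fcont: "\<And>x. x \<noteq> 0 \<Longrightarrow> isCont f x"
    and eq: "\<And>x. x \<noteq> 0 \<Longrightarrow> g2 x / 2 + g1 x / 2 = f x * g x"
    and lim: "(g \<longlongrightarrow> 1) at_top"
  shows "(\<integral>\<omega>. exp_neg (\<integral>\<^sup>+s\<in>{0..}. ennreal (f (X s \<omega>)) \<partial>lborel) \<partial>M) = g 0"
proof -
  interpret piecewise_C2 "{0}" g g1 g2 C by fact
  let ?A = "\<lambda>\<omega>. \<integral>\<^sup>+s\<in>{0..}. ennreal (f (X s \<omega>)) \<partial>lborel"
  define J where "J = (\<lambda>m \<omega>. \<integral>s. indicator {0<..<real (Suc m)} s * f (X (max 0 s) \<omega>) \<partial>lborel)"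
  have [measurable]: "J m \<in> borel_measurable M" for m unfolding J_def by measurable
  have [measurable]: "X (real (Suc m)) \<in> borel_measurable M" for m by (intro measurable_X) simp
  have J0: "0 \<le> J m \<omega>" for m \<omega> unfolding J_def by (intro Bochner_Integration.integral_nonneg) (simp add: f)
  have J_lim: "(\<lambda>m. ennreal (J m \<omega>)) \<longlonglongrightarrow> ?A \<omega>" if \<omega>: "\<omega> \<in> space M" for \<omega>
  proof -
    have [measurable]: "(\<lambda>s. X (max 0 s) \<omega>) \<in> borel_measurable borel"
      by (rule borel_measurable_continuous_onI[OF continuous_X_max[OF \<omega>]])
    have J_eq: "ennreal (J m \<omega>) = (\<integral>\<^sup>+s. indicator {0<..<real (Suc m)} s * ennreal (f (X (max 0 s) \<omega>)) \<partial>lborel)" for m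
    proof -
      have int: "integrable lborel (\<lambda>s. indicator {0<..<real (Suc m)} s * f (X (max 0 s) \<omega>))"
      proof (rule Bochner_Integration.integrable_bound)
        show "integrable lborel (\<lambda>s. indicator {0<..<real (Suc m)} s * F)"
          by (intro integrable_mult_left) (simp add: integrable_indicator_iff del: of_nat_Suc)
        show "AE s in lborel. norm (indicator {0<..<real (Suc m)} s * f (X (max 0 s) \<omega>)) \<le> norm (indicator {0<..<real (Suc m)} s * F)"
          using f order_trans[OF f] by (intro AE_I2) (auto simp: indicator_def)
      qed measurable
      show ?thesis
        unfolding J_def by (subst nn_integral_eq_integral[OF int, symmetric])
          (auto simp: f ennreal_mult' ennreal_indicator intro!: nn_integral_cong)
    qed
    show ?thesis unfolding J_eq additive_functional_eq
    proof (rule nn_integral_LIMSEQ)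
      show "incseq (\<lambda>m s. indicator {0<..<real (Suc m)} s * ennreal (f (X (max 0 s) \<omega>)))"
        by (auto simp: incseq_def le_fun_def indicator_def)
      fix s :: real
      obtain m0 :: nat where "s < real m0" using reals_Archimedean2 by blast
      then have "\<forall>\<^sub>F m in sequentially. indicator {0<..} s * ennreal (f (X (max 0 s) \<omega>))
          = indicator {0<..<real (Suc m)} s * ennreal (f (X (max 0 s) \<omega>))"
        unfolding eventually_sequentially by (intro exI[of _ m0]) (auto simp: indicator_def)
      then show "(\<lambda>m. indicator {0<..<real (Suc m)} s * ennreal (f (X (max 0 s) \<omega>)))
          \<longlonglongrightarrow> indicator {0<..} s * ennreal (f (X (max 0 s) \<omega>))"
        by (rule Lim_transform_eventually[OF tendsto_const])
    qed measurable
  qed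
  have mA: "?A \<in> borel_measurable M" by (rule measurable_additive_functional) measurable
  have l1: "(\<lambda>m. \<integral>\<omega>. exp (- J m \<omega>) \<partial>M) \<longlonglongrightarrow> (\<integral>\<omega>. exp_neg (?A \<omega>) \<partial>M)"
  proof (rule integral_dominated_convergence[where w="\<lambda>_. 1"])
    show "AE \<omega> in M. (\<lambda>m. exp (- J m \<omega>)) \<longlonglongrightarrow> exp_neg (?A \<omega>)"
      using tendsto_exp_neg[OF J_lim] J0 by (intro AE_I2) simp
    show "(\<lambda>\<omega>. exp_neg (?A \<omega>)) \<in> borel_measurable M"
      by (rule measurable_compose[OF mA measurable_exp_neg])
  qed (auto simp: J0)
  have e01: "0 \<le> exp (- J m \<omega>)" "exp (- J m \<omega>) \<le> 1" for m \<omega> using J0 by auto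
  have int1: "integrable M (\<lambda>\<omega>. exp (- J m \<omega>) * g (X (real (Suc m)) \<omega>))" for m
  proof (rule integrable_const_bound[of _ C])
    have "\<bar>exp (- J m \<omega>) * g (X (real (Suc m)) \<omega>)\<bar> \<le> 1 * C" for \<omega>
      unfolding abs_mult using e01[of m \<omega>] bound_g by (intro mult_mono) auto
    then show "AE \<omega> in M. norm (exp (- J m \<omega>) * g (X (real (Suc m)) \<omega>)) \<le> C" by simp
  qed measurable
  have int2: "integrable M (\<lambda>\<omega>. exp (- J m \<omega>))" for m
    by (rule integrable_const_bound[of _ 1]) (use J0 in auto)
  have int3: "integrable M (\<lambda>\<omega>. \<bar>g (X (real (Suc m)) \<omega>) - 1\<bar>)" for m
  proof (intro integrable_abs Bochner_Integration.integrable_diff integrable_const)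
    show "integrable M (\<lambda>\<omega>. g (X (real (Suc m)) \<omega>))"
      by (rule integrable_const_bound[of _ C]) (use bound_g in \<open>simp_all del: of_nat_Suc\<close>)
  qed
  have l2: "(\<lambda>m. (\<integral>\<omega>. exp (- J m \<omega>) \<partial>M) - g 0) \<longlonglongrightarrow> 0"
  proof (rule Lim_null_comparison[OF always_eventually g_X_tendsto_1[OF C2 lim]], rule allI)
    fix m
    have "(\<integral>\<omega>. exp (- J m \<omega>) * g (X (real (Suc m)) \<omega>) \<partial>M) = g 0"
      unfolding J_def by (rule feynman_kac[OF C2 _ f fcont eq]) simp_all
    then have "(\<integral>\<omega>. exp (- J m \<omega>) \<partial>M) - g 0 = (\<integral>\<omega>. exp (- J m \<omega>) - exp (- J m \<omega>) * g (X (real (Suc m)) \<omega>) \<partial>M)"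
      by (simp only: Bochner_Integration.integral_diff[OF int2[of m] int1[of m]])
    also have "norm \<dots> \<le> (\<integral>\<omega>. \<bar>g (X (real (Suc m)) \<omega>) - 1\<bar> \<partial>M)"
    proof (rule order_trans[OF integral_norm_bound integral_mono])
      show "integrable M (\<lambda>\<omega>. norm (exp (- J m \<omega>) - exp (- J m \<omega>) * g (X (real (Suc m)) \<omega>)))"
        by (rule integrable_norm, rule Bochner_Integration.integrable_diff[OF int2[of m] int1[of m]])
      show "integrable M (\<lambda>\<omega>. \<bar>g (X (real (Suc m)) \<omega>) - 1\<bar>)" by (rule int3)
      fix \<omega>
      have "exp (- J m \<omega>) - exp (- J m \<omega>) * g (X (real (Suc m)) \<omega>) = exp (- J m \<omega>) * (1 - g (X (real (Suc m)) \<omega>))"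
        by (simp add: algebra_simps)
      also have "norm \<dots> \<le> 1 * \<bar>g (X (real (Suc m)) \<omega>) - 1\<bar>"
        unfolding norm_mult using e01[of m \<omega>] by (intro mult_mono) auto
      finally show "norm (exp (- J m \<omega>) - exp (- J m \<omega>) * g (X (real (Suc m)) \<omega>)) \<le> \<bar>g (X (real (Suc m)) \<omega>) - 1\<bar>" by simp
    qed
    finally show "norm ((\<integral>\<omega>. exp (- J m \<omega>) \<partial>M) - g 0) \<le> (\<integral>\<omega>. \<bar>g (X (real (Suc m)) \<omega>) - 1\<bar> \<partial>M)" .
  qed
  show ?thesis using LIMSEQ_unique[OF l1 LIM_zero_cancel[OF l2]] .
qed

end

section \<open>Hitting times\<close>

lemma hitting_time_le:
  assumes z: "continuous_on {0..} (\<lambda>t. Z t \<omega>)" "Z 0 \<omega> = 0" and "0 \<le> t" "0 \<le> y \<omega>" "y \<omega> \<le> Z t \<omega>"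
  shows "hitting_time Z y \<omega> \<le> ennreal t"
proof -
  have "continuous_on {0..t} (\<lambda>t. Z t \<omega>)" using z(1) by (rule continuous_on_subset) auto
  then obtain s where s: "0 \<le> s" "s \<le> t" "Z s \<omega> = y \<omega>"
    using IVT'[of "\<lambda>t. Z t \<omega>" 0 "y \<omega>" t] assms by auto
  then have "hitting_time Z y \<omega> \<le> ennreal s"
    unfolding hitting_time_def by (intro Inf_lower) auto
  also have "\<dots> \<le> ennreal t" using s by (intro ennreal_leI)
  finally show ?thesis .
qed

lemma hitting_time_attained:
  assumes z: "continuous_on {0..} (\<lambda>t. Z t \<omega>)" and fin: "hitting_time Z y \<omega> \<noteq> \<top>"
  obtains t where "0 \<le> t" "hitting_time Z y \<omega> = ennreal t" "Z t \<omega> = y \<omega>"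
proof -
  define A where "A = {t\<in>{0..}. Z t \<omega> = y \<omega>}"
  have H: "hitting_time Z y \<omega> = Inf (ennreal ` A)"
    unfolding hitting_time_def A_def by (intro arg_cong[where f=Inf]) auto
  then have "A \<noteq> {}" using fin by auto
  have "closed A" unfolding A_def
    using continuous_closed_preimage_constant[OF z, of "y \<omega>"] by simp
  have bdd: "bdd_below A" by (rule bdd_belowI[of _ 0]) (auto simp: A_def)
  have inA: "Inf A \<in> A" using \<open>A \<noteq> {}\<close> bdd \<open>closed A\<close> by (rule closed_contains_Inf)
  have "Inf (ennreal ` A) = ennreal (Inf A)"
  proof (rule antisym)
    show "Inf (ennreal ` A) \<le> ennreal (Inf A)" using inA by (intro Inf_lower) auto
    show "ennreal (Inf A) \<le> Inf (ennreal ` A)"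
      using bdd by (intro Inf_greatest) (auto intro!: ennreal_leI cInf_lower)
  qed
  then show ?thesis using inA H by (intro that[of "Inf A"]) (auto simp: A_def)
qed

lemma hitting_time_mono:
  assumes "continuous_on {0..} (\<lambda>t. Z t \<omega>)" "Z 0 \<omega> = 0" "0 \<le> y \<omega>" "y \<omega> \<le> y' \<omega>"
  shows "hitting_time Z y \<omega> \<le> hitting_time Z y' \<omega>"
proof (cases "hitting_time Z y' \<omega> = \<top>")
  case False
  obtain t where "0 \<le> t" "hitting_time Z y' \<omega> = ennreal t" "Z t \<omega> = y' \<omega>"
    by (rule hitting_time_attained[OF assms(1) False])
  then show ?thesis using hitting_time_le[of Z \<omega> t y] assms by simp
qed simp

text \<open>Reaching the level by time \<open>t\<close> means that the minimum of
  \<open>\<bar>Z - y\<bar>\<close> over \<open>{0..t}\<close> is 0, and by continuity this can be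
  tested on the countably many points \<open>j * (t / Suc k)\<close>.\<close>

lemma measurable_hitting_time:
  fixes Z :: "real \<Rightarrow> 'a \<Rightarrow> real"
  assumes mZ: "\<And>t. 0 \<le> t \<Longrightarrow> Z t \<in> borel_measurable M" and [measurable]: "y \<in> borel_measurable M"
    and z: "\<And>\<omega>. \<omega> \<in> space M \<Longrightarrow> continuous_on {0..} (\<lambda>t. Z t \<omega>)"
  shows "hitting_time Z y \<in> borel_measurable M"
proof (rule borel_measurableI_le)
  fix e :: ennreal
  show "{\<omega> \<in> space M. hitting_time Z y \<omega> \<le> e} \<in> sets M"
  proof (cases e)
    case (real t)
    have iff: "hitting_time Z y \<omega> \<le> ennreal t \<longleftrightarrow>
      (\<forall>m::nat. \<exists>j k::nat. j \<le> Suc k \<and> \<bar>Z (real j * (t / Suc k)) \<omega> - y \<omega>\<bar> < 1 / Suc m)" (is "?L \<longleftrightarrow> ?R")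
      if \<omega>: "\<omega> \<in> space M" for \<omega>
    proof
      assume ?L
      then have fin: "hitting_time Z y \<omega> \<noteq> \<top>" by (auto simp: top_unique)
      obtain s where s: "0 \<le> s" "hitting_time Z y \<omega> = ennreal s" "Z s \<omega> = y \<omega>"
        by (rule hitting_time_attained[OF z[OF \<omega>] fin])
      then have st: "s \<le> t" using \<open>?L\<close> real by simp
      show ?R
      proof
        fix m :: nat
        show "\<exists>j k::nat. j \<le> Suc k \<and> \<bar>Z (real j * (t / Suc k)) \<omega> - y \<omega>\<bar> < 1 / Suc m"
        proof (cases "t = 0")
          \<comment> \<open>For \<open>t = 0\<close> all grid points collapse to 0, while
            \<open>floor_grid_tendsto\<close> needs a positive horizon.\<close>
          case True
          then show ?thesis using s st by (intro exI[of _ 0]) auto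
        next
          case False
          then have t: "0 < t" using real by simp
          have "(\<lambda>n. Z (real (nat \<lfloor>s * real (Suc n) / t\<rfloor>) * (t / Suc n)) \<omega>) \<longlonglongrightarrow> Z s \<omega>"
            by (rule continuous_on_tendsto_compose[OF z[OF \<omega>] floor_grid_tendsto[OF t s(1)]])
              (use s t in \<open>auto intro!: always_eventually\<close>)
          then have "\<forall>\<^sub>F n in sequentially. dist (Z (real (nat \<lfloor>s * real (Suc n) / t\<rfloor>) * (t / Suc n)) \<omega>) (Z s \<omega>) < 1 / Suc m"
            by (rule tendstoD) simp
          then obtain n where n: "\<bar>Z (real (nat \<lfloor>s * real (Suc n) / t\<rfloor>) * (t / Suc n)) \<omega> - y \<omega>\<bar> < 1 / Suc m"
            using s by (auto simp: eventually_sequentially dist_real_def)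
          have "s * real (Suc n) / t \<le> real (Suc n)"
            using t st mult_right_mono[of s t "real (Suc n)"] by (simp only: pos_divide_le_eq mult.commute of_nat_0_le_iff)
          then have "\<lfloor>s * real (Suc n) / t\<rfloor> \<le> int (Suc n)" by linarith
          then have "nat \<lfloor>s * real (Suc n) / t\<rfloor> \<le> Suc n" by (simp only: nat_le_iff)
          then show ?thesis using n by blast
        qed
      qed
    next
      assume R: ?R
      have "continuous_on {0..t} (\<lambda>s. \<bar>Z s \<omega> - y \<omega>\<bar>)"
        by (intro continuous_intros continuous_on_subset[OF z[OF \<omega>]]) auto
      then obtain s where s: "s \<in> {0..t}" "\<And>u. u \<in> {0..t} \<Longrightarrow> \<bar>Z s \<omega> - y \<omega>\<bar> \<le> \<bar>Z u \<omega> - y \<omega>\<bar>"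
        using continuous_attains_inf[of "{0..t}" "\<lambda>s. \<bar>Z s \<omega> - y \<omega>\<bar>"] real by auto
      have "\<bar>Z s \<omega> - y \<omega>\<bar> \<le> 1 / Suc m" for m :: nat
      proof -
        obtain j k :: nat where jk: "j \<le> Suc k" "\<bar>Z (real j * (t / Suc k)) \<omega> - y \<omega>\<bar> < 1 / Suc m" using R by blast
        have "real j * (t / Suc k) \<le> real (Suc k) * (t / Suc k)" using jk real by (intro mult_right_mono) auto
        then have "real j * (t / Suc k) \<in> {0..t}" using real by simp
        then show ?thesis using s(2) jk(2) by fastforce
      qed
      then have "\<bar>Z s \<omega> - y \<omega>\<bar> \<le> 0"
        using LIMSEQ_le_const[OF LIMSEQ_inverse_real_of_nat, of "\<bar>Z s \<omega> - y \<omega>\<bar>"] by (simp add: inverse_eq_divide)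
      then have "hitting_time Z y \<omega> \<le> ennreal s"
        using s(1) unfolding hitting_time_def by (intro Inf_lower) auto
      also have "\<dots> \<le> ennreal t" using s(1) by (intro ennreal_leI) auto
      finally show ?L .
    qed
    have [measurable]: "(\<lambda>\<omega>. Z (real j * (t / Suc k)) \<omega>) \<in> borel_measurable M" for j k :: nat
      using real by (intro mZ) simp
    have "{\<omega> \<in> space M. hitting_time Z y \<omega> \<le> e} = {\<omega> \<in> space M.
      \<forall>m::nat. \<exists>j k::nat. j \<le> Suc k \<and> \<bar>Z (real j * (t / Suc k)) \<omega> - y \<omega>\<bar> < 1 / Suc m}"
      using iff real by blast
    also have "\<dots> \<in> sets M" by measurable
    finally show ?thesis .
  qed simp
qed

text \<open>\<open>x n\<close> is a walk on the grid and \<open>z\<close> the limit path. For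
  \<open>X\<close> the approximation is exact; the reflected walk is only uniformly close to the
  Skorokhod reflection, which is why an error is allowed.\<close>

locale approximated_path =
  fixes z :: "real \<Rightarrow> real" and x :: "nat \<Rightarrow> nat \<Rightarrow> real" and T :: real
  assumes T_pos: "0 < T"
    and continuous_z: "continuous_on {0..} z" and z_zero: "z 0 = 0" and x_zero: "\<And>n. x n 0 = 0"
    and approx: "\<And>\<epsilon>. 0 < \<epsilon> \<Longrightarrow> \<forall>\<^sub>F n in sequentially. \<forall>k\<le>Suc n. \<bar>x n k - z (real k * (T / Suc n))\<bar> < \<epsilon>"
begin

lemma grid_in: "k \<le> Suc n \<Longrightarrow> real k * (T / Suc n) \<in> {0..T}"
proof -
  assume "k \<le> Suc n"
  then have "real k * (T / Suc n) \<le> real (Suc n) * (T / Suc n)" using T_pos by (intro mult_right_mono) auto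
  then show ?thesis using T_pos by simp
qed

lemma eventually_grid_osc:
  assumes "0 < \<epsilon>"
  shows "\<forall>\<^sub>F n in sequentially. \<forall>s\<in>{0..T}. \<forall>t\<in>{0..T}. \<bar>s - t\<bar> \<le> T / Suc n \<longrightarrow> \<bar>z s - z t\<bar> < \<epsilon>"
proof -
  have "uniformly_continuous_on {0..T} z"
    by (intro compact_uniformly_continuous continuous_on_subset[OF continuous_z]) auto
  then obtain \<delta> where \<delta>: "0 < \<delta>" "\<And>s t. s \<in> {0..T} \<Longrightarrow> t \<in> {0..T} \<Longrightarrow> dist s t < \<delta> \<Longrightarrow> dist (z s) (z t) < \<epsilon>"
    using assms unfolding uniformly_continuous_on_def by metis
  have "\<forall>\<^sub>F n in sequentially. T / Suc n < \<delta>"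
    using order_tendstoD(2)[OF LIMSEQ_Suc[OF lim_const_over_n[of T]] \<delta>(1)] .
  then show ?thesis
  proof eventually_elim
    case (elim n)
    then show ?case using \<delta>(2) by (force simp: dist_real_def)
  qed
qed

lemma approx_at:
  assumes "0 < s" "s < T"
  shows "(\<lambda>n. x n (nat \<lfloor>s * real (Suc n) / T\<rfloor>)) \<longlonglongrightarrow> z s"
proof -
  let ?k = "\<lambda>n. nat \<lfloor>s * real (Suc n) / T\<rfloor>"
  have k: "?k n \<le> Suc n" for n
    using grid_index_less[OF T_pos assms(2)] by (rule less_imp_le)
  have l: "(\<lambda>n. z (real (?k n) * (T / Suc n))) \<longlonglongrightarrow> z s"
    by (rule continuous_on_tendsto_compose[OF continuous_z floor_grid_tendsto[OF T_pos]])
      (use assms T_pos in \<open>auto intro!: always_eventually\<close>)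
  have "(\<lambda>n. x n (?k n) - z (real (?k n) * (T / Suc n))) \<longlonglongrightarrow> 0"
  proof (rule tendstoI)
    fix e :: real assume "0 < e"
    from approx[OF this] show "\<forall>\<^sub>F n in sequentially. dist (x n (?k n) - z (real (?k n) * (T / Suc n))) 0 < e"
      by eventually_elim (use k in \<open>simp add: dist_real_def\<close>)
  qed
  from tendsto_add[OF this l] show ?thesis by simp
qed

context
  fixes g :: "real \<Rightarrow> real" and C r \<mu> :: real
  assumes r_pos: "0 < r" and \<mu>_nonneg: "0 \<le> \<mu>" and g_r: "g r = 1"
    and g_lip: "\<And>u v. \<bar>g u - g v\<bar> \<le> C * \<bar>u - v\<bar>"
    and g_below: "\<And>n k. x n k < r \<Longrightarrow> 0 \<le> g (x n k) \<and> g (x n k) \<le> 1"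
begin

abbreviation sv :: "nat \<Rightarrow> real" where
  "sv n \<equiv> stopped_value (indicator {..<r}) (\<lambda>_. \<mu>) (T / Suc n) g (x n) (Suc n)"

text \<open>Before \<open>\<sigma>\<close> the walk is below \<open>r\<close> and one step changes
  it little, so at \<open>\<sigma>\<close> it has overshot \<open>r\<close> by little and
  \<open>g\<close> is still close to \<open>g r = 1\<close>.\<close>

lemma sv_cases:
  assumes "0 < \<epsilon>"
  shows "\<forall>\<^sub>F n in sequentially. \<exists>\<sigma>\<le>Suc n. sv n = exp (- \<mu> * (real \<sigma> * (T / Suc n))) * g (x n \<sigma>) \<and>
    (\<forall>j<\<sigma>. x n j < r) \<and> (\<sigma> = Suc n \<and> x n \<sigma> < r \<or> r \<le> x n \<sigma> \<and> \<bar>g (x n \<sigma>) - 1\<bar> \<le> \<epsilon>)"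
proof -
  \<comment> \<open>\<open>C + 1\<close> instead of \<open>C\<close> avoids a division by 0. The
    three thirds of \<open>\<delta>\<close> pay for the approximation at two consecutive grid points
    and for the oscillation of \<open>z\<close> between them.\<close>
  define \<delta> where "\<delta> = \<epsilon> / (C + 1)"
  have "0 \<le> C * \<bar>1 - 0\<bar>" using g_lip[of 1 0] by (rule order_trans[OF abs_ge_zero])
  then have C: "0 \<le> C" by simp
  have \<delta>: "0 < \<delta> / 3" using C assms by (simp add: \<delta>_def)
  from approx[OF \<delta>] eventually_grid_osc[OF \<delta>] show ?thesis
  proof eventually_elim
    case (elim n)
    obtain \<sigma> where \<sigma>: "\<sigma> \<le> Suc n" "sv n = exp (- \<mu> * (T / Suc n * real \<sigma>)) * g (x n \<sigma>)"
      "\<forall>j<\<sigma>. x n j < r" "\<sigma> < Suc n \<longrightarrow> r \<le> x n \<sigma>"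
      using stopped_value_cases[of "Suc n" r \<mu> "T / Suc n" g "x n"] by blast
    have close: "\<bar>g (x n \<sigma>) - 1\<bar> \<le> \<epsilon>" if r: "r \<le> x n \<sigma>"
    proof -
      \<comment> \<open>The walk starts at 0 and \<open>0 < r\<close>, so a walk at or above
        \<open>r\<close> has a preceding position, and that one lies below \<open>r\<close>.\<close>
      obtain j where j: "\<sigma> = Suc j" using r r_pos x_zero[of n] by (cases \<sigma>) auto
      have "\<bar>z (real \<sigma> * (T / Suc n)) - z (real j * (T / Suc n))\<bar> < \<delta> / 3"
      proof -
        have "real \<sigma> * (T / Suc n) \<in> {0..T}" using \<sigma>(1) by (rule grid_in)
        moreover have "real j * (T / Suc n) \<in> {0..T}" by (rule grid_in) (use \<sigma>(1) j in simp)
        moreover have "\<bar>real \<sigma> * (T / Suc n) - real j * (T / Suc n)\<bar> \<le> T / Suc n"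
          using T_pos unfolding j left_diff_distrib[symmetric] by simp
        ultimately show ?thesis using elim(2) by blast
      qed
      moreover have "\<bar>x n \<sigma> - z (real \<sigma> * (T / Suc n))\<bar> < \<delta> / 3" "\<bar>x n j - z (real j * (T / Suc n))\<bar> < \<delta> / 3"
        using elim(1) \<sigma>(1) j by auto
      moreover have "x n j < r" using \<sigma>(3) j by simp
      ultimately have "\<bar>x n \<sigma> - r\<bar> \<le> \<delta>" using r by linarith
      then have "\<bar>g (x n \<sigma>) - 1\<bar> \<le> C * \<delta>"
        using g_lip[of "x n \<sigma>" r] mult_left_mono[OF _ C, of "\<bar>x n \<sigma> - r\<bar>" \<delta>] g_r by linarith
      also have "\<dots> \<le> (C + 1) * \<delta>" using \<delta> by (simp add: algebra_simps)
      also have "\<dots> = \<epsilon>" using C by (simp add: \<delta>_def)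
      finally show ?thesis .
    qed
    have "\<sigma> = Suc n \<and> x n \<sigma> < r \<or> r \<le> x n \<sigma> \<and> \<bar>g (x n \<sigma>) - 1\<bar> \<le> \<epsilon>"
      using \<sigma>(1,4) close by (cases "r \<le> x n \<sigma>") auto
    moreover have "sv n = exp (- \<mu> * (real \<sigma> * (T / Suc n))) * g (x n \<sigma>)"
      using \<sigma>(2) by (simp only: mult.commute[of "T / real (Suc n)"])
    ultimately show ?case using \<sigma>(1,3) by blast
  qed
qed

text \<open>When the walk has reached \<open>r\<close>, the path is at least at \<open>r1\<close>
  and has therefore hit \<open>r1\<close> no later. A walk that stays below \<open>r\<close> up to
  \<open>T\<close> contributes at most \<open>exp (- \<mu> * T)\<close>.\<close>

lemma sv_upper:
  assumes r1: "0 \<le> r1" "r1 < r" and "0 < \<epsilon>" and Z: "\<And>t. Z t \<omega> = z t"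
  shows "\<forall>\<^sub>F n in sequentially. sv n \<le> exp_neg (ennreal \<mu> * hitting_time Z (\<lambda>_. r1) \<omega>) + exp (- \<mu> * T) + \<epsilon>"
proof -
  have "0 < r - r1" using r1 by simp
  from sv_cases[OF \<open>0 < \<epsilon>\<close>] approx[OF this] show ?thesis
  proof eventually_elim
    case (elim n)
    then obtain \<sigma> where \<sigma>: "\<sigma> \<le> Suc n" "sv n = exp (- \<mu> * (real \<sigma> * (T / Suc n))) * g (x n \<sigma>)"
      "\<sigma> = Suc n \<and> x n \<sigma> < r \<or> r \<le> x n \<sigma> \<and> \<bar>g (x n \<sigma>) - 1\<bar> \<le> \<epsilon>" by blast
    let ?t = "real \<sigma> * (T / Suc n)" and ?H = "hitting_time Z (\<lambda>_. r1) \<omega>"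
    have t0: "0 \<le> ?t" using T_pos by simp
    have e1: "exp (- \<mu> * ?t) \<le> 1"
      using mult_nonneg_nonneg[OF \<mu>_nonneg t0] by (simp only: exp_le_one_iff mult_minus_left neg_le_0_iff_le)
    have pos: "0 \<le> exp_neg (ennreal \<mu> * ?H)" by (rule exp_neg_nonneg)
    from \<sigma>(3) show ?case
    proof
      assume \<sigma>n: "\<sigma> = Suc n \<and> x n \<sigma> < r"
      then have t: "?t = T" by simp
      have "exp (- \<mu> * T) * g (x n \<sigma>) \<le> exp (- \<mu> * T) * 1" using g_below[of n \<sigma>] \<sigma>n by (intro mult_left_mono) auto
      then have "sv n \<le> exp (- \<mu> * T)" using \<sigma>(2) unfolding t by simp
      then show ?thesis using pos \<open>0 < \<epsilon>\<close> by linarith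
    next
      assume a: "r \<le> x n \<sigma> \<and> \<bar>g (x n \<sigma>) - 1\<bar> \<le> \<epsilon>"
      have "r1 \<le> z ?t" using elim(2) \<sigma>(1) a by fastforce
      then have "?H \<le> ennreal ?t"
        using r1 t0 continuous_z z_zero by (intro hitting_time_le) (simp_all add: Z)
      then have "ennreal \<mu> * ?H \<le> ennreal (\<mu> * ?t)"
        unfolding ennreal_mult[OF \<mu>_nonneg t0] by (intro mult_left_mono) auto
      moreover have "exp_neg (ennreal (\<mu> * ?t)) = exp (- (\<mu> * ?t))"
        by (intro exp_neg_ennreal mult_nonneg_nonneg \<mu>_nonneg t0)
      ultimately have "exp (- \<mu> * ?t) \<le> exp_neg (ennreal \<mu> * ?H)"
        using exp_neg_antimono by (metis mult_minus_left)
      moreover have "exp (- \<mu> * ?t) * g (x n \<sigma>) \<le> exp (- \<mu> * ?t) + \<epsilon>"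
      proof -
        have "g (x n \<sigma>) \<le> 1 + \<epsilon>" using a by linarith
        then have "exp (- \<mu> * ?t) * g (x n \<sigma>) \<le> exp (- \<mu> * ?t) * (1 + \<epsilon>)" by (intro mult_left_mono) auto
        also have "\<dots> \<le> exp (- \<mu> * ?t) + 1 * \<epsilon>"
          unfolding distrib_left mult_1_right using e1 \<open>0 < \<epsilon>\<close> by (intro add_mono mult_right_mono order_refl) auto
        finally show ?thesis unfolding mult_1 .
      qed
      ultimately have "sv n \<le> exp_neg (ennreal \<mu> * ?H) + \<epsilon>" using \<sigma>(2) by linarith
      then show ?thesis using exp_ge_zero[of "- \<mu> * T"] by linarith
    qed
  qed
qed

text \<open>Once the path has hit \<open>r2 > r\<close>, the walk exceeds \<open>r\<close> at the
  next grid point, so it stops at most one cell later. If the path does not hit \<open>r2\<close>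
  before \<open>T\<close>, its transform is at most \<open>exp (- \<mu> * T)\<close>, which is
  subtracted.\<close>

lemma sv_lower:
  assumes r2: "r < r2" and "0 < \<epsilon>" and Z: "\<And>t. Z t \<omega> = z t"
  shows "\<forall>\<^sub>F n in sequentially. exp_neg (ennreal \<mu> * hitting_time Z (\<lambda>_. r2) \<omega>) - exp (- \<mu> * T) - \<epsilon> \<le> sv n"
proof -
  let ?H = "hitting_time Z (\<lambda>_. r2) \<omega>"
  \<comment> \<open>Half of \<open>\<epsilon>\<close> pays for a delay of at most one cell in the
    discount factor, half for \<open>g\<close> not being exactly 1.\<close>
  define e where "e = \<epsilon> / 2"
  have e: "0 < e" using \<open>0 < \<epsilon>\<close> by (simp add: e_def)
  \<comment> \<open>One half of the gap is spent on moving from the hitting time to a grid point,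
    the other on replacing the path by the walk.\<close>
  have d: "0 < (r2 - r) / 2" using r2 by simp
  have "(\<lambda>n. \<mu> * (T / Suc n)) \<longlonglongrightarrow> \<mu> * 0"
    by (intro tendsto_intros LIMSEQ_Suc[OF lim_const_over_n[of T]])
  then have "(\<lambda>n. \<mu> * (T / Suc n)) \<longlonglongrightarrow> 0" by simp
  from order_tendstoD(2)[OF this e]
  have "\<forall>\<^sub>F n in sequentially. \<mu> * (T / Suc n) < e" .
  with sv_cases[OF e] approx[OF d] eventually_grid_osc[OF d] show ?thesis
  proof eventually_elim
    case (elim n)
    then obtain \<sigma> where \<sigma>: "\<sigma> \<le> Suc n" "sv n = exp (- \<mu> * (real \<sigma> * (T / Suc n))) * g (x n \<sigma>)" "\<forall>j<\<sigma>. x n j < r"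
      "\<sigma> = Suc n \<and> x n \<sigma> < r \<or> r \<le> x n \<sigma> \<and> \<bar>g (x n \<sigma>) - 1\<bar> \<le> e" by blast
    let ?h = "T / Suc n"
    let ?t = "real \<sigma> * ?h"
    have h0: "0 < ?h" using T_pos by simp
    have t0: "0 \<le> ?t" using T_pos by simp
    have e1: "exp (- \<mu> * ?t) \<le> 1"
      using mult_nonneg_nonneg[OF \<mu>_nonneg t0] by (simp only: exp_le_one_iff mult_minus_left neg_le_0_iff_le)
    have lower: "- e \<le> sv n"
      using \<sigma>(4)
    proof
      assume "\<sigma> = Suc n \<and> x n \<sigma> < r"
      then have "0 \<le> sv n" unfolding \<sigma>(2) by (intro mult_nonneg_nonneg) (use g_below[of n \<sigma>] in auto)
      then show ?thesis using e by simp
    next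
      assume "r \<le> x n \<sigma> \<and> \<bar>g (x n \<sigma>) - 1\<bar> \<le> e"
      then have "- e \<le> g (x n \<sigma>)" by linarith
      then have "exp (- \<mu> * ?t) * (- e) \<le> sv n" unfolding \<sigma>(2) by (intro mult_left_mono) auto
      moreover have "exp (- \<mu> * ?t) * e \<le> 1 * e" using e1 e by (intro mult_right_mono) auto
      ultimately show ?thesis by linarith
    qed
    show ?case
    proof (cases "?H < ennreal T")
      case False
      then have "ennreal (\<mu> * T) \<le> ennreal \<mu> * ?H"
        using \<mu>_nonneg T_pos by (simp add: ennreal_mult mult_left_mono not_less)
      moreover have "exp_neg (ennreal (\<mu> * T)) = exp (- (\<mu> * T))"
        by (intro exp_neg_ennreal mult_nonneg_nonneg \<mu>_nonneg less_imp_le T_pos)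
      ultimately have "exp_neg (ennreal \<mu> * ?H) \<le> exp (- \<mu> * T)"
        using exp_neg_antimono by (metis mult_minus_left)
      then show ?thesis using lower e by (simp add: e_def)
    next
      case True
      then have fin: "?H \<noteq> \<top>" by auto
      have zc: "continuous_on {0..} (\<lambda>t. Z t \<omega>)" using continuous_z by (simp add: Z)
      obtain t where t: "0 \<le> t" "?H = ennreal t" "Z t \<omega> = r2"
        by (rule hitting_time_attained[OF zc fin])
      have tT: "t < T" using True t by (simp add: ennreal_less_iff)
      \<comment> \<open>The first grid index at or after the hitting time \<open>t\<close>; because
        \<open>t < T\<close> it is at most \<open>Suc n\<close>.\<close>
      define k where "k = nat \<lceil>t / ?h\<rceil>"
      have k1: "t / ?h \<le> real k" "real k \<le> t / ?h + 1"
        using t(1) h0 divide_nonneg_pos[OF t(1) h0] unfolding k_def by linarith+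
      have k2: "t \<le> real k * ?h" "real k * ?h \<le> t + ?h"
      proof -
        show "t \<le> real k * ?h" using k1(1) by (simp only: pos_divide_le_eq[OF h0])
        have "real k * ?h \<le> (t / ?h + 1) * ?h" using k1(2) h0 by (intro mult_right_mono) auto
        also have "\<dots> = t + ?h"
        proof -
          have "(t / h + 1) * h = t + h" if "0 < h" for h using that by (simp add: field_simps)
          from this[OF h0] show ?thesis .
        qed
        finally show "real k * ?h \<le> t + ?h" .
      qed
      have kn: "k \<le> Suc n"
      proof -
        have "t / ?h \<le> real (Suc n)" using tT by (simp only: pos_divide_le_eq[OF h0]) simp
        then have "\<lceil>t / ?h\<rceil> \<le> int (Suc n)" by (simp only: ceiling_le_iff of_int_of_nat_eq)
        then show ?thesis unfolding k_def by (simp only: nat_le_iff)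
      qed
      have "\<bar>z (real k * ?h) - z t\<bar> < (r2 - r) / 2"
      proof -
        have "real k * ?h \<in> {0..T}" using kn by (rule grid_in)
        moreover have "t \<in> {0..T}" using t tT by simp
        moreover have "\<bar>real k * ?h - t\<bar> \<le> ?h" using k2 by linarith
        ultimately show ?thesis using elim(3) by blast
      qed
      moreover have "\<bar>x n k - z (real k * ?h)\<bar> < (r2 - r) / 2" using elim(2) kn by blast
      ultimately have xk: "r < x n k" using t(3) Z by (smt (verit) field_sum_of_halves)
      have \<sigma>k: "\<sigma> \<le> k" using \<sigma>(3) xk by (meson not_le less_asym)
      have "r \<le> x n \<sigma> \<and> \<bar>g (x n \<sigma>) - 1\<bar> \<le> e"
        using \<sigma>(4) \<sigma>k kn xk by (auto dest: le_antisym)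
      then have g1: "1 - e \<le> g (x n \<sigma>)" by linarith
      have "?t \<le> real k * ?h" using \<sigma>k h0 by (intro mult_right_mono) auto
      then have "\<mu> * ?t \<le> \<mu> * (t + ?h)" using k2 \<mu>_nonneg by (intro mult_left_mono) auto
      then have "- \<mu> * ?t \<ge> - (\<mu> * t) + (- (\<mu> * ?h))" by (simp add: distrib_left)
      then have "exp (- \<mu> * ?t) \<ge> exp (- (\<mu> * t)) * exp (- (\<mu> * ?h))"
        unfolding exp_add[symmetric] by simp
      moreover have "exp (- (\<mu> * t)) * exp (- (\<mu> * ?h)) \<ge> exp (- (\<mu> * t)) * (1 - \<mu> * ?h)"
        using exp_ge_add_one_self[of "- (\<mu> * ?h)"] by (intro mult_left_mono) auto
      moreover have "exp (- (\<mu> * t)) * (\<mu> * ?h) \<le> 1 * e"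
      proof (rule mult_mono)
        show "exp (- (\<mu> * t)) \<le> 1" using \<mu>_nonneg t(1) by simp
        show "\<mu> * ?h \<le> e" using elim(4) by (rule less_imp_le)
        show "0 \<le> \<mu> * ?h" by (intro mult_nonneg_nonneg \<mu>_nonneg less_imp_le h0)
      qed simp
      ultimately have m1: "exp (- (\<mu> * t)) - e \<le> exp (- \<mu> * ?t)" by (simp only: right_diff_distrib)
      have "exp (- \<mu> * ?t) * (1 - e) \<le> sv n" unfolding \<sigma>(2) using g1 by (intro mult_left_mono) auto
      moreover have "exp (- \<mu> * ?t) * e \<le> 1 * e" using e1 e by (intro mult_right_mono) auto
      ultimately have "exp (- (\<mu> * t)) - \<epsilon> \<le> sv n" using m1 unfolding e_def right_diff_distrib by linarith
      moreover have "exp_neg (ennreal \<mu> * ?H) = exp (- (\<mu> * t))"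
        using t \<mu>_nonneg exp_neg_ennreal[of "\<mu> * t"] by (simp add: ennreal_mult)
      ultimately show ?thesis using exp_ge_zero[of "- \<mu> * T"] by linarith
    qed
  qed
qed

end

end

text \<open>The bounds hold from an index that depends on the path, so they cannot be integrated for
  a fixed \<open>n\<close>. What passes to the limit is the positive part of \<open>V n - U\<close>,
  which is bounded and tends to 0.\<close>

lemma (in prob_space) lim_integral_le:
  fixes V :: "nat \<Rightarrow> 'a \<Rightarrow> real"
  assumes [measurable]: "\<And>n. V n \<in> borel_measurable M" "U \<in> borel_measurable M"
    and V: "\<And>n \<omega>. \<omega> \<in> space M \<Longrightarrow> \<bar>V n \<omega>\<bar> \<le> C" and U: "\<And>\<omega>. \<omega> \<in> space M \<Longrightarrow> \<bar>U \<omega>\<bar> \<le> K"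
    and ev: "\<And>\<omega> \<epsilon>. \<omega> \<in> space M \<Longrightarrow> 0 < \<epsilon> \<Longrightarrow> \<forall>\<^sub>F n in sequentially. V n \<omega> \<le> U \<omega> + \<epsilon>"
    and L: "(\<lambda>n. \<integral>\<omega>. V n \<omega> \<partial>M) \<longlonglongrightarrow> L"
  shows "L \<le> (\<integral>\<omega>. U \<omega> \<partial>M)"
proof -
  let ?D = "\<lambda>n \<omega>. max 0 (V n \<omega> - U \<omega>)"
  have DK: "norm (?D n \<omega>) \<le> C + K" if "\<omega> \<in> space M" for n \<omega>
    using V[OF that, of n] U[OF that] unfolding real_norm_def by linarith
  have D: "(\<lambda>n. \<integral>\<omega>. ?D n \<omega> \<partial>M) \<longlonglongrightarrow> (\<integral>\<omega>. 0 \<partial>M)"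
  proof (rule integral_dominated_convergence[where w="\<lambda>_. C + K"])
    show "AE \<omega> in M. (\<lambda>n. ?D n \<omega>) \<longlonglongrightarrow> 0"
    proof (intro AE_I2 tendstoI)
      fix \<omega> and e :: real assume \<omega>: "\<omega> \<in> space M" and "0 < e"
      then have "0 < e / 2" by simp
      from ev[OF \<omega> this] show "\<forall>\<^sub>F n in sequentially. dist (?D n \<omega>) 0 < e"
        by eventually_elim (use \<open>0 < e\<close> in \<open>auto simp: dist_real_def max_def\<close>)
    qed
    show "AE \<omega> in M. norm (?D n \<omega>) \<le> C + K" for n using DK by (rule AE_I2)
  qed simp_all
  have intU: "integrable M U" by (rule integrable_const_bound[of _ K]) (use U in auto)
  have intV: "integrable M (V n)" for n by (rule integrable_const_bound[of _ C]) (use V in auto)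
  have intD: "integrable M (?D n)" for n
    by (rule integrable_const_bound[of _ "C + K"]) (use DK in \<open>auto intro!: AE_I2\<close>)
  have "(\<integral>\<omega>. V n \<omega> \<partial>M) \<le> (\<integral>\<omega>. U \<omega> \<partial>M) + (\<integral>\<omega>. ?D n \<omega> \<partial>M)" for n
  proof -
    have "(\<integral>\<omega>. V n \<omega> \<partial>M) \<le> (\<integral>\<omega>. U \<omega> + ?D n \<omega> \<partial>M)"
      by (rule integral_mono[OF intV Bochner_Integration.integrable_add[OF intU intD]]) simp
    also have "\<dots> = (\<integral>\<omega>. U \<omega> \<partial>M) + (\<integral>\<omega>. ?D n \<omega> \<partial>M)"
      by (rule Bochner_Integration.integral_add[OF intU intD])
    finally show ?thesis .
  qed
  moreover have "(\<lambda>n. (\<integral>\<omega>. U \<omega> \<partial>M) + (\<integral>\<omega>. ?D n \<omega> \<partial>M)) \<longlonglongrightarrow> (\<integral>\<omega>. U \<omega> \<partial>M) + 0"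
    using D by (intro tendsto_intros) simp
  ultimately show ?thesis using LIMSEQ_le[OF L] by simp
qed

section \<open>Comparison of hitting-time transforms with a test function\<close>

context half_drift_bm
begin

abbreviation laplace_hit :: "real \<Rightarrow> (real \<Rightarrow> 'a \<Rightarrow> real) \<Rightarrow> real \<Rightarrow> real" where
  "laplace_hit \<mu> Z r \<equiv> \<integral>\<omega>. exp_neg (ennreal \<mu> * hitting_time Z (\<lambda>_. r) \<omega>) \<partial>M"

text \<open>\<open>A\<close> is the state space: the whole line for \<open>X\<close>, the half-line
  for its reflection. The equation is asked only on \<open>A\<close> up to \<open>r\<close>, since
  in general an even test function violates it on the negative side, and so does the bounded
  continuation far above \<open>r\<close>.\<close>

context
  fixes S g g1 g2 C \<pi> Z A r \<mu>
  assumes C2: "piecewise_C2 S g g1 g2 C"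
    and m\<pi>[measurable]: "\<pi> \<in> borel_measurable borel" and g\<pi>: "\<And>x. g (\<pi> x) = g x"
    and mZ: "\<And>t. 0 \<le> t \<Longrightarrow> Z t \<in> borel_measurable M"
    and contZ: "\<And>\<omega>. \<omega> \<in> space M \<Longrightarrow> continuous_on {0..} (\<lambda>t. Z t \<omega>)"
    and Z0: "\<And>\<omega>. \<omega> \<in> space M \<Longrightarrow> Z 0 \<omega> = 0"
    and approxZ: "\<And>T \<omega> \<epsilon>. 0 < T \<Longrightarrow> \<omega> \<in> space M \<Longrightarrow> 0 < \<epsilon> \<Longrightarrow> \<forall>\<^sub>F n in sequentially. \<forall>k\<le>Suc n.
      \<bar>walk \<pi> T n \<omega> k - Z (real k * (T / Suc n)) \<omega>\<bar> < \<epsilon>"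
    and ZA: "\<And>t \<omega>. 0 \<le> t \<Longrightarrow> \<omega> \<in> space M \<Longrightarrow> Z t \<omega> \<in> A"
    and walkA: "\<And>T n \<omega> k. walk \<pi> T n \<omega> k \<in> A"
    and gen: "\<And>y. y \<in> A \<Longrightarrow> y \<le> r \<Longrightarrow> y \<notin> S \<and> g2 y / 2 + g1 y / 2 = \<mu> * g y"
    and g01: "\<And>y. y \<in> A \<Longrightarrow> y < r \<Longrightarrow> 0 \<le> g y \<and> g y \<le> 1"
    and gr: "g r = 1" and r: "0 < r" and \<mu>: "0 < \<mu>"
begin

lemma laplace_hitting_bounds_T:
  assumes T: "0 < T"
  shows "0 \<le> r1 \<Longrightarrow> r1 < r \<Longrightarrow> g 0 \<le> laplace_hit \<mu> Z r1 + exp (- \<mu> * T)"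
    and "r < r2 \<Longrightarrow> laplace_hit \<mu> Z r2 - exp (- \<mu> * T) \<le> g 0"
proof -
  interpret piecewise_C2 S g g1 g2 C by (rule C2)
  let ?V = "\<lambda>n \<omega>. stopped_value (indicator {..<r}) (\<lambda>_. \<mu>) (T / Suc n) g (walk \<pi> T n \<omega>) (Suc n)"
  let ?u = "\<lambda>r \<omega>. exp_neg (ennreal \<mu> * hitting_time Z (\<lambda>_. r) \<omega>)"
  have path: "approximated_path (\<lambda>t. Z t \<omega>) (\<lambda>n. walk \<pi> T n \<omega>) T" if "\<omega> \<in> space M" for \<omega>
    by unfold_locales (use T contZ Z0 approxZ that in auto)
  have lim: "(\<lambda>n. \<integral>\<omega>. ?V n \<omega> \<partial>M) \<longlonglongrightarrow> g 0"
  proof (rule stopped_value_tendsto[where Z = Z and F = \<mu>, OF C2])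
    show "(\<lambda>n. walk \<pi> T n \<omega> (nat \<lfloor>s * real (Suc n) / T\<rfloor>)) \<longlonglongrightarrow> Z s \<omega>"
      if "0 < s" "s < T" "\<omega> \<in> space M" for s \<omega>
      using approximated_path.approx_at[OF path[OF that(3)] that(1,2)] .
    show "AE \<omega> in M. (Z s \<omega> \<notin> S \<and> isCont (\<lambda>_. \<mu>) (Z s \<omega>) \<and> g2 (Z s \<omega>) / 2 + g1 (Z s \<omega>) / 2 = \<mu> * g (Z s \<omega>))
      \<or> (\<forall>\<^sub>F y in nhds (Z s \<omega>). (indicator {..<r} y :: real) = 0)" if s: "0 < s" for s
    proof (rule AE_I2)
      fix \<omega> assume \<omega>: "\<omega> \<in> space M"
      show "(Z s \<omega> \<notin> S \<and> isCont (\<lambda>_. \<mu>) (Z s \<omega>) \<and> g2 (Z s \<omega>) / 2 + g1 (Z s \<omega>) / 2 = \<mu> * g (Z s \<omega>))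
        \<or> (\<forall>\<^sub>F y in nhds (Z s \<omega>). (indicator {..<r} y :: real) = 0)"
      \<comment> \<open>At the level \<open>r\<close> itself \<open>\<kappa>\<close> does not vanish
        nearby, so the equation must hold there too; strictly above \<open>r\<close> the stopping
        takes over.\<close>
      proof (cases "Z s \<omega> \<le> r")
        case True
        then show ?thesis using gen ZA[OF _ \<omega>, of s] s by auto
      next
        case False
        then have "\<forall>\<^sub>F y in nhds (Z s \<omega>). r < y"
          using order_tendstoD(1)[OF filterlim_ident, of r "Z s \<omega>"] by simp
        then show ?thesis by (intro disjI2) (auto elim!: eventually_mono)
      qed
    qed
  qed (use T \<mu> g\<pi> in \<open>auto simp: indicator_def\<close>)
  have mV[measurable]: "?V n \<in> borel_measurable M" for n
  proof -
    interpret gaussian_walk M "T / Suc n" "Suc n" "incr T n" using T by (rule walk_X)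
    have "integrable M (?V n)"
      by (rule dynkin(1)[where F=\<mu> and C=C]) (use \<mu> g\<pi> bound_g in \<open>auto simp: indicator_def\<close>)
    then show ?thesis by (rule borel_measurable_integrable)
  qed
  have VC: "\<bar>?V n \<omega>\<bar> \<le> C" for n \<omega>
  proof -
    obtain \<sigma> where \<sigma>: "?V n \<omega> = exp (- \<mu> * (T / Suc n * real \<sigma>)) * g (walk \<pi> T n \<omega> \<sigma>)"
      using stopped_value_cases[of "Suc n" r \<mu> "T / Suc n" g "walk \<pi> T n \<omega>"] by blast
    have "0 \<le> \<mu> * (T / Suc n * real \<sigma>)" using \<mu> T by (intro mult_nonneg_nonneg) auto
    then have "\<bar>?V n \<omega>\<bar> \<le> 1 * C"
      unfolding \<sigma> abs_mult by (intro mult_mono) (auto simp: bound_g simp del: of_nat_Suc)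
    then show ?thesis by simp
  qed
  have mu[measurable]: "?u y \<in> borel_measurable M" for y
  proof -
    have [measurable]: "hitting_time Z (\<lambda>_. y) \<in> borel_measurable M"
      by (rule measurable_hitting_time) (use mZ contZ in auto)
    show ?thesis by measurable
  qed
  have u01: "0 \<le> ?u y \<omega>" "?u y \<omega> \<le> 1" for y \<omega> by (rule exp_neg_nonneg exp_neg_le_1)+
  have intu: "integrable M (?u y)" for y
    by (rule integrable_const_bound[of _ 1]) (use u01 in auto)
  have e01: "0 \<le> exp (- \<mu> * T)" "exp (- \<mu> * T) \<le> 1" using \<mu> T by auto
  show "g 0 \<le> (\<integral>\<omega>. ?u r1 \<omega> \<partial>M) + exp (- \<mu> * T)" if r1: "0 \<le> r1" "r1 < r"
  proof -
    have "g 0 \<le> (\<integral>\<omega>. ?u r1 \<omega> + exp (- \<mu> * T) \<partial>M)"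
    proof (rule lim_integral_le[OF mV _ _ _ _ lim])
      show "\<bar>?V n \<omega>\<bar> \<le> C" for n \<omega> by (rule VC)
      show "\<bar>?u r1 \<omega> + exp (- \<mu> * T)\<bar> \<le> 2" for \<omega> using u01[of r1 \<omega>] e01 by linarith
      fix \<omega> and \<epsilon> :: real assume \<omega>: "\<omega> \<in> space M" and "0 < \<epsilon>"
      interpret approximated_path "\<lambda>t. Z t \<omega>" "\<lambda>n. walk \<pi> T n \<omega>" T by (rule path[OF \<omega>])
      show "\<forall>\<^sub>F n in sequentially. ?V n \<omega> \<le> ?u r1 \<omega> + exp (- \<mu> * T) + \<epsilon>"
        by (rule sv_upper[where C=C]) (use r \<mu> gr g_lipschitz g01[OF walkA] r1 \<open>0 < \<epsilon>\<close> in \<open>simp_all\<close>)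
    qed measurable
    also have "\<dots> = (\<integral>\<omega>. ?u r1 \<omega> \<partial>M) + exp (- \<mu> * T)"
      by (subst Bochner_Integration.integral_add[OF intu]) (simp_all add: prob_space)
    finally show ?thesis .
  qed
  show "(\<integral>\<omega>. ?u r2 \<omega> \<partial>M) - exp (- \<mu> * T) \<le> g 0" if r2: "r < r2"
  proof -
    \<comment> \<open>Negation turns the lower bound into an instance of the one-sided
      \<open>lim_integral_le\<close>.\<close>
    have "- g 0 \<le> (\<integral>\<omega>. - (?u r2 \<omega> - exp (- \<mu> * T)) \<partial>M)"
    proof (rule lim_integral_le)
      show "(\<lambda>n. \<integral>\<omega>. - ?V n \<omega> \<partial>M) \<longlonglongrightarrow> - g 0" unfolding integral_minus by (intro tendsto_intros lim)
      show "\<bar>- ?V n \<omega>\<bar> \<le> C" for n \<omega> unfolding abs_minus_cancel by (rule VC)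
      show "\<bar>- (?u r2 \<omega> - exp (- \<mu> * T))\<bar> \<le> 2" for \<omega> using u01[of r2 \<omega>] e01 by linarith
      fix \<omega> and \<epsilon> :: real assume \<omega>: "\<omega> \<in> space M" and "0 < \<epsilon>"
      interpret approximated_path "\<lambda>t. Z t \<omega>" "\<lambda>n. walk \<pi> T n \<omega>" T by (rule path[OF \<omega>])
      have "\<forall>\<^sub>F n in sequentially. ?u r2 \<omega> - exp (- \<mu> * T) - \<epsilon> \<le> ?V n \<omega>"
        by (rule sv_lower[where C=C]) (use r \<mu> gr g_lipschitz g01[OF walkA] r2 \<open>0 < \<epsilon>\<close> in \<open>simp_all\<close>)
      then show "\<forall>\<^sub>F n in sequentially. - ?V n \<omega> \<le> - (?u r2 \<omega> - exp (- \<mu> * T)) + \<epsilon>"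
        by (rule eventually_mono) linarith
    qed (intro borel_measurable_uminus borel_measurable_diff mV mu borel_measurable_const)+
    also have "\<dots> = - ((\<integral>\<omega>. ?u r2 \<omega> \<partial>M) - exp (- \<mu> * T))"
      unfolding integral_minus by (subst Bochner_Integration.integral_diff[OF intu]) (simp_all add: prob_space)
    finally show ?thesis by simp
  qed
qed

lemma laplace_hitting_bounds:
  shows "0 \<le> r1 \<Longrightarrow> r1 < r \<Longrightarrow> g 0 \<le> laplace_hit \<mu> Z r1"
    and "r < r2 \<Longrightarrow> laplace_hit \<mu> Z r2 \<le> g 0"
proof -
  have e: "(\<lambda>m. exp (- \<mu> * real (Suc m))) \<longlonglongrightarrow> 0" using \<mu> by real_asymp
  show "g 0 \<le> laplace_hit \<mu> Z r1" if "0 \<le> r1" "r1 < r"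
  proof (rule LIMSEQ_le_const)
    show "(\<lambda>m. laplace_hit \<mu> Z r1 + exp (- \<mu> * real (Suc m)))
        \<longlonglongrightarrow> laplace_hit \<mu> Z r1"
      using tendsto_add[OF tendsto_const e] by simp
    show "\<exists>N. \<forall>m\<ge>N. g 0 \<le> laplace_hit \<mu> Z r1 + exp (- \<mu> * real (Suc m))"
      using laplace_hitting_bounds_T(1)[OF of_nat_0_less_iff[THEN iffD2, OF zero_less_Suc] that] by blast
  qed
  show "laplace_hit \<mu> Z r2 \<le> g 0" if "r < r2"
  proof (rule LIMSEQ_le_const2)
    show "(\<lambda>m. laplace_hit \<mu> Z r2 - exp (- \<mu> * real (Suc m)))
        \<longlonglongrightarrow> laplace_hit \<mu> Z r2"
      using tendsto_diff[OF tendsto_const e] by simp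
    show "\<exists>N. \<forall>m\<ge>N. laplace_hit \<mu> Z r2 - exp (- \<mu> * real (Suc m)) \<le> g 0"
      using laplace_hitting_bounds_T(2)[OF of_nat_0_less_iff[THEN iffD2, OF zero_less_Suc] that] by blast
  qed
qed

end

end

section \<open>Reflection\<close>

definition regulator :: "(real \<Rightarrow> real) \<Rightarrow> real \<Rightarrow> real" where
  "regulator z t = (SUP s\<in>{0..t}. - z s)"

context
  fixes z :: "real \<Rightarrow> real"
  assumes z: "continuous_on {0..} z"
begin

lemma bdd_above_regulator: "bdd_above ((\<lambda>s. - z s) ` {0..t})"
  by (intro compact_imp_bounded[THEN bounded_imp_bdd_above] compact_continuous_image
      continuous_intros continuous_on_subset[OF z]) auto

lemma regulator_upper: "0 \<le> s \<Longrightarrow> s \<le> t \<Longrightarrow> - z s \<le> regulator z t"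
  unfolding regulator_def by (rule cSUP_upper[OF _ bdd_above_regulator]) auto

lemma regulator_least: "0 \<le> t \<Longrightarrow> (\<And>s. 0 \<le> s \<Longrightarrow> s \<le> t \<Longrightarrow> - z s \<le> b) \<Longrightarrow> regulator z t \<le> b"
  unfolding regulator_def by (rule cSUP_least) auto

lemma regulator_mono: "0 \<le> s \<Longrightarrow> s \<le> t \<Longrightarrow> regulator z s \<le> regulator z t"
  by (rule regulator_least) (auto intro: regulator_upper)

lemma regulator_osc:
  assumes "0 \<le> s" "s \<le> t" "\<And>u. s \<le> u \<Longrightarrow> u \<le> t \<Longrightarrow> \<bar>z u - z s\<bar> \<le> \<epsilon>"
  shows "regulator z t \<le> regulator z s + \<epsilon>"
proof (rule regulator_least)
  have \<epsilon>: "0 \<le> \<epsilon>" using assms(3)[of s] assms(2) by simp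
  fix u assume u: "0 \<le> u" "u \<le> t"
  show "- z u \<le> regulator z s + \<epsilon>"
  proof (cases "u \<le> s")
    case True
    then show ?thesis using regulator_upper[of u s] u \<epsilon> by simp
  next
    case False
    then show ?thesis using assms(3)[of u] u regulator_upper[of s s] assms(1) by simp
  qed
qed (use assms in simp)

lemma continuous_on_regulator: "continuous_on {0..} (regulator z)"
proof (rule continuous_onI)
  fix t \<epsilon> :: real assume t: "t \<in> {0..}" and "0 < \<epsilon>"
  \<comment> \<open>Nonnegative times within distance 1 of \<open>t\<close> stay in this compact
    interval, whence \<open>min \<delta> 1\<close> below.\<close>
  have "uniformly_continuous_on {0..t + 1} z"
    by (intro compact_uniformly_continuous continuous_on_subset[OF z]) auto
  then obtain \<delta> where \<delta>: "0 < \<delta>" "\<And>u v. u \<in> {0..t + 1} \<Longrightarrow> v \<in> {0..t + 1} \<Longrightarrow> dist u v < \<delta> \<Longrightarrow> dist (z u) (z v) < \<epsilon>"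
    using \<open>0 < \<epsilon>\<close> unfolding uniformly_continuous_on_def by metis
  have main: "dist (regulator z a) (regulator z b) \<le> \<epsilon>"
    if ab: "0 \<le> a" "a \<le> b" "b \<le> t + 1" "b - a < \<delta>" for a b
  proof -
    have "\<bar>z u - z a\<bar> \<le> \<epsilon>" if "a \<le> u" "u \<le> b" for u
      using \<delta>(2)[of u a] that ab by (simp add: dist_real_def)
    then have "regulator z b \<le> regulator z a + \<epsilon>" by (rule regulator_osc[OF ab(1,2)])
    then show ?thesis using regulator_mono[OF ab(1,2)] by (simp add: dist_real_def)
  qed
  show "\<exists>d>0. \<forall>x'\<in>{0..}. dist x' t < d \<longrightarrow> dist (regulator z x') (regulator z t) \<le> \<epsilon>"
  proof (intro exI[of _ "min \<delta> 1"] conjI ballI impI)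
    fix s assume s: "s \<in> {0..}" "dist s t < min \<delta> 1"
    show "dist (regulator z s) (regulator z t) \<le> \<epsilon>"
    proof (cases "s \<le> t")
      case True
      then show ?thesis using s t by (intro main) (auto simp: dist_real_def)
    next
      case False
      then have "dist (regulator z t) (regulator z s) \<le> \<epsilon>" using s t by (intro main) (auto simp: dist_real_def)
      then show ?thesis by (simp add: dist_commute)
    qed
  qed (use \<delta> in simp)
qed

text \<open>The walk reflected by the absolute value increases its regulator by twice the overshoot
  below \<open>0\<close>, but only at times when it is within one increment of \<open>0\<close>; this keeps it close to
  the Skorokhod reflection.\<close>

lemma abs_chain_approx:
  fixes h \<delta> :: real
  assumes z0: "z 0 = 0" and h: "0 < h"
    and osc: "\<And>s t. 0 \<le> s \<Longrightarrow> s \<le> real N * h \<Longrightarrow> 0 \<le> t \<Longrightarrow> t \<le> real N * h \<Longrightarrow> \<bar>s - t\<bar> \<le> h \<Longrightarrow> \<bar>z s - z t\<bar> \<le> \<delta>"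
    and k: "k \<le> N"
  shows "\<bar>chain abs (\<lambda>i. z (real (Suc i) * h) - z (real i * h)) k - (z (real k * h) + regulator z (real k * h))\<bar> \<le> \<delta>"
proof -
  define y where "y = chain abs (\<lambda>i. z (real (Suc i) * h) - z (real i * h))"
  \<comment> \<open>The regulator of the walk: the total amount added by taking absolute
    values.\<close>
  define L where "L = (\<lambda>k. y k - z (real k * h))"
  have y_Suc: "y (Suc k) = \<bar>y k + (z (real (Suc k) * h) - z (real k * h))\<bar>" for k
    by (simp add: y_def)
  have y0: "0 \<le> y k" for k by (cases k) (simp_all add: y_def)
  have \<delta>0: "0 \<le> \<delta>" using osc[of 0 0] h by simp
  have L_mono: "L i \<le> L j" if "i \<le> j" for i j
    using that by (induction j rule: dec_induct) (auto simp: L_def y_Suc abs_if)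
  have inN: "real i * h \<le> real N * h" if "i \<le> N" for i using that h by (intro mult_right_mono) auto
  \<comment> \<open>\<open>L\<close> grows only when a step would go below 0. The reflected position
    is then at most \<open>\<delta>\<close>, so \<open>L\<close> exceeds the current
    \<open>- z\<close>, and hence the running supremum, by at most \<open>\<delta>\<close>.\<close>
  have up: "L k \<le> regulator z (real k * h) + \<delta>" if "k \<le> N" for k
    using that
  proof (induction k)
    case 0
    have "- z 0 \<le> regulator z 0" by (rule regulator_upper) auto
    then show ?case using \<delta>0 z0 by (simp add: L_def y_def)
  next
    case (Suc k)
    let ?d = "z (real (Suc k) * h) - z (real k * h)"
    have step: "real k * h \<le> real (Suc k) * h" using h by (intro mult_right_mono) auto
    show ?case
    proof (cases "0 \<le> y k + ?d")
      case True
      then have "L (Suc k) = L k" unfolding L_def y_Suc by simp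
      also have "\<dots> \<le> regulator z (real k * h) + \<delta>" using Suc by simp
      also have "\<dots> \<le> regulator z (real (Suc k) * h) + \<delta>"
        using h step by (intro add_right_mono regulator_mono) auto
      finally show ?thesis .
    next
      case False
      have "\<bar>?d\<bar> \<le> \<delta>"
      proof (rule osc)
        show "\<bar>real (Suc k) * h - real k * h\<bar> \<le> h" using h by (simp add: algebra_simps)
        show "0 \<le> real (Suc k) * h" "0 \<le> real k * h" using h by auto
        show "real (Suc k) * h \<le> real N * h" "real k * h \<le> real N * h" using Suc.prems by (auto intro!: inN simp del: of_nat_Suc)
      qed
      then have "y (Suc k) \<le> \<delta>" using False y0[of k] unfolding y_Suc by linarith
      moreover have "- z (real (Suc k) * h) \<le> regulator z (real (Suc k) * h)"
        using h by (intro regulator_upper) auto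
      ultimately show ?thesis unfolding L_def by linarith
    qed
  qed
  \<comment> \<open>\<open>L\<close> is monotone and the walk is nonnegative, so \<open>L\<close>
    dominates \<open>- z\<close> at all earlier grid points; between grid points \<open>z\<close>
    moves by at most \<open>\<delta>\<close>.\<close>
  have low: "regulator z (real k * h) \<le> L k + \<delta>"
  proof (rule regulator_least)
    show "0 \<le> real k * h" using h by simp
    fix s assume s: "0 \<le> s" "s \<le> real k * h"
    define j where "j = nat \<lfloor>s / h\<rfloor>"
    have sh: "0 \<le> s / h" using s h by simp
    have j1: "real j \<le> s / h" "s / h \<le> real j + 1" using sh unfolding j_def by linarith+
    have j2: "real j * h \<le> s" using j1(1) by (simp only: pos_le_divide_eq[OF h])
    have j3: "s \<le> real j * h + h" using j1(2) by (simp only: pos_divide_le_eq[OF h] distrib_right mult_1)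
    have "real j * h \<le> real k * h" using j2 s(2) by (rule order_trans)
    then have "real j \<le> real k" by (simp only: mult_le_cancel_right_pos[OF h])
    then have jk: "j \<le> k" by simp
    have "\<bar>z s - z (real j * h)\<bar> \<le> \<delta>"
    proof (rule osc)
      show "s \<le> real N * h" "real j * h \<le> real N * h" using s(2) inN[OF k] j2 by linarith+
      show "\<bar>s - real j * h\<bar> \<le> h" using j2 j3 by linarith
    qed (use s h in auto)
    moreover have "- z (real j * h) \<le> L k" using L_mono[OF jk] y0[of j] unfolding L_def by linarith
    ultimately show "- z s \<le> L k + \<delta>" by linarith
  qed
  have "\<bar>L k - regulator z (real k * h)\<bar> \<le> \<delta>" using up[OF k] low by linarith
  then show ?thesis unfolding L_def y_def[symmetric] by (simp add: algebra_simps)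
qed

end

context half_drift_bm
begin

definition reflected :: "real \<Rightarrow> 'a \<Rightarrow> real" where
  "reflected t \<omega> = X t \<omega> + regulator (\<lambda>s. X s \<omega>) t"

lemma continuous_reflected: "\<omega> \<in> space M \<Longrightarrow> continuous_on {0..} (\<lambda>t. reflected t \<omega>)"
  unfolding reflected_def by (intro continuous_intros continuous_X continuous_on_regulator)

lemma reflected_nonneg: "\<omega> \<in> space M \<Longrightarrow> 0 \<le> t \<Longrightarrow> 0 \<le> reflected t \<omega>"
  unfolding reflected_def using regulator_upper[OF continuous_X, of \<omega> t t] by simp

lemma reflected_zero: "\<omega> \<in> space M \<Longrightarrow> reflected 0 \<omega> = 0"
  by (simp add: reflected_def regulator_def X_zero)

lemma walk_abs_nonneg: "0 \<le> walk abs T n \<omega> k"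
  by (cases k) auto

lemma walk_abs_approx:
  assumes T: "0 < T" and \<omega>: "\<omega> \<in> space M" and "0 < \<epsilon>"
  shows "\<forall>\<^sub>F n in sequentially. \<forall>k\<le>Suc n. \<bar>walk abs T n \<omega> k - reflected (real k * (T / Suc n)) \<omega>\<bar> < \<epsilon>"
proof -
  have "uniformly_continuous_on {0..T} (\<lambda>t. X t \<omega>)"
    by (intro compact_uniformly_continuous continuous_on_subset[OF continuous_X[OF \<omega>]]) auto
  moreover have "0 < \<epsilon> / 2" using \<open>0 < \<epsilon>\<close> by simp
  ultimately obtain \<delta> where \<delta>: "0 < \<delta>" "\<And>u v. u \<in> {0..T} \<Longrightarrow> v \<in> {0..T} \<Longrightarrow> dist u v < \<delta> \<Longrightarrow> dist (X u \<omega>) (X v \<omega>) < \<epsilon> / 2"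
    unfolding uniformly_continuous_on_def by metis
  have "\<forall>\<^sub>F n in sequentially. T / Suc n < \<delta>"
    using order_tendstoD(2)[OF LIMSEQ_Suc[OF lim_const_over_n[of T]] \<delta>(1)] .
  then show ?thesis
  proof eventually_elim
    case (elim n)
    show ?case
    proof (intro allI impI)
      fix k assume k: "k \<le> Suc n"
      have N: "real (Suc n) * (T / Suc n) = T" by simp
      have "\<bar>walk abs T n \<omega> k - reflected (real k * (T / Suc n)) \<omega>\<bar> \<le> \<epsilon> / 2"
        unfolding incr_def reflected_def
      proof (rule abs_chain_approx[OF continuous_X[OF \<omega>] X_zero[OF \<omega>] _ _ k])
        show "0 < T / Suc n" using T by simp
        show "\<bar>X s \<omega> - X t \<omega>\<bar> \<le> \<epsilon> / 2"
          if "0 \<le> s" "s \<le> real (Suc n) * (T / Suc n)" "0 \<le> t" "t \<le> real (Suc n) * (T / Suc n)" "\<bar>s - t\<bar> \<le> T / Suc n" for s t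
          using \<delta>(2)[of s t] that elim unfolding N dist_real_def by fastforce
      qed
      also have "\<dots> < \<epsilon>" using \<open>0 < \<epsilon>\<close> by simp
      finally show "\<bar>walk abs T n \<omega> k - reflected (real k * (T / Suc n)) \<omega>\<bar> < \<epsilon>" .
    qed
  qed
qed

text \<open>The supremum runs over uncountably many times; measurability is inherited from the
  reflected walks, whose end values converge to the reflection.\<close>

lemma measurable_reflected:
  assumes t: "0 \<le> t" shows "reflected t \<in> borel_measurable M"
proof (cases "t = 0")
  case True
  then show ?thesis using measurable_cong[of M "reflected 0" "\<lambda>_. 0" borel] reflected_zero by simp
next
  case False
  then have t: "0 < t" using t by simp
  show ?thesis
  proof (rule borel_measurable_LIMSEQ_real)
    show "(\<lambda>\<omega>. walk abs t n \<omega> (Suc n)) \<in> borel_measurable M" for n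
    proof -
      interpret gaussian_walk M "t / Suc n" "Suc n" "incr t n" using t by (rule walk_X)
      show ?thesis by (intro measurable_chain measurable_D) auto
    qed
    fix \<omega> assume \<omega>: "\<omega> \<in> space M"
    show "(\<lambda>n. walk abs t n \<omega> (Suc n)) \<longlonglongrightarrow> reflected t \<omega>"
    proof (rule tendstoI)
      fix e :: real assume "0 < e"
      from walk_abs_approx[OF t \<omega> this] show "\<forall>\<^sub>F n in sequentially. dist (walk abs t n \<omega> (Suc n)) (reflected t \<omega>) < e"
      proof eventually_elim
        case (elim n)
        have "real (Suc n) * (t / Suc n) = t" by simp
        then show ?case using elim[rule_format, of "Suc n"] unfolding dist_real_def by (metis order_refl)
      qed
    qed
  qed
qed

end

section \<open>Explicit test functions\<close>

definition glue :: "real \<Rightarrow> (real \<Rightarrow> real) \<Rightarrow> (real \<Rightarrow> real) \<Rightarrow> real \<Rightarrow> real" where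
  "glue p u v x = (if x \<le> p then u x else v x)"

lemma eventually_glue_left: "x < p \<Longrightarrow> \<forall>\<^sub>F y in nhds x. glue p u v y = u y"
  by (rule eventually_mono[OF order_tendstoD(2)[OF filterlim_ident]]) (auto simp: glue_def)

lemma eventually_glue_right: "p < x \<Longrightarrow> \<forall>\<^sub>F y in nhds x. glue p u v y = v y"
  by (rule eventually_mono[OF order_tendstoD(1)[OF filterlim_ident]]) (auto simp: glue_def)

lemma isCont_glue:
  assumes "x \<le> p \<Longrightarrow> isCont u x" "p \<le> x \<Longrightarrow> isCont v x" "x = p \<Longrightarrow> u p = v p"
  shows "isCont (glue p u v) x"
proof (cases x p rule: linorder_cases)
  case less
  then show ?thesis using assms(1) isCont_cong[OF eventually_glue_left[OF less]] by simp
next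
  case greater
  then show ?thesis using assms(2) isCont_cong[OF eventually_glue_right[OF greater]] by simp
next
  case equal
  have "(u \<longlongrightarrow> u p) (at p)" "(v \<longlongrightarrow> u p) (at p)"
    using assms equal by (simp_all add: isCont_def)
  then have "(u \<longlongrightarrow> u p) (at_left p)" "(v \<longlongrightarrow> u p) (at_right p)"
    by (blast dest: filterlim_at_split[THEN iffD1])+
  moreover have "\<forall>\<^sub>F y in at_left p. u y = glue p u v y" "\<forall>\<^sub>F y in at_right p. v y = glue p u v y"
    by (simp_all add: glue_def eventually_at_filter)
  ultimately have "(glue p u v \<longlongrightarrow> u p) (at p)"
    unfolding filterlim_at_split[of "glue p u v"] by (blast intro: Lim_transform_eventually)
  then show ?thesis using equal by (simp add: isCont_def glue_def)
qed

lemma DERIV_glue: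
  assumes "x \<le> p \<Longrightarrow> (u has_real_derivative u1 x) (at x)" "p \<le> x \<Longrightarrow> (v has_real_derivative v1 x) (at x)"
    and "x = p \<Longrightarrow> u p = v p" "x = p \<Longrightarrow> u1 p = v1 p"
  shows "(glue p u v has_real_derivative glue p u1 v1 x) (at x)"
proof (cases x p rule: linorder_cases)
  case less
  then show ?thesis using assms(1) unfolding DERIV_cong_ev[OF refl eventually_glue_left[OF less] refl] by (simp add: glue_def[of p u1])
next
  case greater
  then show ?thesis using assms(2) unfolding DERIV_cong_ev[OF refl eventually_glue_right[OF greater] refl] by (simp add: glue_def[of p u1])
next
  case equal
  have u: "((\<lambda>y. (u y - u p) / (y - p)) \<longlongrightarrow> u1 p) (at p)"
    using assms(1) equal by (simp add: has_field_derivative_iff)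
  have v: "((\<lambda>y. (v y - v p) / (y - p)) \<longlongrightarrow> v1 p) (at p)"
    using assms(2) equal by (simp add: has_field_derivative_iff)
  let ?du = "\<lambda>y. (u y - u p) / (y - p)" and ?dv = "\<lambda>y. (v y - v p) / (y - p)" and ?d = "\<lambda>y. (glue p u v y - u p) / (y - p)"
  have "(?dv \<longlongrightarrow> u1 p) (at p)" using v assms(4)[OF equal] by simp
  with u have "(?du \<longlongrightarrow> u1 p) (at_left p)" "(?dv \<longlongrightarrow> u1 p) (at_right p)"
    by (blast dest: filterlim_at_split[THEN iffD1])+
  moreover have "\<forall>\<^sub>F y in at_left p. ?du y = ?d y" "\<forall>\<^sub>F y in at_right p. ?dv y = ?d y"
    using assms(3) equal by (simp_all add: glue_def eventually_at_filter)
  ultimately have "(?d \<longlongrightarrow> u1 p) (at p)"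
    unfolding filterlim_at_split[of ?d] by (blast intro: Lim_transform_eventually)
  then show ?thesis using equal by (simp add: has_field_derivative_iff glue_def)
qed

lemma piecewise_C2_glue:
  assumes u: "\<And>x. x \<le> p \<Longrightarrow> (u has_real_derivative u1 x) (at x)" "\<And>x. x \<le> p \<Longrightarrow> (u1 has_real_derivative u2 x) (at x)"
      "\<And>x. x \<le> p \<Longrightarrow> isCont u2 x"
    and v: "\<And>x. p \<le> x \<Longrightarrow> (v has_real_derivative v1 x) (at x)" "\<And>x. p \<le> x \<Longrightarrow> (v1 has_real_derivative v2 x) (at x)"
      "\<And>x. p \<le> x \<Longrightarrow> isCont v2 x"
    and p: "u p = v p" "u1 p = v1 p"
    and uC: "\<And>x. x \<le> p \<Longrightarrow> \<bar>u x\<bar> \<le> C \<and> \<bar>u1 x\<bar> \<le> C \<and> \<bar>u2 x\<bar> \<le> C"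
    and vC: "\<And>x. p \<le> x \<Longrightarrow> \<bar>v x\<bar> \<le> C \<and> \<bar>v1 x\<bar> \<le> C \<and> \<bar>v2 x\<bar> \<le> C"
  shows "piecewise_C2 {p} (glue p u v) (glue p u1 v1) (glue p u2 v2) C"
proof
  fix x
  show "(glue p u v has_real_derivative glue p u1 v1 x) (at x)" by (rule DERIV_glue) (use u v p in auto)
  show "isCont (glue p u1 v1) x" by (rule isCont_glue) (auto intro: DERIV_isCont[OF u(2)] DERIV_isCont[OF v(2)] p)
  show "(glue p u1 v1 has_real_derivative glue p u2 v2 x) (at x)" if "x \<notin> {p}"
    by (rule DERIV_glue) (use u v that in auto)
  show "isCont (glue p u2 v2) x" if "x \<notin> {p}" by (rule isCont_glue) (use u v that in auto)
  show "\<bar>glue p u v x\<bar> \<le> C" "\<bar>glue p u1 v1 x\<bar> \<le> C" "\<bar>glue p u2 v2 x\<bar> \<le> C"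
    using uC[of x] vC[of x] by (auto simp: glue_def)
qed simp

text \<open>The test functions for hitting times grow exponentially. Beyond a level \<open>p\<close> above the stopping
  level they are continued so as to stay bounded; no equation needs to hold there.\<close>

context
  fixes u u1 u2 :: "real \<Rightarrow> real" and p :: real
  assumes u: "\<And>x. (u has_real_derivative u1 x) (at x)" "\<And>x. (u1 has_real_derivative u2 x) (at x)"
    "\<And>x. isCont u2 x"
begin

text \<open>\<open>sin\<close> has value 0 and slope 1 at 0, so value and slope match at
  \<open>p\<close>.\<close>

definition "ext = glue p u (\<lambda>x. u p + u1 p * sin (x - p))"
definition "ext1 = glue p u1 (\<lambda>x. u1 p * cos (x - p))"
definition "ext2 = glue p u2 (\<lambda>x. - u1 p * sin (x - p))"

lemma ext_facts:
  shows "(ext has_real_derivative ext1 x) (at x)"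
    and "isCont ext1 x"
    and "x \<noteq> p \<Longrightarrow> (ext1 has_real_derivative ext2 x) (at x)"
    and "x \<noteq> p \<Longrightarrow> isCont ext2 x"
  unfolding ext_def ext1_def ext2_def
     apply (rule DERIV_glue)
        apply (auto intro!: u derivative_eq_intros)[4]
    apply (rule isCont_glue)
      apply (auto intro!: DERIV_isCont[OF u(2)] continuous_intros)[3]
   apply (rule DERIV_glue)
      apply (auto intro!: u derivative_eq_intros)[4]
  apply (rule isCont_glue)
    apply (auto intro!: u continuous_intros)
  done

lemma ext_bounds:
  assumes C: "\<bar>u (min x p)\<bar> \<le> C" "\<bar>u1 (min x p)\<bar> \<le> C" "\<bar>u2 (min x p)\<bar> \<le> C"
  shows "\<bar>ext x\<bar> \<le> 2 * C" "\<bar>ext1 x\<bar> \<le> 2 * C" "\<bar>ext2 x\<bar> \<le> 2 * C"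
proof -
  have C0: "0 \<le> C" using C(1) by linarith
  have s: "\<bar>u1 p * sin y\<bar> \<le> C" "\<bar>u1 p * cos y\<bar> \<le> C" if "p < x" for y
  proof -
    have "\<bar>u1 p\<bar> \<le> C" using C(2) that by simp
    then have "\<bar>u1 p * sin y\<bar> \<le> C * 1" "\<bar>u1 p * cos y\<bar> \<le> C * 1"
      unfolding abs_mult using C0 by (intro mult_mono; simp)+
    then show "\<bar>u1 p * sin y\<bar> \<le> C" "\<bar>u1 p * cos y\<bar> \<le> C" by simp_all
  qed
  show "\<bar>ext x\<bar> \<le> 2 * C"
  proof (cases "x \<le> p")
    case False
    then have "\<bar>u p\<bar> \<le> C" "\<bar>u1 p * sin (x - p)\<bar> \<le> C" using C(1) s by auto
    then have "\<bar>u p + u1 p * sin (x - p)\<bar> \<le> 2 * C" by linarith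
    then show ?thesis using False by (simp add: ext_def glue_def)
  qed (use C C0 in \<open>simp add: ext_def glue_def min_def\<close>)
  show "\<bar>ext1 x\<bar> \<le> 2 * C"
    using C(2) C0 s(2)[of "x - p"] by (cases "x \<le> p") (simp_all add: ext1_def glue_def min_def)
  show "\<bar>ext2 x\<bar> \<le> 2 * C"
    using C(3) C0 s(1)[of "x - p"] by (cases "x \<le> p") (simp_all add: ext2_def glue_def min_def)
qed

lemma ext_left:
  assumes "x \<le> p" shows "ext x = u x" "ext1 x = u1 x" "ext2 x = u2 x"
  using assms by (simp_all add: ext_def ext1_def ext2_def glue_def)

lemma piecewise_C2_ext:
  assumes "\<And>x. x \<le> p \<Longrightarrow> \<bar>u x\<bar> \<le> C \<and> \<bar>u1 x\<bar> \<le> C \<and> \<bar>u2 x\<bar> \<le> C"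
  shows "piecewise_C2 {p} ext ext1 ext2 (2 * C)"
  by unfold_locales (use ext_facts ext_bounds assms in auto)

text \<open>The Neumann condition \<open>u1 0 = 0\<close> makes the even continuation C1 across 0,
  and its second derivative is again even. So 0 is not exceptional; only the two seams at
  \<open>p\<close> and \<open>- p\<close> are.\<close>

lemma piecewise_C2_even_ext:
  assumes p: "0 < p" and C: "\<And>x. 0 \<le> x \<Longrightarrow> x \<le> p \<Longrightarrow> \<bar>u x\<bar> \<le> C \<and> \<bar>u1 x\<bar> \<le> C \<and> \<bar>u2 x\<bar> \<le> C"
    and u10: "u1 0 = 0"
  shows "piecewise_C2 {p, - p} (glue 0 (\<lambda>x. ext (- x)) ext) (glue 0 (\<lambda>x. - ext1 (- x)) ext1)
    (glue 0 (\<lambda>x. ext2 (- x)) ext2) (2 * C)"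
proof
  have ext10: "ext1 0 = 0" using ext_left(2)[of 0] p u10 by simp
  have bounds: "\<bar>ext x\<bar> \<le> 2 * C" "\<bar>ext1 x\<bar> \<le> 2 * C" "\<bar>ext2 x\<bar> \<le> 2 * C" if "0 \<le> x" for x
    using ext_bounds[of x C] C[of "min x p"] that p by auto
  fix x
  show "(glue 0 (\<lambda>x. ext (- x)) ext has_real_derivative glue 0 (\<lambda>x. - ext1 (- x)) ext1 x) (at x)"
  proof (rule DERIV_glue)
    have "((\<lambda>x. ext (- x)) has_real_derivative ext1 (- x) * (- 1)) (at x)"
      by (intro DERIV_chain2[of ext _ uminus] ext_facts(1)) (auto intro!: derivative_eq_intros)
    then show "((\<lambda>x. ext (- x)) has_real_derivative - ext1 (- x)) (at x)" by simp
  qed (use ext_facts(1) ext10 in auto)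
  show "isCont (glue 0 (\<lambda>x. - ext1 (- x)) ext1) x"
  proof (rule isCont_glue)
    show "isCont (\<lambda>x. - ext1 (- x)) x"
      by (intro continuous_minus isCont_o2[of _ uminus ext1] continuous_ident ext_facts(2))
  qed (use ext_facts(2) ext10 in auto)
  show "(glue 0 (\<lambda>x. - ext1 (- x)) ext1 has_real_derivative glue 0 (\<lambda>x. ext2 (- x)) ext2 x) (at x)" if "x \<notin> {p, -p}"
  proof (rule DERIV_glue)
    have "((\<lambda>x. ext1 (- x)) has_real_derivative ext2 (- x) * (- 1)) (at x)"
      using that by (intro DERIV_chain2[of ext1 _ uminus] ext_facts(3)) (auto intro!: derivative_eq_intros)
    from DERIV_minus[OF this] show "((\<lambda>x. - ext1 (- x)) has_real_derivative ext2 (- x)) (at x)" by simp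
  qed (use that ext_facts(3) ext10 in auto)
  show "isCont (glue 0 (\<lambda>x. ext2 (- x)) ext2) x" if "x \<notin> {p, -p}"
  proof (rule isCont_glue)
    show "isCont (\<lambda>x. ext2 (- x)) x"
      using that by (intro isCont_o2[of _ uminus ext2] continuous_minus continuous_ident ext_facts(4)) auto
  qed (use that ext_facts(4) in auto)
  show "\<bar>glue 0 (\<lambda>x. ext (- x)) ext x\<bar> \<le> 2 * C" "\<bar>glue 0 (\<lambda>x. - ext1 (- x)) ext1 x\<bar> \<le> 2 * C"
    "\<bar>glue 0 (\<lambda>x. ext2 (- x)) ext2 x\<bar> \<le> 2 * C"
    using bounds[of x] bounds[of "- x"] by (auto simp: glue_def)
qed simp

end

text \<open>Its square is the integrand of the theorem; for positive \<open>a\<close> it is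
  \<open>- dy/dx\<close> for the coordinate \<open>y = ln (1 + exp (- x) / a)\<close>.\<close>

definition slope :: "real \<Rightarrow> real \<Rightarrow> real" where
  "slope a x = 1 / (1 + a * exp x)"

text \<open>In the scale coordinate \<open>y = ln (1 + exp (- x) / a)\<close> the drifting Brownian motion becomes a
  time change of a Brownian motion with drift \<open>- 1/2\<close>, whose eigenfunctions are exponentials. The
  exponent below is \<open>- \<sigma> y\<close> for \<open>b = ln a\<close> and \<open>\<sigma> (r - y)\<close> for \<open>b = ln (1 + a)\<close>.\<close>

definition prof :: "real \<Rightarrow> real \<Rightarrow> real \<Rightarrow> real \<Rightarrow> real" where
  "prof a b \<sigma> x = exp (\<sigma> * (b + x - ln (1 + a * exp x)))"

lemma DERIV_slope:
  assumes "0 < 1 + a * exp x"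
  shows "(slope a has_real_derivative - slope a x * (1 - slope a x)) (at x)"
proof -
  have "(slope a has_real_derivative - (a * exp x) / (1 + a * exp x)^2) (at x)"
    unfolding slope_def[abs_def] using assms
    by (auto intro!: derivative_eq_intros simp: power2_eq_square)
  moreover have "- (a * exp x) / (1 + a * exp x)^2 = - slope a x * (1 - slope a x)"
    using assms by (simp add: slope_def field_simps power2_eq_square)
  ultimately show ?thesis by simp
qed

lemma DERIV_prof:
  assumes "0 < 1 + a * exp x"
  shows "(prof a b \<sigma> has_real_derivative \<sigma> * slope a x * prof a b \<sigma> x) (at x)"
proof -
  have "((\<lambda>x. \<sigma> * (b + x - ln (1 + a * exp x))) has_real_derivative \<sigma> * (1 - a * exp x / (1 + a * exp x))) (at x)"
    using assms by (auto intro!: derivative_eq_intros)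
  moreover have "1 - a * exp x / (1 + a * exp x) = slope a x"
    using assms by (simp add: slope_def field_simps)
  ultimately have "((\<lambda>x. \<sigma> * (b + x - ln (1 + a * exp x))) has_real_derivative \<sigma> * slope a x) (at x)" by simp
  from DERIV_chain2[OF DERIV_exp this] show ?thesis
    unfolding prof_def[abs_def] by (simp add: mult_ac)
qed

text \<open>Adding the first derivative cancels the \<open>- 1\<close> in the bracket:
  \<open>prof\<close> satisfies \<open>g'' / 2 + g' / 2 = \<mu> * (slope a x)^2 * g\<close> with
  \<open>\<mu> = \<sigma> * (1 + \<sigma>) / 2\<close>. This rate is unchanged when
  \<open>\<sigma>\<close> becomes \<open>- (1 + \<sigma>)\<close>, which gives the second
  solution.\<close>

lemma DERIV_prof1:
  assumes "0 < 1 + a * exp x"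
  shows "((\<lambda>x. \<sigma> * slope a x * prof a b \<sigma> x) has_real_derivative
    \<sigma> * slope a x * ((1 + \<sigma>) * slope a x - 1) * prof a b \<sigma> x) (at x)"
  by (rule DERIV_cong[OF DERIV_mult[OF DERIV_cmult[OF DERIV_slope[OF assms]] DERIV_prof[OF assms]]])
    (simp add: algebra_simps power2_eq_square)

lemma isCont_prof2:
  assumes "0 < 1 + a * exp x"
  shows "isCont (\<lambda>x. \<sigma> * slope a x * ((1 + \<sigma>) * slope a x - 1) * prof a b \<sigma> x) x"
  by (intro continuous_intros DERIV_isCont[OF DERIV_slope[OF assms]] DERIV_isCont[OF DERIV_prof[OF assms]])

text \<open>The prefactors of \<open>prof\<close> in the three functions contain at most two
  factors, each bounded by \<open>(1 + \<bar>\<sigma>\<bar>) * (1 + Q)\<close>, whence the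
  square.\<close>

lemma prof_bounds:
  assumes q: "0 \<le> slope a x" "slope a x \<le> Q" and B: "prof a b \<sigma> x \<le> B"
  defines "C \<equiv> B * ((1 + \<bar>\<sigma>\<bar>) * (1 + Q))\<^sup>2"
  shows "\<bar>prof a b \<sigma> x\<bar> \<le> C" "\<bar>\<sigma> * slope a x * prof a b \<sigma> x\<bar> \<le> C"
    "\<bar>\<sigma> * slope a x * ((1 + \<sigma>) * slope a x - 1) * prof a b \<sigma> x\<bar> \<le> C"
proof -
  let ?P = "prof a b \<sigma> x" and ?q = "slope a x" and ?s = "\<bar>\<sigma>\<bar>"
  let ?K = "(1 + ?s) * (1 + Q)"
  have P: "0 < ?P" by (simp add: prof_def)
  have Q: "0 \<le> Q" using q by linarith
  have K1: "1 \<le> ?K" using Q mult_mono[of 1 "1 + ?s" 1 "1 + Q"] by simp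
  have K2: "1 \<le> ?K\<^sup>2" "?K \<le> ?K\<^sup>2" using one_le_power[OF K1, of 2] power_increasing[OF _ K1, of 1 2] by simp_all
  have sq: "?s * ?q \<le> ?K" using q Q by (intro mult_mono) auto
  have t: "\<bar>(1 + \<sigma>) * ?q - 1\<bar> \<le> ?K"
  proof -
    have "\<bar>(1 + \<sigma>) * ?q - 1\<bar> \<le> \<bar>1 + \<sigma>\<bar> * ?q + 1" using q abs_triangle_ineq4[of "(1 + \<sigma>) * ?q" 1] by (simp add: abs_mult)
    also have "\<dots> \<le> (1 + ?s) * Q + (1 + ?s) * 1" using q Q by (intro add_mono mult_mono) auto
    finally show ?thesis by (simp add: algebra_simps)
  qed
  have B0: "0 \<le> B" using P B by linarith
  have main: "\<bar>c * ?P\<bar> \<le> C" if "\<bar>c\<bar> \<le> ?K\<^sup>2" for c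
  proof -
    have "\<bar>c * ?P\<bar> = \<bar>c\<bar> * ?P" using P by (simp add: abs_mult)
    also have "\<dots> \<le> ?K\<^sup>2 * B" using that B P by (intro mult_mono) auto
    finally show ?thesis by (simp add: C_def mult.commute)
  qed
  show "\<bar>?P\<bar> \<le> C" using main[of 1] K2 by simp
  show "\<bar>\<sigma> * ?q * ?P\<bar> \<le> C" using main[of "\<sigma> * ?q"] sq K2 q by (simp add: abs_mult)
  have "\<bar>\<sigma> * ?q * ((1 + \<sigma>) * ?q - 1)\<bar> \<le> ?K * ?K"
    unfolding abs_mult[of "\<sigma> * ?q"] using sq t q by (intro mult_mono) (auto simp: abs_mult)
  then show "\<bar>\<sigma> * ?q * ((1 + \<sigma>) * ?q - 1) * ?P\<bar> \<le> C" by (intro main) (simp add: power2_eq_square)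
qed

lemma slope_pos:
  assumes "0 < 1 + a * exp x" shows "0 < slope a x"
  using assms by (simp add: slope_def)

lemma slope_le_1: "0 \<le> a \<Longrightarrow> slope a x \<le> 1"
  unfolding slope_def by (subst divide_le_eq_1) (auto simp: add_nonneg_nonneg)

lemma measurable_slope [measurable]: "slope a \<in> borel_measurable borel"
  unfolding slope_def[abs_def] by measurable

lemma prof_neg_le_1:
  assumes a: "-1 < a" and x: "x \<le> 0" and "0 \<le> \<rho>" and pos: "0 < 1 + a * exp x"
  shows "prof a (ln (1 + a)) \<rho> x \<le> 1"
proof -
  have "(1 + a) * exp x \<le> 1 + a * exp x" using x by (simp add: algebra_simps)
  then have "ln ((1 + a) * exp x) \<le> ln (1 + a * exp x)" using a pos by (subst ln_le_cancel_iff) auto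
  then have "ln (1 + a) + x - ln (1 + a * exp x) \<le> 0" using a by (simp add: ln_mult)
  then show ?thesis using \<open>0 \<le> \<rho>\<close> by (simp add: prof_def mult_nonneg_nonpos)
qed

text \<open>For negative \<open>a\<close> the denominator of \<open>slope\<close> is smallest at
  \<open>x = 0\<close> on this half-line; the bound opens the whole range \<open>-1 < a\<close> of
  the third identity.\<close>

lemma one_plus_a_exp_ge:
  assumes "-1 < a" "x \<le> (0::real)" shows "min 1 (1 + a) \<le> 1 + a * exp x"
proof (cases "0 \<le> a")
  case False
  then have "a * 1 \<le> a * exp x" using assms by (intro mult_left_mono_neg) auto
  then show ?thesis by simp
qed simp

lemma lincomb_bound:
  fixes A :: real
  assumes "\<bar>A\<bar> \<le> CA" "\<bar>B\<bar> \<le> CB" "0 \<le> p" "0 \<le> q" "0 < K"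
  shows "\<bar>(p * A + q * B) / K\<bar> \<le> (p * CA + q * CB) / K"
proof -
  have "\<bar>p * A + q * B\<bar> \<le> p * \<bar>A\<bar> + q * \<bar>B\<bar>"
    using assms abs_triangle_ineq[of "p * A" "q * B"] by (simp add: abs_mult)
  also have "\<dots> \<le> p * CA + q * CB" using assms by (intro add_mono mult_left_mono)
  finally show ?thesis using assms by (simp add: divide_right_mono)
qed

text \<open>The solution of \<open>c''/2 + c'/2 = \<mu> c\<close> with \<open>c 0 = 1\<close>, \<open>c' 0 = 0\<close> for \<open>\<mu> = \<rho> (1 + \<rho>) / 2\<close>.\<close>

definition refl_sol :: "real \<Rightarrow> real \<Rightarrow> real" where
  "refl_sol \<rho> t = (\<rho> * exp (- (1 + \<rho>) * t) + (1 + \<rho>) * exp (\<rho> * t)) / (1 + 2 * \<rho>)"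

lemma refl_sol_pos: "0 < \<rho> \<Longrightarrow> 0 < refl_sol \<rho> t"
  unfolding refl_sol_def by (intro divide_pos_pos add_pos_pos mult_pos_pos) auto

lemma refl_sol_0: "0 < \<rho> \<Longrightarrow> refl_sol \<rho> 0 = 1"
  by (simp add: refl_sol_def)

section \<open>Explicit transforms of the three additive functionals\<close>

context half_drift_bm
begin

text \<open>The test function is \<open>exp (- \<rho> * y)\<close>, smooth on the whole line. At
  infinity \<open>y\<close> tends to 0, which gives the limit 1, and at the starting point
  \<open>y = ln ((1 + a) / a)\<close>.\<close>

lemma laplace_total:
  assumes a: "0 < a" and \<rho>: "0 < \<rho>" and \<mu>: "\<mu> = \<rho> * (1 + \<rho>) / 2"
  shows "(\<integral>\<omega>. exp_neg (\<integral>\<^sup>+s\<in>{0..}. ennreal (\<mu> * (slope a (X s \<omega>))\<^sup>2) \<partial>lborel) \<partial>M) = exp (- \<rho> * ln ((1 + a) / a))"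
proof -
  let ?P = "prof a (ln a) \<rho>"
  have pos: "0 < 1 + a * exp x" for x using a by (simp add: add_pos_nonneg)
  have P1: "?P x \<le> 1" for x
  proof -
    have "ln (a * exp x) \<le> ln (1 + a * exp x)" using a pos by (subst ln_le_cancel_iff) auto
    then have "ln a + x - ln (1 + a * exp x) \<le> 0" using a by (simp add: ln_mult)
    then show ?thesis using \<rho> by (simp add: prof_def mult_nonneg_nonpos)
  qed
  have q: "0 \<le> slope a x" "slope a x \<le> 1" for x
    using slope_pos[OF pos, of x] slope_le_1[of a x] a by auto
  have "(\<integral>\<omega>. exp_neg (\<integral>\<^sup>+s\<in>{0..}. ennreal (\<mu> * (slope a (X s \<omega>))\<^sup>2) \<partial>lborel) \<partial>M) = ?P 0"
  proof (rule laplace_additive_functional)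
    show "piecewise_C2 {0} ?P (\<lambda>x. \<rho> * slope a x * ?P x) (\<lambda>x. \<rho> * slope a x * ((1 + \<rho>) * slope a x - 1) * ?P x)
      (1 * ((1 + \<bar>\<rho>\<bar>) * (1 + 1))\<^sup>2)"
    proof
      fix x
      show "(?P has_real_derivative \<rho> * slope a x * ?P x) (at x)" by (rule DERIV_prof[OF pos])
      show "isCont (\<lambda>x. \<rho> * slope a x * ?P x) x" by (rule DERIV_isCont[OF DERIV_prof1[OF pos]])
      show "((\<lambda>x. \<rho> * slope a x * ?P x) has_real_derivative \<rho> * slope a x * ((1 + \<rho>) * slope a x - 1) * ?P x) (at x)"
        by (rule DERIV_prof1[OF pos])
      show "isCont (\<lambda>x. \<rho> * slope a x * ((1 + \<rho>) * slope a x - 1) * ?P x) x" by (rule isCont_prof2[OF pos])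
    qed (use prof_bounds[OF q P1] in auto)
    show "isCont (\<lambda>x. \<mu> * (slope a x)\<^sup>2) x" for x
      by (intro continuous_intros DERIV_isCont[OF DERIV_slope[OF pos]])
    show "0 \<le> \<mu> * (slope a x)\<^sup>2" for x using \<rho> by (simp add: \<mu>)
    show "\<mu> * (slope a x)\<^sup>2 \<le> \<mu>" for x
      using \<rho> q[of x] mult_left_mono[of "(slope a x)\<^sup>2" 1 \<mu>] by (simp add: \<mu> power_le_one)
    show "\<rho> * slope a x * ((1 + \<rho>) * slope a x - 1) * ?P x / 2 + \<rho> * slope a x * ?P x / 2 = \<mu> * (slope a x)\<^sup>2 * ?P x" for x
      by (simp add: \<mu> algebra_simps power2_eq_square add_divide_distrib diff_divide_distrib)
    have "((\<lambda>x. \<rho> * (ln a + x - ln (1 + a * exp x))) \<longlongrightarrow> 0) at_top" using a by real_asymp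
    then show "(?P \<longlongrightarrow> 1) at_top" unfolding prof_def[abs_def] using tendsto_exp by fastforce
  qed measurable
  then show ?thesis using a by (simp add: prof_def ln_div algebra_simps)
qed

text \<open>On the negative half-line \<open>f\<close> vanishes and bounded solutions are constant,
  because the other solution \<open>exp (- x)\<close> explodes there. C1 matching then forces slope
  0 at 0, so on the positive side the solution is \<open>refl_sol \<rho> (r - y)\<close>, divided by
  its value at infinity.\<close>

lemma laplace_positive_part:
  assumes a: "0 < a" and \<rho>: "0 < \<rho>" and \<mu>: "\<mu> = \<rho> * (1 + \<rho>) / 2" and r: "r = ln ((1 + a) / a)"
  shows "(\<integral>\<omega>. exp_neg (\<integral>\<^sup>+s\<in>{0..}. ennreal (\<mu> * ((slope a (X s \<omega>))\<^sup>2 * indicator {0<..} (X s \<omega>))) \<partial>lborel) \<partial>M)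
    = 1 / refl_sol \<rho> r"
proof -
  \<comment> \<open>Absorbs both the denominator in \<open>refl_sol\<close> and the normalisation to
    the limit 1 at infinity.\<close>
  define K where "K = (1 + 2 * \<rho>) * refl_sol \<rho> r"
  have c: "0 < refl_sol \<rho> r" using \<rho> by (rule refl_sol_pos)
  have K: "0 < K" using \<rho> c by (simp add: K_def)
  let ?b = "ln (1 + a)" and ?q = "slope a"
  let ?s = "- (1 + \<rho>)"
  let ?A = "prof a ?b ?s" and ?B = "prof a ?b \<rho>"
  let ?A1 = "\<lambda>x. ?s * ?q x * ?A x" and ?B1 = "\<lambda>x. \<rho> * ?q x * ?B x"
  let ?A2 = "\<lambda>x. ?s * ?q x * ((1 + ?s) * ?q x - 1) * ?A x" and ?B2 = "\<lambda>x. \<rho> * ?q x * ((1 + \<rho>) * ?q x - 1) * ?B x"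
  let ?v = "\<lambda>x. (\<rho> * ?A x + (1 + \<rho>) * ?B x) / K"
  let ?v1 = "\<lambda>x. (\<rho> * ?A1 x + (1 + \<rho>) * ?B1 x) / K"
  let ?v2 = "\<lambda>x. (\<rho> * ?A2 x + (1 + \<rho>) * ?B2 x) / K"
  let ?u = "\<lambda>x::real. 1 / refl_sol \<rho> r"
  have pos: "0 < 1 + a * exp x" for x using a by (simp add: add_pos_nonneg)
  have q: "0 \<le> ?q x" "?q x \<le> 1" for x
    using slope_pos[OF pos, of x] slope_le_1[of a x] a by auto
  have AB0: "?A 0 = 1" "?B 0 = 1" by (simp_all add: prof_def)
  have v0: "?v 0 = 1 / refl_sol \<rho> r" 
  proof -
    have e: "\<rho> * 1 + (1 + \<rho>) * 1 = 1 + 2 * \<rho>" and nz: "1 + 2 * \<rho> \<noteq> 0" using \<rho> by simp_all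
    show ?thesis unfolding AB0 K_def e by (rule nonzero_divide_mult_cancel_left[OF nz])
  qed
  \<comment> \<open>The quantity in the middle is \<open>r - y\<close>; it runs from 0 at the origin
    to \<open>r\<close> at infinity.\<close>
  have t: "0 \<le> ?b + x - ln (1 + a * exp x) \<and> ?b + x - ln (1 + a * exp x) \<le> r" if "0 \<le> x" for x
  proof -
    have "1 + a * exp x \<le> (1 + a) * exp x" using that by (simp add: algebra_simps)
    then have "ln (1 + a * exp x) \<le> ln ((1 + a) * exp x)" using pos a by (subst ln_le_cancel_iff) auto
    moreover have "ln (a * exp x) \<le> ln (1 + a * exp x)" using a pos by (subst ln_le_cancel_iff) auto
    ultimately show ?thesis using a by (simp add: ln_mult ln_div r)
  qed
  have BB: "?B x \<le> exp (\<rho> * r)" if "0 \<le> x" for x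
    using t[OF that] \<rho> by (simp add: prof_def)
  have r0: "0 \<le> r" using t[of 0] by simp
  have AA: "?A x \<le> exp (\<rho> * r)" if "0 \<le> x" for x
  proof -
    have "?A x \<le> 1" using t[OF that] \<rho> by (simp add: prof_def mult_nonpos_nonneg)
    also have "\<dots> \<le> exp (\<rho> * r)" using \<rho> r0 by simp
    finally show ?thesis .
  qed
  define CA where "CA = exp (\<rho> * r) * ((1 + \<bar>?s\<bar>) * (1 + 1))\<^sup>2"
  define CB where "CB = exp (\<rho> * r) * ((1 + \<bar>\<rho>\<bar>) * (1 + 1))\<^sup>2"
  define C where "C = (\<rho> * CA + (1 + \<rho>) * CB) / K + 1 / refl_sol \<rho> r"
  have CAB: "0 \<le> (\<rho> * CA + (1 + \<rho>) * CB) / K" using \<rho> K by (simp add: CA_def CB_def)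
  note Ab = prof_bounds[OF q AA, folded CA_def] and Bb = prof_bounds[OF q BB, folded CB_def]
  let ?f = "\<lambda>x. \<mu> * ((?q x)\<^sup>2 * indicator {0<..} x)"
  have "(\<integral>\<omega>. exp_neg (\<integral>\<^sup>+s\<in>{0..}. ennreal (?f (X s \<omega>)) \<partial>lborel) \<partial>M) = glue 0 ?u ?v 0"
  proof (rule laplace_additive_functional[where g = "glue 0 ?u ?v"])
    show "piecewise_C2 {0} (glue 0 ?u ?v) (glue 0 (\<lambda>_. 0) ?v1) (glue 0 (\<lambda>_. 0) ?v2) C"
    proof (rule piecewise_C2_glue)
      fix x :: real
      show "(?v has_real_derivative ?v1 x) (at x)"
        by (intro DERIV_cdivide DERIV_add DERIV_cmult DERIV_prof pos)
      show "(?v1 has_real_derivative ?v2 x) (at x)"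
        by (intro DERIV_cdivide DERIV_add DERIV_cmult DERIV_prof1 pos)
      show "isCont ?v2 x"
        by (intro continuous_divide continuous_add continuous_mult_left continuous_const isCont_prof2 pos) (use K in simp)
      show "1 / refl_sol \<rho> r = ?v 0" using v0 by simp
      show "0 = ?v1 0" unfolding AB0 by (simp add: algebra_simps)
      show "\<bar>1 / refl_sol \<rho> r\<bar> \<le> C \<and> \<bar>0\<bar> \<le> C \<and> \<bar>0\<bar> \<le> C" using c CAB by (simp add: C_def)
      assume x: "0 \<le> x"
      have "(\<rho> * CA + (1 + \<rho>) * CB) / K \<le> C" using c by (simp add: C_def)
      moreover have "\<bar>?v x\<bar> \<le> (\<rho> * CA + (1 + \<rho>) * CB) / K"
        by (rule lincomb_bound[OF Ab(1)[OF x] Bb(1)[OF x]]) (use \<rho> K in auto)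
      moreover have "\<bar>?v1 x\<bar> \<le> (\<rho> * CA + (1 + \<rho>) * CB) / K"
        by (rule lincomb_bound[OF Ab(2)[OF x] Bb(2)[OF x]]) (use \<rho> K in auto)
      moreover have "\<bar>?v2 x\<bar> \<le> (\<rho> * CA + (1 + \<rho>) * CB) / K"
        by (rule lincomb_bound[OF Ab(3)[OF x] Bb(3)[OF x]]) (use \<rho> K in auto)
      ultimately show "\<bar>?v x\<bar> \<le> C \<and> \<bar>?v1 x\<bar> \<le> C \<and> \<bar>?v2 x\<bar> \<le> C" by linarith
    qed simp_all
    show "isCont ?f x" if "x \<noteq> 0" for x
    proof (cases "0 < x")
      case True
      have "\<forall>\<^sub>F y in nhds x. ?f y = \<mu> * (?q y)\<^sup>2"
        by (rule eventually_mono[OF order_tendstoD(1)[OF filterlim_ident True]]) simp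
      from isCont_cong[OF this] show ?thesis
        by (simp only:) (intro continuous_intros DERIV_isCont[OF DERIV_slope[OF pos]])
    next
      case False
      then have "x < 0" using that by simp
      have "\<forall>\<^sub>F y in nhds x. ?f y = 0"
        by (rule eventually_mono[OF order_tendstoD(2)[OF filterlim_ident \<open>x < 0\<close>]]) simp
      from isCont_cong[OF this] show ?thesis by simp
    qed
    show "0 \<le> ?f x" for x using \<rho> by (simp add: \<mu>)
    show "?f x \<le> \<mu>" for x
      using \<rho> q[of x] mult_left_mono[of "(?q x)\<^sup>2" 1 \<mu>] by (simp add: \<mu> power_le_one indicator_def)
    show "glue 0 (\<lambda>_. 0) ?v2 x / 2 + glue 0 (\<lambda>_. 0) ?v1 x / 2 = ?f x * glue 0 ?u ?v x" if "x \<noteq> 0" for x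
    proof (cases "0 < x")
      case True
      have "?A2 x / 2 + ?A1 x / 2 = \<mu> * (?q x)\<^sup>2 * ?A x" "?B2 x / 2 + ?B1 x / 2 = \<mu> * (?q x)\<^sup>2 * ?B x"
        by (simp_all add: \<mu> algebra_simps power2_eq_square add_divide_distrib diff_divide_distrib)
      then have "(\<rho> * (?A2 x / 2 + ?A1 x / 2) + (1 + \<rho>) * (?B2 x / 2 + ?B1 x / 2)) / K = \<mu> * (?q x)\<^sup>2 * ?v x"
        by (simp only:) (simp add: algebra_simps add_divide_distrib)
      then have "?v2 x / 2 + ?v1 x / 2 = \<mu> * (?q x)\<^sup>2 * ?v x"
        by (simp only: distrib_left add_divide_distrib times_divide_eq_right divide_divide_eq_left mult.commute[of 2] add_ac)
      then show ?thesis using True by (simp add: glue_def)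
    qed (use that in \<open>simp add: glue_def\<close>)
    have "((\<lambda>x. ?b + x - ln (1 + a * exp x)) \<longlongrightarrow> ?b - ln a) at_top" using a by real_asymp
    moreover have "?b - ln a = r" using a by (simp add: r ln_div)
    ultimately have "((\<lambda>x. ?b + x - ln (1 + a * exp x)) \<longlongrightarrow> r) at_top" by simp
    then have "(?v \<longlongrightarrow> (\<rho> * exp (?s * r) + (1 + \<rho>) * exp (\<rho> * r)) / K) at_top"
      unfolding prof_def using K by (intro tendsto_intros) auto
    moreover have "(\<rho> * exp (?s * r) + (1 + \<rho>) * exp (\<rho> * r)) / K = 1"
      using c \<rho> K unfolding K_def refl_sol_def by simp
    ultimately have "(?v \<longlongrightarrow> 1) at_top" by simp
    moreover have "\<forall>\<^sub>F x in at_top. ?v x = glue 0 ?u ?v x"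
      using eventually_gt_at_top[of 0] by eventually_elim (simp add: glue_def)
    ultimately show "(glue 0 ?u ?v \<longlongrightarrow> 1) at_top" by (rule Lim_transform_eventually)
  qed measurable
  then show ?thesis by (simp add: glue_def)
qed

text \<open>On the positive half-line \<open>f\<close> vanishes and the solutions with limit 1 are
  \<open>1 + c * exp (- x)\<close>; on the negative one the exponent \<open>\<rho>\<close> stays
  bounded, while \<open>- (1 + \<rho>)\<close> explodes at minus infinity. For negative
  \<open>a\<close> the singularity of \<open>slope\<close> lies at a positive \<open>x\<close>,
  where the indicator removes it.\<close>

lemma laplace_negative_part:
  assumes a: "-1 < a" and \<rho>: "0 < \<rho>" and \<mu>: "\<mu> = \<rho> * (1 + \<rho>) / 2"
  shows "(\<integral>\<omega>. exp_neg (\<integral>\<^sup>+s\<in>{0..}. ennreal (\<mu> * ((slope a (X s \<omega>))\<^sup>2 * indicator {..<0} (X s \<omega>))) \<partial>lborel) \<partial>M)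
    = (1 + a) / (1 + a + \<rho>)"
proof -
  \<comment> \<open>Matching slopes at 0 requires \<open>K * \<rho> / (1 + a) = 1 - K\<close>, where
    \<open>1 / (1 + a)\<close> is \<open>slope a 0\<close>; this is the solution.\<close>
  define K where "K = (1 + a) / (1 + a + \<rho>)"
  have K: "0 \<le> K" "K \<le> 1" using a \<rho> by (simp_all add: K_def)
  let ?q = "slope a" and ?P = "prof a (ln (1 + a)) \<rho>"
  \<comment> \<open>For negative \<open>a\<close> the values of \<open>slope\<close> on the negative
    half-line exceed 1; they are largest at 0, where \<open>slope a 0 = 1 / (1 + a)\<close>.\<close>
  define Q where "Q = 1 / min 1 (1 + a)"
  let ?u = "\<lambda>x. K * ?P x" and ?u1 = "\<lambda>x. K * (\<rho> * ?q x * ?P x)"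
  let ?u2 = "\<lambda>x. K * (\<rho> * ?q x * ((1 + \<rho>) * ?q x - 1) * ?P x)"
  let ?v = "\<lambda>x. 1 + (K - 1) * exp (- x)" and ?v1 = "\<lambda>x. - (K - 1) * exp (- x)" and ?v2 = "\<lambda>x. (K - 1) * exp (- x)"
  have m: "0 < min 1 (1 + a)" using a by simp
  have pos: "0 < 1 + a * exp x" if "x \<le> 0" for x
    using one_plus_a_exp_ge[OF a that] m by linarith
  have q: "0 \<le> ?q x" "?q x \<le> Q" if "x \<le> 0" for x
    using one_plus_a_exp_ge[OF a that] m pos[OF that] unfolding slope_def Q_def by (auto intro: divide_left_mono)
  have P1: "?P x \<le> 1" if "x \<le> 0" for x using prof_neg_le_1[OF a that] \<rho> pos[OF that] by simp
  have P0: "?P 0 = 1" by (simp add: prof_def)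
  define C where "C = 1 * ((1 + \<bar>\<rho>\<bar>) * (1 + Q))\<^sup>2 + 1"
  have C1: "1 \<le> C" by (simp add: C_def)
  note Pb = prof_bounds[OF q P1]
  let ?f = "\<lambda>x. \<mu> * ((?q x)\<^sup>2 * indicator {..<0} x)"
  have "(\<integral>\<omega>. exp_neg (\<integral>\<^sup>+s\<in>{0..}. ennreal (?f (X s \<omega>)) \<partial>lborel) \<partial>M) = glue 0 ?u ?v 0"
  proof (rule laplace_additive_functional[where g = "glue 0 ?u ?v"])
    show "piecewise_C2 {0} (glue 0 ?u ?v) (glue 0 ?u1 ?v1) (glue 0 ?u2 ?v2) C"
    proof (rule piecewise_C2_glue)
      fix x :: real
      show "?u 0 = ?v 0" by (simp add: P0)
      show "?u1 0 = ?v1 0" 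
      proof -
        have nz: "1 + a \<noteq> 0" "1 + a + \<rho> \<noteq> 0" using a \<rho> by linarith+
        then have "K * (\<rho> * (1 / (1 + a))) = \<rho> / (1 + a + \<rho>)" by (simp add: K_def)
        moreover have "1 - K = \<rho> / (1 + a + \<rho>)" using nz(2) by (simp add: K_def field_simps)
        ultimately show ?thesis by (simp add: P0 slope_def)
      qed
      show "(?v has_real_derivative ?v1 x) (at x)" "(?v1 has_real_derivative ?v2 x) (at x)" "isCont ?v2 x"
        by (auto intro!: derivative_eq_intros continuous_intros simp: algebra_simps)
      show "\<bar>?v x\<bar> \<le> C \<and> \<bar>?v1 x\<bar> \<le> C \<and> \<bar>?v2 x\<bar> \<le> C" if "0 \<le> x"
      proof -
        have "0 \<le> (1 - K) * exp (- x)" "(1 - K) * exp (- x) \<le> 1 * 1"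
          using K that by (simp_all add: mult_le_one)
        moreover have "?v x = 1 - (1 - K) * exp (- x)" "?v1 x = (1 - K) * exp (- x)" "?v2 x = - ((1 - K) * exp (- x))"
          by (algebra, algebra, algebra)
        ultimately show ?thesis using C1 by linarith
      qed
      assume x: "x \<le> 0"
      show "(?u has_real_derivative ?u1 x) (at x)" by (intro DERIV_cmult DERIV_prof pos x)
      show "(?u1 has_real_derivative ?u2 x) (at x)" by (intro DERIV_cmult DERIV_prof1 pos x)
      show "isCont ?u2 x" by (intro continuous_mult_left isCont_prof2 pos x)
      have KC: "\<bar>K * y\<bar> \<le> C" if "\<bar>y\<bar> \<le> 1 * ((1 + \<bar>\<rho>\<bar>) * (1 + Q))\<^sup>2" for y
      proof -
        have "\<bar>K * y\<bar> \<le> 1 * \<bar>y\<bar>" unfolding abs_mult using K by (intro mult_right_mono) auto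
        then show ?thesis using that by (simp add: C_def)
      qed
      show "\<bar>?u x\<bar> \<le> C \<and> \<bar>?u1 x\<bar> \<le> C \<and> \<bar>?u2 x\<bar> \<le> C"
        by (intro conjI KC Pb x)
    qed
    show "isCont ?f x" if "x \<noteq> 0" for x
    proof (cases "x < 0")
      case True
      have "\<forall>\<^sub>F y in nhds x. ?f y = \<mu> * (?q y)\<^sup>2"
        by (rule eventually_mono[OF order_tendstoD(2)[OF filterlim_ident True]]) simp
      from isCont_cong[OF this] show ?thesis
        by (simp only:) (intro continuous_intros DERIV_isCont[OF DERIV_slope[OF pos]], use True in simp)
    next
      case False
      then have "0 < x" using that by simp
      have "\<forall>\<^sub>F y in nhds x. ?f y = 0"
        by (rule eventually_mono[OF order_tendstoD(1)[OF filterlim_ident \<open>0 < x\<close>]]) simp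
      from isCont_cong[OF this] show ?thesis by simp
    qed
    have \<mu>0: "0 \<le> \<mu>" using \<rho> by (simp add: \<mu>)
    show "0 \<le> ?f x" for x using \<mu>0 by simp
    show "?f x \<le> \<mu> * Q\<^sup>2" for x
      using \<mu>0 q[of x] by (auto simp: indicator_def intro!: mult_left_mono power_mono)
    show "glue 0 ?u2 ?v2 x / 2 + glue 0 ?u1 ?v1 x / 2 = ?f x * glue 0 ?u ?v x" if "x \<noteq> 0" for x
    proof (cases "x < 0")
      case True
      have "?u2 x / 2 + ?u1 x / 2 = \<mu> * (?q x)\<^sup>2 * ?u x"
        by (simp add: \<mu> algebra_simps power2_eq_square add_divide_distrib diff_divide_distrib)
      then show ?thesis using True by (simp add: glue_def)
    qed (use that in \<open>simp add: glue_def left_diff_distrib diff_divide_distrib\<close>)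
    have "(?v \<longlongrightarrow> 1) at_top" by real_asymp
    moreover have "\<forall>\<^sub>F x in at_top. ?v x = glue 0 ?u ?v x"
      using eventually_gt_at_top[of 0] by eventually_elim (simp add: glue_def)
    ultimately show "(glue 0 ?u ?v \<longlongrightarrow> 1) at_top" by (rule Lim_transform_eventually)
  qed measurable
  then show ?thesis by (simp add: glue_def P0 K_def)
qed

end

text \<open>\<open>\<phi>\<close> gives the explicit transform at a test level and \<open>E\<close>
  is the unknown transform at \<open>r\<close>. Since the test level moves and \<open>r\<close> does
  not, only the explicit function has to be continuous.\<close>

lemma eq_if_between:
  fixes \<phi> :: "real \<Rightarrow> real"
  assumes "isCont \<phi> r" "0 < r" "\<And>r'. r < r' \<Longrightarrow> \<phi> r' \<le> E" "\<And>r'. 0 < r' \<Longrightarrow> r' < r \<Longrightarrow> E \<le> \<phi> r'"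
  shows "E = \<phi> r"
proof (rule antisym)
  have "(\<phi> \<longlongrightarrow> \<phi> r) (at_left r)" "(\<phi> \<longlongrightarrow> \<phi> r) (at_right r)"
    using assms(1) unfolding isCont_def by (blast dest: filterlim_at_split[THEN iffD1])+
  then show "E \<le> \<phi> r" "\<phi> r \<le> E"
    using assms by (auto intro!: tendsto_lowerbound[of \<phi> "\<phi> r" "at_left r"] tendsto_upperbound[of \<phi> "\<phi> r" "at_right r"]
      eventually_mono[OF eventually_at_left_real[OF \<open>0 < r\<close>]] eventually_mono[OF eventually_at_right_less])
qed

section \<open>Explicit transforms of hitting times of constant levels\<close>

context half_drift_bm
begin

text \<open>\<open>exp (\<rho> * (x - s))\<close> lies between 0 and 1 below the level
  \<open>s\<close> and is 1 on it; the other exponential solution is unbounded at minus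
  infinity.\<close>

lemma laplace_hitting_time:
  assumes r: "0 < r" and \<rho>: "0 < \<rho>" and \<mu>: "\<mu> = \<rho> * (1 + \<rho>) / 2"
  shows "laplace_hit \<mu> X r = exp (- \<rho> * r)"
proof -
  have \<mu>0: "0 < \<mu>" using \<rho> by (simp add: \<mu>)
  have bounds: "0 \<le> r1 \<Longrightarrow> r1 < s \<Longrightarrow> exp (- \<rho> * s) \<le> laplace_hit \<mu> X r1"
    "s < r2 \<Longrightarrow> laplace_hit \<mu> X r2 \<le> exp (- \<rho> * s)"
    if s: "0 < s" for s r1 r2
  proof -
    let ?u = "\<lambda>x. exp (\<rho> * (x - s))" and ?u1 = "\<lambda>x. \<rho> * exp (\<rho> * (x - s))" and ?u2 = "\<lambda>x. \<rho>\<^sup>2 * exp (\<rho> * (x - s))"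
    \<comment> \<open>The seam must lie strictly above \<open>s\<close>, because the equation is
      needed at \<open>s\<close> too; the distance 1 produces the bound \<open>exp \<rho>\<close> on
      the exponential.\<close>
    let ?p = "s + 1"
    define C where "C = (1 + \<rho> + \<rho>\<^sup>2) * exp \<rho>"
    have u: "(?u has_real_derivative ?u1 x) (at x)" "(?u1 has_real_derivative ?u2 x) (at x)" "isCont ?u2 x" for x
      by (auto intro!: derivative_eq_intros continuous_intros simp: power2_eq_square)
    have C: "\<bar>?u x\<bar> \<le> C \<and> \<bar>?u1 x\<bar> \<le> C \<and> \<bar>?u2 x\<bar> \<le> C" if "x \<le> ?p" for x
    proof -
      have e: "exp (\<rho> * (x - s)) \<le> exp \<rho>" using that \<rho> mult_left_mono[of "x - s" 1 \<rho>] by simp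
      have "c * exp (\<rho> * (x - s)) \<le> C" if "0 \<le> c" "c \<le> 1 + \<rho> + \<rho>\<^sup>2" for c
        unfolding C_def using that e \<rho> by (intro mult_mono) auto
      from this[of 1] this[of \<rho>] this[of "\<rho>\<^sup>2"] show ?thesis using \<rho> by simp
    qed
    let ?g = "ext ?u ?u1 ?p" and ?g1 = "ext1 ?u1 ?p" and ?g2 = "ext2 ?u1 ?u2 ?p"
    have C2: "piecewise_C2 {?p} ?g ?g1 ?g2 (2 * C)" by (rule piecewise_C2_ext[OF u C])
    note left = ext_left[OF u]
    have g0: "?g 0 = exp (- \<rho> * s)" using left(1)[of 0 ?p] s by simp
    have gen: "y \<notin> {?p} \<and> ?g2 y / 2 + ?g1 y / 2 = \<mu> * ?g y" if "y \<le> s" for y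
      using that left[of y ?p] by (simp add: \<mu> algebra_simps power2_eq_square add_divide_distrib)
    have g01: "0 \<le> ?g y \<and> ?g y \<le> 1" if "y < s" for y
      using that left(1)[of y ?p] \<rho> by (simp add: mult_nonneg_nonpos)
    have gs: "?g s = 1" using left(1)[of s ?p] by simp
    have ap: "\<forall>\<^sub>F n in sequentially. \<forall>k\<le>Suc n. \<bar>walk (\<lambda>x. x) T n \<omega> k - X (real k * (T / Suc n)) \<omega>\<bar> < \<epsilon>"
      if "\<omega> \<in> space M" "0 < \<epsilon>" for T \<omega> \<epsilon>
      using that by (simp add: walk_id)
    show "exp (- \<rho> * s) \<le> laplace_hit \<mu> X r1" if "0 \<le> r1" "r1 < s"
      unfolding g0[symmetric]
      by (rule laplace_hitting_bounds(1)[where A = UNIV and \<pi> = "\<lambda>x. x", OF C2])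
        (use gen g01 gs s \<mu>0 that in \<open>auto intro: measurable_X continuous_X X_zero simp: walk_id\<close>)
    show "laplace_hit \<mu> X r2 \<le> exp (- \<rho> * s)" if "s < r2"
      unfolding g0[symmetric]
      by (rule laplace_hitting_bounds(2)[where A = UNIV and \<pi> = "\<lambda>x. x", OF C2])
        (use gen g01 gs s \<mu>0 that in \<open>auto intro: measurable_X continuous_X X_zero simp: walk_id\<close>)
  qed
  show ?thesis
    by (rule eq_if_between[where \<phi> = "\<lambda>s. exp (- \<rho> * s)"]) (use r bounds in \<open>auto intro!: continuous_intros\<close>)
qed

text \<open>Rounding a small random level down produces the level 0, which
  \<open>laplace_hitting_time\<close> does not cover.\<close>

lemma laplace_hitting_time_0:
  "\<omega> \<in> space M \<Longrightarrow> exp_neg (ennreal \<mu> * hitting_time X (\<lambda>_. 0) \<omega>) = 1"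
proof -
  assume \<omega>: "\<omega> \<in> space M"
  have "hitting_time X (\<lambda>_. 0) \<omega> \<le> ennreal 0"
    by (rule hitting_time_le) (use continuous_X[OF \<omega>] X_zero[OF \<omega>] in auto)
  then show ?thesis by (simp add: exp_neg_def)
qed

text \<open>The test function is \<open>refl_sol \<rho> x / refl_sol \<rho> s\<close>, extended
  evenly: its slope 0 at the origin expresses reflection, and evenness makes it blind to the
  absolute values in the walk.\<close>

lemma laplace_hitting_time_reflected:
  assumes r: "0 < r" and \<rho>: "0 < \<rho>" and \<mu>: "\<mu> = \<rho> * (1 + \<rho>) / 2"
  shows "laplace_hit \<mu> reflected r = 1 / refl_sol \<rho> r"
proof -
  have \<mu>0: "0 < \<mu>" using \<rho> by (simp add: \<mu>)
  have bounds: "0 \<le> r1 \<Longrightarrow> r1 < s \<Longrightarrow> 1 / refl_sol \<rho> s \<le> laplace_hit \<mu> reflected r1"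
    "s < r2 \<Longrightarrow> laplace_hit \<mu> reflected r2 \<le> 1 / refl_sol \<rho> s"
    if s: "0 < s" for s r1 r2
  proof -
    have c: "0 < refl_sol \<rho> s" using \<rho> by (rule refl_sol_pos)
    define K where "K = (1 + 2 * \<rho>) * refl_sol \<rho> s"
    have K: "0 < K" using \<rho> c by (simp add: K_def)
    let ?e = "\<lambda>x. exp (- (1 + \<rho>) * x)" and ?f = "\<lambda>x. exp (\<rho> * x)"
    let ?u = "\<lambda>x. (\<rho> * ?e x + (1 + \<rho>) * ?f x) / K"
    let ?u1 = "\<lambda>x. (\<rho> * (- (1 + \<rho>) * ?e x) + (1 + \<rho>) * (\<rho> * ?f x)) / K"
    let ?u2 = "\<lambda>x. (\<rho> * ((1 + \<rho>)\<^sup>2 * ?e x) + (1 + \<rho>) * (\<rho>\<^sup>2 * ?f x)) / K"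
    let ?p = "s + 1"
    define CE where "CE = (1 + \<rho>)\<^sup>2 * exp (\<rho> * ?p)"
    define C where "C = (\<rho> * CE + (1 + \<rho>) * CE) / K"
    have u_eq: "?u x = refl_sol \<rho> x / refl_sol \<rho> s" for x
      using c \<rho> by (simp add: refl_sol_def K_def)
    have u: "(?u has_real_derivative ?u1 x) (at x)" "(?u1 has_real_derivative ?u2 x) (at x)" "isCont ?u2 x" for x
    proof -
      have e: "(?e has_real_derivative - (1 + \<rho>) * ?e x) (at x)" "(?f has_real_derivative \<rho> * ?f x) (at x)" for x
        by (auto intro!: derivative_eq_intros simp: algebra_simps)
      show "(?u has_real_derivative ?u1 x) (at x)"
        by (intro DERIV_cdivide DERIV_add DERIV_cmult e)
      show "(?u1 has_real_derivative ?u2 x) (at x)"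
        by (rule DERIV_cong[OF DERIV_cdivide[OF DERIV_add[OF DERIV_cmult[OF DERIV_cmult[OF e(1)]] DERIV_cmult[OF DERIV_cmult[OF e(2)]]]]])
          (simp add: power2_eq_square algebra_simps)
      show "isCont ?u2 x" by (intro continuous_intros) (use K in auto)
    qed
    have C: "\<bar>?u x\<bar> \<le> C \<and> \<bar>?u1 x\<bar> \<le> C \<and> \<bar>?u2 x\<bar> \<le> C" if x: "0 \<le> x" "x \<le> ?p" for x
    proof -
      have f: "?f x \<le> exp (\<rho> * ?p)" using x \<rho> by simp
      have "?e x \<le> 1" using x \<rho> by (simp add: mult_nonpos_nonneg)
      moreover have "1 \<le> exp (\<rho> * ?p)" using \<rho> s by simp
      ultimately have e: "?e x \<le> exp (\<rho> * ?p)" by linarith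
      have q: "1 \<le> (1 + \<rho>)\<^sup>2" "1 + \<rho> \<le> (1 + \<rho>)\<^sup>2" "\<rho> \<le> (1 + \<rho>)\<^sup>2" "\<rho>\<^sup>2 \<le> (1 + \<rho>)\<^sup>2"
        using \<rho> by (auto simp: power2_eq_square algebra_simps)
      have m: "\<bar>b * y\<bar> \<le> CE" if "\<bar>b\<bar> \<le> (1 + \<rho>)\<^sup>2" "0 \<le> y" "y \<le> exp (\<rho> * ?p)" for b y :: real
        unfolding CE_def abs_mult using that by (intro mult_mono) auto
      have "\<bar>?u x\<bar> \<le> C" unfolding C_def
        by (rule lincomb_bound) (use m[of 1 "?e x"] m[of 1 "?f x"] q e f \<rho> K in auto)
      moreover have "\<bar>?u1 x\<bar> \<le> C" unfolding C_def
        by (rule lincomb_bound[OF m m]) (use q e f \<rho> K in auto)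
      moreover have "\<bar>?u2 x\<bar> \<le> C" unfolding C_def
        by (rule lincomb_bound[OF m m]) (use q e f \<rho> K in auto)
      ultimately show ?thesis by blast
    qed
    have u10: "?u1 0 = 0" by (simp add: algebra_simps)
    let ?E = "ext ?u ?u1 ?p" and ?E1 = "ext1 ?u1 ?p" and ?E2 = "ext2 ?u1 ?u2 ?p"
    let ?g = "glue 0 (\<lambda>x. ?E (- x)) ?E" and ?g1 = "glue 0 (\<lambda>x. - ?E1 (- x)) ?E1" and ?g2 = "glue 0 (\<lambda>x. ?E2 (- x)) ?E2"
    have p: "0 < ?p" using s by simp
    have C2: "piecewise_C2 {?p, - ?p} ?g ?g1 ?g2 (2 * C)" by (rule piecewise_C2_even_ext[OF u p C u10])
    note left = ext_left[OF u]
    have gy: "?g y = ?u y \<and> ?g1 y = ?u1 y \<and> ?g2 y = ?u2 y" if "y \<in> {0..}" "y \<le> s" for y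
    proof (cases "y = 0")
      case True
      then show ?thesis using left[of 0 ?p] p u10 by (simp add: glue_def)
    next
      case False
      then show ?thesis using that left[of y ?p] by (simp add: glue_def)
    qed
    have g0: "?g 0 = 1 / refl_sol \<rho> s" using gy[of 0] s u_eq[of 0] \<rho> by (simp add: refl_sol_0)
    have gen: "y \<notin> {?p, - ?p} \<and> ?g2 y / 2 + ?g1 y / 2 = \<mu> * ?g y" if "y \<in> {0..}" "y \<le> s" for y
    proof -
      have "?u2 y / 2 + ?u1 y / 2 = \<mu> * ?u y"
        using K by (simp add: \<mu> field_simps power2_eq_square)
      then show ?thesis using gy[OF that] that s by simp
    qed
    \<comment> \<open>The derivative is a positive multiple of
      \<open>exp (\<rho> * x) - exp (- (1 + \<rho>) * x)\<close>, which is nonnegative for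
      \<open>x \<ge> 0\<close>; this keeps the test function at most 1 below the level.\<close>
    have mono: "refl_sol \<rho> y \<le> refl_sol \<rho> s" if "0 \<le> y" "y < s" for y
    proof -
      have "?u y \<le> ?u s"
      proof (rule DERIV_nonneg_imp_nondecreasing[where f = ?u])
        show "y \<le> s" using that by simp
        fix x assume "y \<le> x" "x \<le> s"
        then have "0 \<le> x" using that by simp
        then have "- (1 + \<rho>) * x \<le> \<rho> * x" using \<rho> by (intro mult_right_mono) auto
        then have "?e x \<le> ?f x" by simp
        then have "0 \<le> \<rho> * (1 + \<rho>) * (?f x - ?e x) / K" using \<rho> K by simp
        also have "\<dots> = ?u1 x" by (simp add: algebra_simps)
        finally show "\<exists>y. (?u has_real_derivative y) (at x) \<and> 0 \<le> y" using u(1) by blast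
      qed
      then show ?thesis using c unfolding u_eq by (simp add: divide_le_cancel)
    qed
    have g01: "0 \<le> ?g y \<and> ?g y \<le> 1" if "y \<in> {0..}" "y < s" for y
    proof -
      have "?g y = refl_sol \<rho> y / refl_sol \<rho> s" using gy[of y] that u_eq by simp
      then show ?thesis using mono[of y] that c refl_sol_pos[OF \<rho>, of y] by simp
    qed
    have gs: "?g s = 1" using gy[of s] s u_eq[of s] c by simp
    have g_abs: "?g \<bar>x\<bar> = ?g x" for x by (auto simp: glue_def abs_if)
    show "1 / refl_sol \<rho> s \<le> laplace_hit \<mu> reflected r1" if "0 \<le> r1" "r1 < s"
      unfolding g0[symmetric]
      by (rule laplace_hitting_bounds(1)[where A = "{0..}" and \<pi> = abs, OF C2 _ g_abs measurable_reflected
            continuous_reflected reflected_zero walk_abs_approx _ _ gen g01 gs s \<mu>0 that])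
        (auto simp: walk_abs_nonneg reflected_nonneg)
    show "laplace_hit \<mu> reflected r2 \<le> 1 / refl_sol \<rho> s" if "s < r2"
      unfolding g0[symmetric]
      by (rule laplace_hitting_bounds(2)[where A = "{0..}" and \<pi> = abs, OF C2 _ g_abs measurable_reflected
            continuous_reflected reflected_zero walk_abs_approx _ _ gen g01 gs s \<mu>0 that])
        (auto simp: walk_abs_nonneg reflected_nonneg)
  qed
  have cont: "isCont (\<lambda>s. 1 / refl_sol \<rho> s) r"
    using refl_sol_pos[OF \<rho>, of r] unfolding refl_sol_def using \<rho>
    by (intro continuous_intros) auto
  show ?thesis
    by (rule eq_if_between[where \<phi> = "\<lambda>s. 1 / refl_sol \<rho> s", OF cont r]) (use r bounds in auto)
qed

end

section \<open>The identities in law\<close>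

lemma (in prob_space) indep_set_mono:
  assumes "indep_set A B" "A' \<subseteq> A" "B' \<subseteq> B"
  shows "indep_set A' B'"
  using assms(1) unfolding indep_set_def
  by (rule indep_sets_mono_sets) (use assms in \<open>auto split: bool.split\<close>)

text \<open>Multiplying the density by \<open>exp (- \<rho> * x)\<close> gives
  \<open>l / (l + \<rho>)\<close> times the exponential density with parameter
  \<open>l + \<rho>\<close>, whose total mass is 1.\<close>

lemma nn_integral_exp_exponential:
  assumes "prob_space M" and D: "distributed M lborel L (exponential_density l)" and l: "0 < l" and \<rho>: "0 < \<rho>"
  shows "(\<integral>\<^sup>+\<omega>. ennreal (exp (- \<rho> * L \<omega>)) \<partial>M) = ennreal (l / (l + \<rho>))"
proof -
  interpret E: prob_space "density lborel (exponential_density (l + \<rho>))"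
    using l \<rho> by (intro prob_space_exponential_density) simp
  have "(\<integral>\<^sup>+\<omega>. ennreal (exp (- \<rho> * L \<omega>)) \<partial>M)
      = (\<integral>\<^sup>+x. ennreal (exponential_density l x) * ennreal (exp (- \<rho> * x)) \<partial>lborel)"
    by (rule distributed_nn_integral[OF D, symmetric]) measurable
  also have "\<dots> = (\<integral>\<^sup>+x. ennreal (l / (l + \<rho>)) * ennreal (exponential_density (l + \<rho>) x) \<partial>lborel)"
  proof (rule nn_integral_cong)
    fix x :: real
    have "exponential_density l x * exp (- \<rho> * x) = l / (l + \<rho>) * exponential_density (l + \<rho>) x"
    proof (cases "x < 0")
      case False
      have e: "exp (- x * (l + \<rho>)) = exp (- x * l) * exp (- \<rho> * x)"
        unfolding exp_add[symmetric] by (simp add: algebra_simps)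
      have "l / (l + \<rho>) * ((l + \<rho>) * E) = l * E" for E
        using l \<rho> by simp
      from this[of "exp (- x * l) * exp (- \<rho> * x)"] show ?thesis
        unfolding exponential_density_def using False by (simp only: if_False e mult.assoc)
    qed (simp add: exponential_density_def)
    then show "ennreal (exponential_density l x) * ennreal (exp (- \<rho> * x))
        = ennreal (l / (l + \<rho>)) * ennreal (exponential_density (l + \<rho>) x)"
      using l \<rho> by (simp add: exponential_density_def flip: ennreal_mult)
  qed
  also have "\<dots> = ennreal (l / (l + \<rho>)) * (\<integral>\<^sup>+x. ennreal (exponential_density (l + \<rho>) x) \<partial>lborel)"
    by (rule nn_integral_cmult) measurable
  also have "(\<integral>\<^sup>+x. ennreal (exponential_density (l + \<rho>) x) \<partial>lborel) = 1"
    using E.emeasure_space_1 by (simp add: emeasure_density)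
  finally show ?thesis by simp
qed

section \<open>The independent exponential level\<close>

context half_drift_bm
begin

abbreviation hit :: "real \<Rightarrow> 'a \<Rightarrow> ennreal" where
  "hit r \<equiv> hitting_time X (\<lambda>_. r)"

text \<open>The hitting time of a constant level is a functional of the path, so it is measurable
  for the sigma-algebra of the process and hence independent of the random level.\<close>

lemma nn_integral_indep_level:
  assumes ind: "process_indep_var M X \<Lambda>" and [measurable]: "\<Lambda> \<in> borel_measurable M"
    and A: "A \<in> sets borel"
    and r: "0 \<le> r" and \<rho>: "0 < \<rho>" and \<mu>: "\<mu> = \<rho> * (1 + \<rho>) / 2"
  shows "(\<integral>\<^sup>+\<omega>. indicator A (\<Lambda> \<omega>) * ennreal (exp_neg (ennreal \<mu> * hit r \<omega>)) \<partial>M)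
    = (\<integral>\<^sup>+\<omega>. indicator A (\<Lambda> \<omega>) * ennreal (exp (- \<rho> * r)) \<partial>M)"
proof -
  note A[measurable]
  let ?F = "vimage_algebra (space M) (\<lambda>\<omega>. \<lambda>t\<in>{0..}. X t \<omega>) (PiM {0..} (\<lambda>_. borel))"
  let ?G = "vimage_algebra (space M) \<Lambda> borel"
  let ?Y = "\<lambda>\<omega>. exp_neg (ennreal \<mu> * hit r \<omega>)" and ?I = "\<lambda>\<omega>. indicator A (\<Lambda> \<omega>) :: real"
  have XF: "X t \<in> borel_measurable ?F" if "0 \<le> t" for t
  proof -
    have "(\<lambda>\<omega>. \<lambda>t\<in>{0..}. X t \<omega>) \<in> ?F \<rightarrow>\<^sub>M PiM {0..} (\<lambda>_. borel)"
      by (rule measurable_vimage_algebra1) (auto simp: space_PiM)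
    from measurable_compose[OF this measurable_component_singleton[of t]] that show ?thesis by simp
  qed
  \<comment> \<open>\<open>measurable_hitting_time\<close> is applied to the sigma-algebra generated
    by the path instead of \<open>M\<close>.\<close>
  have [measurable]: "hit r \<in> borel_measurable ?F"
    by (rule measurable_hitting_time) (use XF continuous_X in auto)
  have YF: "?Y \<in> borel_measurable ?F" by measurable
  have "\<Lambda> \<in> borel_measurable ?G" by (rule measurable_vimage_algebra1) auto
  then have IG: "?I \<in> borel_measurable ?G" by measurable
  have [measurable]: "hit r \<in> borel_measurable M"
    by (rule measurable_hitting_time) (use measurable_X continuous_X in auto)
  have YM[measurable]: "?Y \<in> borel_measurable M" by measurable
  have "indep_var borel ?Y borel ?I"
    unfolding indep_var_eq
  proof (intro conjI)
    show "indep_set (sigma_sets (space M) {?Y -` B \<inter> space M |B. B \<in> sets borel})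
      (sigma_sets (space M) {?I -` B \<inter> space M |B. B \<in> sets borel})"
    proof (rule indep_set_mono)
      show "indep_set (sets ?F) (sets ?G)" using ind by (simp add: process_indep_var_def)
      show "sigma_sets (space M) {?Y -` B \<inter> space M |B. B \<in> sets borel} \<subseteq> sets ?F"
        using sets.sigma_sets_subset[of "{?Y -` B \<inter> space M |B. B \<in> sets borel}" ?F] measurable_sets[OF YF] by auto
      show "sigma_sets (space M) {?I -` B \<inter> space M |B. B \<in> sets borel} \<subseteq> sets ?G"
        using sets.sigma_sets_subset[of "{?I -` B \<inter> space M |B. B \<in> sets borel}" ?G] measurable_sets[OF IG] by auto
    qed
  qed measurable
  have iY: "integrable M ?Y"
    by (rule integrable_const_bound[of _ 1]) (use exp_neg_nonneg exp_neg_le_1 in auto)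
  have iI: "integrable M ?I" by (rule integrable_const_bound[of _ 1]) auto
  have EY: "(\<integral>\<omega>. ?Y \<omega> \<partial>M) = exp (- \<rho> * r)"
  proof (cases "r = 0")
    case True
    have "(\<integral>\<omega>. ?Y \<omega> \<partial>M) = (\<integral>\<omega>. 1 \<partial>M)"
      unfolding True by (rule Bochner_Integration.integral_cong[OF refl laplace_hitting_time_0])
    then show ?thesis using True by (simp add: prob_space)
  next
    case False
    then show ?thesis using r \<rho> \<mu> by (intro laplace_hitting_time) auto
  qed
  have "(\<integral>\<^sup>+\<omega>. indicator A (\<Lambda> \<omega>) * ennreal (?Y \<omega>) \<partial>M) = (\<integral>\<^sup>+\<omega>. ennreal (?Y \<omega> * ?I \<omega>) \<partial>M)"
    by (rule nn_integral_cong) (auto simp: indicator_def)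
  also have "\<dots> = ennreal (\<integral>\<omega>. ?Y \<omega> * ?I \<omega> \<partial>M)"
    by (rule nn_integral_eq_integral[OF indep_var_integrable[OF \<open>indep_var borel ?Y borel ?I\<close> iY iI]])
      (auto simp: exp_neg_nonneg)
  also have "(\<integral>\<omega>. ?Y \<omega> * ?I \<omega> \<partial>M) = (\<integral>\<omega>. ?Y \<omega> \<partial>M) * (\<integral>\<omega>. ?I \<omega> \<partial>M)"
    by (rule indep_var_lebesgue_integral[OF \<open>indep_var borel ?Y borel ?I\<close> iY iI])
  also have "\<dots> = (\<integral>\<omega>. ?I \<omega> * exp (- \<rho> * r) \<partial>M)" by (simp add: EY)
  also have "ennreal \<dots> = (\<integral>\<^sup>+\<omega>. ennreal (?I \<omega> * exp (- \<rho> * r)) \<partial>M)"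
    by (rule nn_integral_eq_integral[symmetric]) (use iI in auto)
  also have "\<dots> = (\<integral>\<^sup>+\<omega>. indicator A (\<Lambda> \<omega>) * ennreal (exp (- \<rho> * r)) \<partial>M)"
    by (rule nn_integral_cong) (auto simp: indicator_def)
  finally show ?thesis .
qed

text \<open>The level is rounded up or down to multiples of \<open>1/m\<close>, so that independence is only needed
  for hitting times of constant levels.\<close>

lemma laplace_hitting_time_random_level:
  assumes ind: "process_indep_var M X \<Lambda>" and D: "distributed M lborel \<Lambda> (exponential_density l)"
    and l: "0 < l" and \<rho>: "0 < \<rho>" and \<mu>: "\<mu> = \<rho> * (1 + \<rho>) / 2"
  shows "(\<integral>\<omega>. exp_neg (ennreal \<mu> * hitting_time X \<Lambda> \<omega>) \<partial>M) = l / (l + \<rho>)"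
proof -
  have \<Lambda>[measurable]: "\<Lambda> \<in> borel_measurable M" using distributed_measurable[OF D] by simp
  \<comment> \<open>The cells used below cover only nonnegative levels, and these are the levels for
    which hitting times increase with the level.\<close>
  have pos: "AE \<omega> in M. 0 \<le> \<Lambda> \<omega>"
  proof (rule AE_distrD[where f = \<Lambda> and P = "\<lambda>x. 0 \<le> x"])
    show "\<Lambda> \<in> M \<rightarrow>\<^sub>M lborel" by simp
    show "AE x in distr M lborel \<Lambda>. 0 \<le> x"
      unfolding distributed_distr_eq_density[OF D]
      by (subst AE_density) (auto simp: exponential_density_def)
  qed
  have hitm[measurable]: "hitting_time X y \<in> borel_measurable M" if "y \<in> borel_measurable M" for y
    using that by (intro measurable_hitting_time) (use measurable_X continuous_X in auto)
  let ?J = "\<lambda>m j. {real j / real (Suc m)..<real (Suc j) / real (Suc m)}"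
  let ?E = "\<lambda>y \<omega>. ennreal (exp_neg (ennreal \<mu> * hitting_time X y \<omega>))"
  let ?V = "\<integral>\<^sup>+\<omega>. ?E \<Lambda> \<omega> \<partial>M" and ?K = "\<integral>\<^sup>+\<omega>. ennreal (exp (- \<rho> * \<Lambda> \<omega>)) \<partial>M"
  have split: "(\<integral>\<^sup>+\<omega>. \<phi> \<omega> \<partial>M) = (\<Sum>j. \<integral>\<^sup>+\<omega>. indicator (?J m j) (\<Lambda> \<omega>) * \<phi> \<omega> \<partial>M)"
    if [measurable]: "\<phi> \<in> borel_measurable M" for \<phi> :: "'a \<Rightarrow> ennreal" and m
  proof -
    have "(\<integral>\<^sup>+\<omega>. \<phi> \<omega> \<partial>M) = (\<integral>\<^sup>+\<omega>. (\<Sum>j. indicator (?J m j) (\<Lambda> \<omega>) * \<phi> \<omega>) \<partial>M)"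
    proof (rule nn_integral_cong_AE, use pos in eventually_elim)
      case (elim \<omega>)
      define k where "k = nat \<lfloor>\<Lambda> \<omega> * real (Suc m)\<rfloor>"
      have u: "0 \<le> \<Lambda> \<omega> * real (Suc m)" using elim by simp
      have J: "\<Lambda> \<omega> \<in> ?J m j \<longleftrightarrow> j = k" for j
      proof -
        have "\<Lambda> \<omega> \<in> ?J m j \<longleftrightarrow> real j \<le> \<Lambda> \<omega> * real (Suc m) \<and> \<Lambda> \<omega> * real (Suc m) < real (Suc j)"
          by (simp add: pos_divide_le_eq pos_less_divide_eq del: of_nat_Suc)
        also have "\<dots> \<longleftrightarrow> j = k" unfolding k_def using u by (auto; linarith)
        finally show ?thesis .
      qed
      have "(\<Sum>j. indicator (?J m j) (\<Lambda> \<omega>) * \<phi> \<omega>) = (\<Sum>j. if j = k then \<phi> \<omega> else 0)"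
        by (intro suminf_cong) (simp only: indicator_def J, simp)
      also have "\<dots> = \<phi> \<omega>" by (subst suminf_finite[of "{k}"]) auto
      finally show ?case by (rule sym)
    qed
    also have "\<dots> = (\<Sum>j. \<integral>\<^sup>+\<omega>. indicator (?J m j) (\<Lambda> \<omega>) * \<phi> \<omega> \<partial>M)"
      by (rule nn_integral_suminf) measurable
    finally show ?thesis .
  qed
  have E_mono: "?E y' \<omega> \<le> ?E y \<omega>" if "\<omega> \<in> space M" "0 \<le> y \<omega>" "y \<omega> \<le> y' \<omega>" for y y' \<omega>
    using hitting_time_mono[of X \<omega> y y'] that continuous_X[OF that(1)] X_zero[OF that(1)]
    by (intro ennreal_leI exp_neg_antimono mult_left_mono) auto
  have meas: "(\<lambda>\<omega>. ?E y \<omega>) \<in> borel_measurable M" if "y \<in> borel_measurable M" for y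
    using hitm[OF that] by measurable
  \<comment> \<open>Rounding the level down makes the hit earlier and the transform larger. The
    hitting time of the rounded, constant level is independent of the cell, and returning to
    \<open>\<Lambda>\<close> costs at most one mesh, hence the factor
    \<open>exp (\<rho> / Suc m)\<close>.\<close>
  have upper: "?V \<le> ennreal (exp (\<rho> / Suc m)) * ?K" for m
  proof -
    have "?V = (\<Sum>j. \<integral>\<^sup>+\<omega>. indicator (?J m j) (\<Lambda> \<omega>) * ?E \<Lambda> \<omega> \<partial>M)" by (rule split[OF meas[OF \<Lambda>]])
    also have "\<dots> \<le> (\<Sum>j. \<integral>\<^sup>+\<omega>. indicator (?J m j) (\<Lambda> \<omega>) * ?E (\<lambda>_. real j / Suc m) \<omega> \<partial>M)"
    proof (intro suminf_le nn_integral_mono)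
      fix j \<omega> assume \<omega>: "\<omega> \<in> space M"
      show "indicator (?J m j) (\<Lambda> \<omega>) * ?E \<Lambda> \<omega> \<le> indicator (?J m j) (\<Lambda> \<omega>) * ?E (\<lambda>_. real j / Suc m) \<omega>"
        using E_mono[OF \<omega>, of "\<lambda>_. real j / Suc m" \<Lambda>] by (auto simp: indicator_def)
    qed auto
    also have "\<dots> = (\<Sum>j. \<integral>\<^sup>+\<omega>. indicator (?J m j) (\<Lambda> \<omega>) * ennreal (exp (- \<rho> * (real j / Suc m))) \<partial>M)"
      by (intro suminf_cong nn_integral_indep_level[OF ind \<Lambda> _ _ \<rho> \<mu>]) auto
    also have "\<dots> \<le> (\<Sum>j. \<integral>\<^sup>+\<omega>. indicator (?J m j) (\<Lambda> \<omega>) * (ennreal (exp (\<rho> / Suc m)) * ennreal (exp (- \<rho> * \<Lambda> \<omega>))) \<partial>M)"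
    proof (intro suminf_le nn_integral_mono)
      fix j \<omega>
      have "exp (- \<rho> * (real j / Suc m)) \<le> exp (\<rho> / Suc m) * exp (- \<rho> * \<Lambda> \<omega>)" if "\<Lambda> \<omega> \<in> ?J m j"
      proof -
        have "\<Lambda> \<omega> \<le> real j / Suc m + 1 / Suc m" using that by (simp add: add_divide_distrib)
        then have "\<rho> * \<Lambda> \<omega> \<le> \<rho> * (real j / Suc m + 1 / Suc m)" using \<rho> by (intro mult_left_mono) auto
        then show ?thesis unfolding exp_add[symmetric] exp_le_cancel_iff by (simp add: distrib_left)
      qed
      then show "indicator (?J m j) (\<Lambda> \<omega>) * ennreal (exp (- \<rho> * (real j / Suc m)))
          \<le> indicator (?J m j) (\<Lambda> \<omega>) * (ennreal (exp (\<rho> / Suc m)) * ennreal (exp (- \<rho> * \<Lambda> \<omega>)))"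
        by (auto simp: indicator_def ennreal_mult[symmetric] intro!: ennreal_leI)
    qed auto
    also have "\<dots> = (\<integral>\<^sup>+\<omega>. ennreal (exp (\<rho> / Suc m)) * ennreal (exp (- \<rho> * \<Lambda> \<omega>)) \<partial>M)"
      by (rule split[symmetric]) measurable
    also have "\<dots> = ennreal (exp (\<rho> / Suc m)) * ?K" by (rule nn_integral_cmult) measurable
    finally show ?thesis .
  qed
  \<comment> \<open>The same computation read backwards, with levels rounded up to the right end
    \<open>Suc j / Suc m\<close> of the cell.\<close>
  have lower: "ennreal (exp (- \<rho> / Suc m)) * ?K \<le> ?V" for m
  proof -
    have "ennreal (exp (- \<rho> / Suc m)) * ?K = (\<integral>\<^sup>+\<omega>. ennreal (exp (- \<rho> / Suc m)) * ennreal (exp (- \<rho> * \<Lambda> \<omega>)) \<partial>M)"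
      by (rule nn_integral_cmult[symmetric]) measurable
    also have "\<dots> = (\<Sum>j. \<integral>\<^sup>+\<omega>. indicator (?J m j) (\<Lambda> \<omega>) * (ennreal (exp (- \<rho> / Suc m)) * ennreal (exp (- \<rho> * \<Lambda> \<omega>))) \<partial>M)"
      by (rule split) measurable
    also have "\<dots> \<le> (\<Sum>j. \<integral>\<^sup>+\<omega>. indicator (?J m j) (\<Lambda> \<omega>) * ennreal (exp (- \<rho> * (real (Suc j) / Suc m))) \<partial>M)"
    proof (intro suminf_le nn_integral_mono)
      fix j \<omega>
      have "exp (- \<rho> / Suc m) * exp (- \<rho> * \<Lambda> \<omega>) \<le> exp (- \<rho> * (real (Suc j) / Suc m))" if "\<Lambda> \<omega> \<in> ?J m j"
      proof -
        have "real (Suc j) / Suc m \<le> 1 / Suc m + \<Lambda> \<omega>" using that by (simp add: add_divide_distrib)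
        then have le: "\<rho> * (real (Suc j) / Suc m) \<le> \<rho> * (1 / Suc m + \<Lambda> \<omega>)" using \<rho> by (intro mult_left_mono) auto
        have eq: "- \<rho> / Suc m + - (\<rho> * \<Lambda> \<omega>) = - (\<rho> * (1 / Suc m + \<Lambda> \<omega>))" by (simp add: distrib_left)
        show ?thesis unfolding exp_add[symmetric] exp_le_cancel_iff mult_minus_left eq
          using le by (simp only: neg_le_iff_le)
      qed
      then show "indicator (?J m j) (\<Lambda> \<omega>) * (ennreal (exp (- \<rho> / Suc m)) * ennreal (exp (- \<rho> * \<Lambda> \<omega>)))
          \<le> indicator (?J m j) (\<Lambda> \<omega>) * ennreal (exp (- \<rho> * (real (Suc j) / Suc m)))"
        by (auto simp: indicator_def ennreal_mult[symmetric] intro!: ennreal_leI)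
    qed auto
    also have "\<dots> = (\<Sum>j. \<integral>\<^sup>+\<omega>. indicator (?J m j) (\<Lambda> \<omega>) * ?E (\<lambda>_. real (Suc j) / Suc m) \<omega> \<partial>M)"
      by (intro suminf_cong nn_integral_indep_level[OF ind \<Lambda> _ _ \<rho> \<mu>, symmetric]) auto
    also have "\<dots> \<le> (\<Sum>j. \<integral>\<^sup>+\<omega>. indicator (?J m j) (\<Lambda> \<omega>) * ?E \<Lambda> \<omega> \<partial>M)"
    proof (intro suminf_le nn_integral_mono)
      fix j \<omega> assume \<omega>: "\<omega> \<in> space M"
      have "0 \<le> \<Lambda> \<omega>" if "\<Lambda> \<omega> \<in> ?J m j"
        using that order_trans[of 0 "real j / real (Suc m)" "\<Lambda> \<omega>"] by auto
      then show "indicator (?J m j) (\<Lambda> \<omega>) * ?E (\<lambda>_. real (Suc j) / Suc m) \<omega> \<le> indicator (?J m j) (\<Lambda> \<omega>) * ?E \<Lambda> \<omega>"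
        using E_mono[OF \<omega>, of \<Lambda> "\<lambda>_. real (Suc j) / Suc m"] by (auto simp: indicator_def)
    qed auto
    also have "\<dots> = ?V" by (rule split[OF meas[OF \<Lambda>], symmetric])
    finally show ?thesis .
  qed
  have K: "?K = ennreal (l / (l + \<rho>))"
    by (rule nn_integral_exp_exponential[OF prob_space_axioms D l \<rho>])
  define v where "v = (\<integral>\<omega>. exp_neg (ennreal \<mu> * hitting_time X \<Lambda> \<omega>) \<partial>M)"
  have iv: "integrable M (\<lambda>\<omega>. exp_neg (ennreal \<mu> * hitting_time X \<Lambda> \<omega>))"
    by (rule integrable_const_bound[of _ 1]) (use exp_neg_nonneg exp_neg_le_1 hitm[OF \<Lambda>] in \<open>auto intro: AE_I2\<close>)
  have v0: "0 \<le> v" unfolding v_def by (intro Bochner_Integration.integral_nonneg exp_neg_nonneg)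
  have V: "?V = ennreal v"
    unfolding v_def by (rule nn_integral_eq_integral[OF iv]) (simp add: exp_neg_nonneg)
  have lr: "0 \<le> l / (l + \<rho>)" using l \<rho> by simp
  have u: "v \<le> exp (\<rho> / Suc m) * (l / (l + \<rho>))" and lo: "exp (- \<rho> / Suc m) * (l / (l + \<rho>)) \<le> v" for m
  proof -
    have "0 \<le> exp (\<rho> / Suc m) * (l / (l + \<rho>))" using lr by (intro mult_nonneg_nonneg) auto
    then show "v \<le> exp (\<rho> / Suc m) * (l / (l + \<rho>))"
      using upper[of m] lr unfolding V K by (simp only: ennreal_mult[symmetric] exp_ge_zero ennreal_le_iff)
    show "exp (- \<rho> / Suc m) * (l / (l + \<rho>)) \<le> v"
      using lower[of m] lr v0 unfolding V K by (simp only: ennreal_mult[symmetric] exp_ge_zero ennreal_le_iff)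
  qed
  have "v \<le> exp 0 * (l / (l + \<rho>))"
  proof (rule LIMSEQ_le_const)
    show "(\<lambda>m. exp (\<rho> / Suc m) * (l / (l + \<rho>))) \<longlonglongrightarrow> exp 0 * (l / (l + \<rho>))"
      by (intro tendsto_intros LIMSEQ_Suc[OF lim_const_over_n])
  qed (use u in blast)
  moreover have "exp 0 * (l / (l + \<rho>)) \<le> v"
  proof (rule LIMSEQ_le_const2)
    show "(\<lambda>m. exp (- \<rho> / Suc m) * (l / (l + \<rho>))) \<longlonglongrightarrow> exp 0 * (l / (l + \<rho>))"
      by (intro tendsto_intros LIMSEQ_Suc[OF lim_const_over_n])
  qed (use lo in blast)
  ultimately show ?thesis unfolding v_def by simp
qed

lemma additive_functional_cmult:
  assumes \<omega>: "\<omega> \<in> space M" and [measurable]: "\<phi> \<in> borel_measurable borel"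
  shows "of_nat n * (\<integral>\<^sup>+s\<in>{0..}. ennreal (\<phi> (X s \<omega>)) \<partial>lborel) = (\<integral>\<^sup>+s\<in>{0..}. ennreal (real n * \<phi> (X s \<omega>)) \<partial>lborel)"
proof -
  have [measurable]: "(\<lambda>s. X (max 0 s) \<omega>) \<in> borel_measurable borel"
    by (rule borel_measurable_continuous_onI[OF continuous_X_max[OF \<omega>]])
  show ?thesis
    unfolding additive_functional_eq additive_functional_eq[of "\<lambda>x. real n * \<phi> x"]
    by (subst nn_integral_cmult[symmetric])
      (auto intro!: nn_integral_cong simp: indicator_def ennreal_mult' ennreal_of_nat_eq_real_of_nat)
qed

end

lemma quadratic_root:
  fixes n :: nat assumes "0 < n"
  obtains \<rho> where "0 < \<rho>" "real n = \<rho> * (1 + \<rho>) / 2"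
proof
  let ?\<rho> = "(sqrt (1 + 8 * real n) - 1) / 2"
  have "sqrt 1 < sqrt (1 + 8 * real n)" using assms by (intro real_sqrt_less_mono) simp
  then show "0 < ?\<rho>" by simp
  have "?\<rho> * (1 + ?\<rho>) = ((sqrt (1 + 8 * real n))\<^sup>2 - 1) / 4" by (simp add: power2_eq_square field_simps)
  then show "real n = ?\<rho> * (1 + ?\<rho>) / 2" by simp
qed

text \<open>At \<open>n = \<rho> * (1 + \<rho>) / 2\<close> the common transforms are
  \<open>exp (- \<rho> * r)\<close>, \<open>1 / refl_sol \<rho> r\<close> and
  \<open>(1 + a) / (1 + a + \<rho>)\<close>, the last being the transform of the exponential law at
  \<open>\<rho>\<close>.\<close>

theorem proposition3p5:
  fixes M :: "'a measure" and B :: "real \<Rightarrow> 'a \<Rightarrow> real"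
  assumes "brownian_motion_with_drift M (1/2) B"
  shows
    "(\<forall>(N :: 'b measure) \<beta> (a :: real) r.
        brownian_motion_with_drift N (1/2) \<beta> \<and> a > 0 \<and> r = ln ((1 + a) / a) \<longrightarrow>
        identical_in_law
          M (\<lambda>\<omega>. \<integral>\<^sup>+s\<in>{0..}. ennreal (1 / (a * exp (B s \<omega>) + 1)^2) \<partial>lborel)
          N (hitting_time \<beta> (\<lambda>_. r)))
     \<and>
     (\<forall>(N :: 'c measure) \<beta> (a :: real) r.
        reflecting_brownian_motion_with_drift N (1/2) \<beta> \<and> a > 0 \<and> r = ln ((1 + a) / a) \<longrightarrow>
        identical_in_law
          M (\<lambda>\<omega>. \<integral>\<^sup>+s\<in>{0..}. ennreal (1 / (a * exp (B s \<omega>) + 1)^2)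
                      * indicator {s. B s \<omega> > 0} s \<partial>lborel)
          N (hitting_time \<beta> (\<lambda>_. r)))
     \<and>
     (\<forall>(N :: 'd measure) \<beta> (a :: real) \<Lambda>.
        brownian_motion_with_drift N (1/2) \<beta> \<and> a > -1 \<and>
        process_indep_var N \<beta> \<Lambda> \<and>
        distributed N lborel \<Lambda> (exponential_density (1 + a)) \<longrightarrow>
        identical_in_law
          M (\<lambda>\<omega>. \<integral>\<^sup>+s\<in>{0..}. ennreal (1 / (a * exp (B s \<omega>) + 1)^2)
                      * indicator {s. B s \<omega> < 0} s \<partial>lborel)
          N (hitting_time \<beta> \<Lambda>))"
proof -
  have sq: "1 / (a * exp x + 1)^2 = (slope a x)\<^sup>2" for a x :: real
    by (simp add: slope_def power_divide add.commute)
  interpret B: half_drift_bm M B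
    using assms by (rule half_drift_bmI)
  have scale: "(\<integral>\<omega>. exp_neg (of_nat n * (\<integral>\<^sup>+s\<in>{0..}. ennreal (\<phi> (B s \<omega>)) \<partial>lborel)) \<partial>M)
      = (\<integral>\<omega>. exp_neg (\<integral>\<^sup>+s\<in>{0..}. ennreal (real n * \<phi> (B s \<omega>)) \<partial>lborel) \<partial>M)"
    if "\<phi> \<in> borel_measurable borel" for n and \<phi> :: "real \<Rightarrow> real"
    by (rule Bochner_Integration.integral_cong[OF refl]) (simp add: B.additive_functional_cmult that)
  have pos_part: "ennreal (1 / (a * exp (B s \<omega>) + 1)^2) * indicator {s. 0 < B s \<omega>} s
      = ennreal ((slope a (B s \<omega>))\<^sup>2 * indicator {0<..} (B s \<omega>))"
    and neg_part: "ennreal (1 / (a * exp (B s \<omega>) + 1)^2) * indicator {s. B s \<omega> < 0} s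
      = ennreal ((slope a (B s \<omega>))\<^sup>2 * indicator {..<0} (B s \<omega>))" for a s \<omega>
    by (simp_all add: sq indicator_def)
  show ?thesis
  proof (intro conjI allI impI; elim conjE)
    fix N :: "'b measure" and \<beta> and a r :: real
    assume N: "brownian_motion_with_drift N (1/2) \<beta>" and a: "0 < a" and r: "r = ln ((1 + a) / a)"
    interpret N: half_drift_bm N \<beta>
      using N by (rule half_drift_bmI)
    have r0: "0 < r" using a by (simp add: r)
    show "identical_in_law M (\<lambda>\<omega>. \<integral>\<^sup>+s\<in>{0..}. ennreal (1 / (a * exp (B s \<omega>) + 1)^2) \<partial>lborel) N (hitting_time \<beta> (\<lambda>_. r))"
      unfolding sq
    proof (rule identical_in_law_if_laplace_eq[OF B.prob_space_axioms N.prob_space_axioms])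
      show "(\<lambda>\<omega>. \<integral>\<^sup>+s\<in>{0..}. ennreal ((slope a (B s \<omega>))\<^sup>2) \<partial>lborel) \<in> borel_measurable M"
        by (rule B.measurable_additive_functional) measurable
      show "hitting_time \<beta> (\<lambda>_. r) \<in> borel_measurable N"
        by (rule measurable_hitting_time) (use N.measurable_X N.continuous_X in auto)
      fix n :: nat assume "0 < n"
      then obtain \<rho> where \<rho>: "0 < \<rho>" "real n = \<rho> * (1 + \<rho>) / 2" by (rule quadratic_root)
      have "(\<integral>\<omega>. exp_neg (of_nat n * (\<integral>\<^sup>+s\<in>{0..}. ennreal ((slope a (B s \<omega>))\<^sup>2) \<partial>lborel)) \<partial>M) = exp (- \<rho> * r)"
        unfolding scale[of "\<lambda>x. (slope a x)\<^sup>2", simplified] r by (rule B.laplace_total[OF a \<rho>])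
      also have "\<dots> = (\<integral>\<omega>. exp_neg (of_nat n * hitting_time \<beta> (\<lambda>_. r) \<omega>) \<partial>N)"
        unfolding ennreal_of_nat_eq_real_of_nat by (rule N.laplace_hitting_time[OF r0 \<rho>, symmetric])
      finally show "(\<integral>\<omega>. exp_neg (of_nat n * (\<integral>\<^sup>+s\<in>{0..}. ennreal ((slope a (B s \<omega>))\<^sup>2) \<partial>lborel)) \<partial>M)
        = (\<integral>\<omega>. exp_neg (of_nat n * hitting_time \<beta> (\<lambda>_. r) \<omega>) \<partial>N)" .
    qed
  next
    fix N :: "'c measure" and \<beta> and a r :: real
    assume N: "reflecting_brownian_motion_with_drift N (1/2) \<beta>" and a: "0 < a" and r: "r = ln ((1 + a) / a)"
    from N obtain X where X: "brownian_motion_with_drift N (1/2) X"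
      and \<beta>: "\<And>t \<omega>. 0 \<le> t \<Longrightarrow> \<omega> \<in> space N \<Longrightarrow> \<beta> t \<omega> = X t \<omega> + (SUP s\<in>{0..t}. - X s \<omega>)"
      unfolding reflecting_brownian_motion_with_drift_def by blast
    interpret N: half_drift_bm N X
      using X by (rule half_drift_bmI)
    have r0: "0 < r" using a by (simp add: r)
    \<comment> \<open>\<open>\<beta>\<close> is prescribed only for \<open>t \<ge> 0\<close> and on
      \<open>space N\<close>, which is all that the hitting time uses.\<close>
    have hit_eq: "hitting_time \<beta> (\<lambda>_. r) \<omega> = hitting_time N.reflected (\<lambda>_. r) \<omega>" if "\<omega> \<in> space N" for \<omega>
      unfolding hitting_time_def using \<beta> that
      by (intro arg_cong[where f = Inf]) (auto simp: N.reflected_def regulator_def)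
    have mhit: "hitting_time N.reflected (\<lambda>_. r) \<in> borel_measurable N"
      by (rule measurable_hitting_time) (use N.measurable_reflected N.continuous_reflected in auto)
    let ?\<phi> = "\<lambda>x. (slope a x)\<^sup>2 * indicator {0<..} x"
    have \<phi>: "?\<phi> \<in> borel_measurable borel" by measurable
    show "identical_in_law M (\<lambda>\<omega>. \<integral>\<^sup>+s\<in>{0..}. ennreal (1 / (a * exp (B s \<omega>) + 1)^2) * indicator {s. 0 < B s \<omega>} s \<partial>lborel)
        N (hitting_time \<beta> (\<lambda>_. r))"
      unfolding pos_part
    proof (rule identical_in_law_if_laplace_eq[OF B.prob_space_axioms N.prob_space_axioms])
      show "(\<lambda>\<omega>. \<integral>\<^sup>+s\<in>{0..}. ennreal (?\<phi> (B s \<omega>)) \<partial>lborel) \<in> borel_measurable M"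
        by (rule B.measurable_additive_functional[OF \<phi>])
      show "hitting_time \<beta> (\<lambda>_. r) \<in> borel_measurable N"
        using mhit by (subst measurable_cong[OF hit_eq])
      fix n :: nat assume "0 < n"
      then obtain \<rho> where \<rho>: "0 < \<rho>" "real n = \<rho> * (1 + \<rho>) / 2" by (rule quadratic_root)
      have "(\<integral>\<omega>. exp_neg (of_nat n * (\<integral>\<^sup>+s\<in>{0..}. ennreal (?\<phi> (B s \<omega>)) \<partial>lborel)) \<partial>M) = 1 / refl_sol \<rho> r"
        unfolding scale[OF \<phi>] by (rule B.laplace_positive_part[OF a \<rho> r])
      also have "\<dots> = (\<integral>\<omega>. exp_neg (of_nat n * hitting_time N.reflected (\<lambda>_. r) \<omega>) \<partial>N)"
        unfolding ennreal_of_nat_eq_real_of_nat by (rule N.laplace_hitting_time_reflected[OF r0 \<rho>, symmetric])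
      also have "\<dots> = (\<integral>\<omega>. exp_neg (of_nat n * hitting_time \<beta> (\<lambda>_. r) \<omega>) \<partial>N)"
        by (rule Bochner_Integration.integral_cong[OF refl]) (simp add: hit_eq)
      finally show "(\<integral>\<omega>. exp_neg (of_nat n * (\<integral>\<^sup>+s\<in>{0..}. ennreal (?\<phi> (B s \<omega>)) \<partial>lborel)) \<partial>M)
        = (\<integral>\<omega>. exp_neg (of_nat n * hitting_time \<beta> (\<lambda>_. r) \<omega>) \<partial>N)" .
    qed
  next
    fix N :: "'d measure" and \<beta> and a :: real and \<Lambda>
    assume N: "brownian_motion_with_drift N (1/2) \<beta>" and a: "-1 < a"
      and ind: "process_indep_var N \<beta> \<Lambda>" and D: "distributed N lborel \<Lambda> (exponential_density (1 + a))"
    interpret N: half_drift_bm N \<beta>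
      using N by (rule half_drift_bmI)
    let ?\<phi> = "\<lambda>x. (slope a x)\<^sup>2 * indicator {..<0} x"
    have \<phi>: "?\<phi> \<in> borel_measurable borel" by measurable
    have a1: "0 < 1 + a" using a by simp
    show "identical_in_law M (\<lambda>\<omega>. \<integral>\<^sup>+s\<in>{0..}. ennreal (1 / (a * exp (B s \<omega>) + 1)^2) * indicator {s. B s \<omega> < 0} s \<partial>lborel)
        N (hitting_time \<beta> \<Lambda>)"
      unfolding neg_part
    proof (rule identical_in_law_if_laplace_eq[OF B.prob_space_axioms N.prob_space_axioms])
      show "(\<lambda>\<omega>. \<integral>\<^sup>+s\<in>{0..}. ennreal (?\<phi> (B s \<omega>)) \<partial>lborel) \<in> borel_measurable M"
        by (rule B.measurable_additive_functional[OF \<phi>])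
      have "\<Lambda> \<in> borel_measurable N" using distributed_measurable[OF D] by simp
      then show "hitting_time \<beta> \<Lambda> \<in> borel_measurable N"
        by (rule measurable_hitting_time[rotated]) (use N.measurable_X N.continuous_X in auto)
      fix n :: nat assume "0 < n"
      then obtain \<rho> where \<rho>: "0 < \<rho>" "real n = \<rho> * (1 + \<rho>) / 2" by (rule quadratic_root)
      have "(\<integral>\<omega>. exp_neg (of_nat n * (\<integral>\<^sup>+s\<in>{0..}. ennreal (?\<phi> (B s \<omega>)) \<partial>lborel)) \<partial>M) = (1 + a) / (1 + a + \<rho>)"
        unfolding scale[OF \<phi>] by (rule B.laplace_negative_part[OF a \<rho>])
      also have "\<dots> = (\<integral>\<omega>. exp_neg (of_nat n * hitting_time \<beta> \<Lambda> \<omega>) \<partial>N)"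
        unfolding ennreal_of_nat_eq_real_of_nat
        by (rule N.laplace_hitting_time_random_level[OF ind D a1 \<rho>, symmetric])
      finally show "(\<integral>\<omega>. exp_neg (of_nat n * (\<integral>\<^sup>+s\<in>{0..}. ennreal (?\<phi> (B s \<omega>)) \<partial>lborel)) \<partial>M)
        = (\<integral>\<omega>. exp_neg (of_nat n * hitting_time \<beta> \<Lambda> \<omega>) \<partial>N)" .
    qed
  qed
qed

end
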